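(* Let $L\ge1$, $N\ge2$ and let $\mathcal L=(K,S,\{f_s\}_{s\in S})$ be a subsystem of ($L$-dimensional hyper)cubic tiling. Assume that $\mathcal L$ is non-degenerate, locally symmetric and strongly connected, and that the following condition (SDR) holds: for any $j_1,j_2\in\{1,\dots,L\}$ with $j_1\ne j_2$ there exists $i\in\{1,-1\}$ such that $R^i_{j_1,j_2}\in\mathcal G_{(K,T)}$. Then $K$ is $p$-conductively homogeneous for every $p>\dim_{AR}(K,d_* )$, where $d_*$ is the restriction of the Euclidean metric to $K$.
   Context: Cubic tiling. $C_*=[-1,1]^L$; $\mathbb B_L=\{g\in O(L):g(C_* )=C_*\}$; $B_{j,i}=\{x\in C_*:x_j=i\}$ for $j\in\{1,\dots,L\}$, $i\in\{1,-1\}$. For $s\in\{1,\dots,N\}^L$, $C_s=\prod_{i=1}^L[\frac{2s_i-2-N}N,\frac{2s_i-N}N]$ and $c_s=(\frac{2s_1-1-N}N,\dots,\frac{2s_L-1-N}N)$. $R^i_{j_1,j_2}$ is the reflection of $\mathbb R^L$ in the hyperplane $\{x:x_{j_1}=ix_{j_2}\}$. A subsystem of cubic tiling is a triple $(K,S,\{f_s\}_{s\in S})$ with $S\subseteq\{1,\dots,N\}^L$, $f_s(x)=\frac1N\Phi_sx+c_s$ with $\Phi_s\in\mathbb B_L$ for $s\in S$, and $K\subseteq C_*$ the non-empty compact set with $K=\bigcup_{s\in S}f_s(K)$. Set $T_n=S^n$ (words of length $n$), $T=\bigcup_{n\ge0}T_n$, $f_w=f_{w_1}\circ\cdots\circ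 f_{w_n}$, $K_w=f_w(K)$. It is non-degenerate if $K\cap B_{j,i}\ne\emptyset$ for all $j\in\{1,\dots,L\}$, $i\in\{1,-1\}$. Let $E_n^\ell$ be the set of $(w,v)\in T_n^2$, $w\ne v$, such that $f_w(C_* )\cap f_v(C_* )=f_w(B_{j,i})$ for some $j\in\{1,\dots,L\}$, $i\in\{1,-1\}$. It is strongly connected if the graph $(T_n,E_n^\ell)$ is connected for all $n\ge1$; it is locally symmetric if for all $n\ge1$, $(w,v)\in E_n^\ell$, the set $K_w\cup K_v$ is invariant under the reflection in the hyperplane containing $f_w(C_* )\cap f_v(C_* )$. $\mathcal G_{(K,T)}$ is the set of homeomorphisms $g:K\to K$ for which there is $g^*:T\to T$ with $|g^*(w)|=|w|$ and $g(K_w)=K_{g^*(w)}$ for all $w\in T$ ($|w|$ is the word length); an isometry of $\mathbb R^L$ is said to belong to $\mathcal G_{(K,T)}$ if its restriction to $K$ does. Conductive homogeneity. For $w\in T$, $S^m(w)\subseteq T_{|w|+m}$ is the set of words of length $|w|+m$ with prefix $w$. $E_n^*=\{(w,v)\in T_n^2:w\neq v,K_w\cap K_v\ne\emptyset\}$, $\Gamma_1(w)=\{v\in T_{|w|}:K_v\cap K_w\ne\emptyset\}$. For $A\subseteq T_n$, $f:A\to\mathbb R$, $\mathcal E^n_{p,A}(f)=\frac12\sum_{u,v\in A,(u,v)\in E_n^*}|f(u)-f(v)|^p$. $\mathcal E_{1,p,m}=\sup_{w\in T,|w|\ge1}\inf\{\mathcal E^{|w|+m}_{p,T_{|w|+m}}(f):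 f=1\text{ on }S^m(w),\ f=0\text{ on }S^m(v)\text{ for all }v\in T_{|w|}\setminus\Gamma_1(w)\}$. $(f)_A$ is the arithmetic mean of $f$ over $A\subseteq T_n$ (the reference measure being the self-similar measure with $\mu(K_w)=(\#S)^{-|w|}$). $\sigma_{p,m}=\sup_{n\ge1}\sup_{(w,v)\in E_n^*}\sup_f|(f)_{S^m(w)}-(f)_{S^m(v)}|^p/\mathcal E^{n+m}_{p,S^m(w)\cup S^m(v)}(f)$, the last supremum over non-constant $f:S^m(w)\cup S^m(v)\to\mathbb R$. $K$ is $p$-conductively homogeneous if $\sup_{m\ge0}\sigma_{p,m}\mathcal E_{1,p,m}<\infty$. $\dim_{AR}(K,d)$ is the infimum of all $\alpha$ for which there exist a metric $\rho$ on $K$ quasisymmetric to $d$ and a Borel regular measure that is $\alpha$-Ahlfors regular with respect to $\rho$. *)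

theory Defs
  imports "HOL-Analysis.Analysis"
begin

section \<open>Words and the cubic tiling\<close>

definition words :: "'s set \<Rightarrow> nat \<Rightarrow> 's list set" where
  "words S n = {w. length w = n \<and> set w \<subseteq> S}"

definition all_words :: "'s set \<Rightarrow> 's list set" where
  "all_words S = (\<Union>n. words S n)"

definition word_map :: "('s \<Rightarrow> 'a \<Rightarrow> 'a) \<Rightarrow> 's list \<Rightarrow> 'a \<Rightarrow> 'a" where
  "word_map f w = foldr (\<lambda>s g. f s \<circ> g) w id"

definition cell :: "('s \<Rightarrow> 'a \<Rightarrow> 'a) \<Rightarrow> 'a set \<Rightarrow> 's list \<Rightarrow> 'a set" where
  "cell f K w = word_map f w ` K"

definition cube :: "(real ^ 'n) set" where
  "cube = {x. \<forall>i. -1 \<le> x $ i \<and> x $ i \<le> 1}"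

definition cube_symmetries :: "(real ^ 'n \<Rightarrow> real ^ 'n) set" where
  "cube_symmetries = {g. orthogonal_transformation g \<and> g ` cube = cube}"

definition face :: "'n \<Rightarrow> real \<Rightarrow> (real ^ 'n) set" where
  "face j i = {x \<in> cube. x $ j = i}"

definition center :: "nat \<Rightarrow> nat ^ 'n \<Rightarrow> real ^ 'n" where
  "center N s = (\<chi> i. (2 * real (s $ i) - 1 - real N) / real N)"

text \<open>The maps \<open>f s\<close> are constrained for \<open>s \<in> S\<close> only.  In every definition below they enter
  through words over \<open>S\<close> only.\<close>

definition cubic_subsystem ::
  "nat \<Rightarrow> (real ^ 'n) set \<Rightarrow> (nat ^ 'n) set \<Rightarrow> (nat ^ 'n \<Rightarrow> real ^ 'n \<Rightarrow> real ^ 'n) \<Rightarrow> bool" where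
  "cubic_subsystem N K S f \<longleftrightarrow>
     S \<subseteq> {s. \<forall>i. s $ i \<in> {1..N}} \<and>
     (\<forall>s\<in>S. \<exists>\<Phi>\<in>cube_symmetries. f s = (\<lambda>x. (1 / real N) *\<^sub>R \<Phi> x + center N s)) \<and>
     K \<noteq> {} \<and> compact K \<and> K \<subseteq> cube \<and> K = (\<Union>s\<in>S. f s ` K)"

definition nondegenerate :: "(real ^ 'n) set \<Rightarrow> bool" where
  "nondegenerate K \<longleftrightarrow> (\<forall>j. \<forall>i\<in>{1, -1}. K \<inter> face j i \<noteq> {})"

definition face_edges ::
  "'s set \<Rightarrow> ('s \<Rightarrow> real ^ 'n \<Rightarrow> real ^ 'n) \<Rightarrow> nat \<Rightarrow> ('s list \<times> 's list) set" where
  "face_edges S f n = {(w, v). w \<in> words S n \<and> v \<in> words S n \<and> w \<noteq> v \<and>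
     (\<exists>j. \<exists>i\<in>{1, -1}. word_map f w ` cube \<inter> word_map f v ` cube = word_map f w ` face j i)}"

text \<open>For a subsystem of cubic tiling the relation \<open>face_edges S f n\<close> is symmetric, as a face shared
  by two cubes of the grid is a face of both; so directed reachability is connectedness of the
  graph.\<close>

definition strongly_connected ::
  "'s set \<Rightarrow> ('s \<Rightarrow> real ^ 'n \<Rightarrow> real ^ 'n) \<Rightarrow> bool" where
  "strongly_connected S f \<longleftrightarrow>
     (\<forall>n\<ge>1. \<forall>w\<in>words S n. \<forall>v\<in>words S n. (w, v) \<in> (face_edges S f n)\<^sup>*)"

text \<open>Orthogonal reflection in the hyperplane \<open>{x. a \<bullet> x = b}\<close>, where \<open>a \<noteq> 0\<close>.\<close>

definition hyperplane_reflection :: "'a::real_inner \<Rightarrow> real \<Rightarrow> 'a \<Rightarrow> 'a" where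
  "hyperplane_reflection a b x = x - (2 * (a \<bullet> x - b) / (a \<bullet> a)) *\<^sub>R a"

text \<open>The hyperplane containing a common face exists and is unique, because the face has
  codimension one; the quantifier over \<open>a\<close>, \<open>b\<close> ranges over the equations of that hyperplane.\<close>

definition locally_symmetric ::
  "(real ^ 'n) set \<Rightarrow> 's set \<Rightarrow> ('s \<Rightarrow> real ^ 'n \<Rightarrow> real ^ 'n) \<Rightarrow> bool" where
  "locally_symmetric K S f \<longleftrightarrow>
     (\<forall>n\<ge>1. \<forall>(w, v) \<in> face_edges S f n. \<forall>a b. a \<noteq> 0 \<longrightarrow>
        word_map f w ` cube \<inter> word_map f v ` cube \<subseteq> {x. a \<bullet> x = b} \<longrightarrow>
        hyperplane_reflection a b ` (cell f K w \<union> cell f K v) = cell f K w \<union> cell f K v)"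

text \<open>The reflection in \<open>{x. x $ j1 = i * x $ j2}\<close>.\<close>

definition coord_reflection :: "'n \<Rightarrow> 'n \<Rightarrow> real \<Rightarrow> real ^ 'n \<Rightarrow> real ^ 'n" where
  "coord_reflection j1 j2 i = hyperplane_reflection (axis j1 1 - i *\<^sub>R axis j2 1) 0"

text \<open>Membership depends only on the restriction of \<open>g\<close> to \<open>K\<close>.\<close>

definition cell_homeos ::
  "'a::topological_space set \<Rightarrow> 's set \<Rightarrow> ('s \<Rightarrow> 'a \<Rightarrow> 'a) \<Rightarrow> ('a \<Rightarrow> 'a) set" where
  "cell_homeos K S f = {g. (\<exists>h. homeomorphism K K g h) \<and>
     (\<exists>g'. \<forall>w\<in>all_words S. g' w \<in> all_words S \<and> length (g' w) = length w \<and>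
        g ` cell f K w = cell f K (g' w))}"

definition SDR ::
  "(real ^ 'n) set \<Rightarrow> 's set \<Rightarrow> ('s \<Rightarrow> real ^ 'n \<Rightarrow> real ^ 'n) \<Rightarrow> bool" where
  "SDR K S f \<longleftrightarrow>
     (\<forall>j1 j2. j1 \<noteq> j2 \<longrightarrow> (\<exists>i\<in>{1, -1}. coord_reflection j1 j2 i \<in> cell_homeos K S f))"


section \<open>Conductive homogeneity\<close>

text \<open>Here \<open>X w\<close> stands for the cell \<open>K\<^sub>w\<close>.\<close>

definition descendants :: "'s set \<Rightarrow> nat \<Rightarrow> 's list \<Rightarrow> 's list set" where
  "descendants S m w = {v \<in> words S (length w + m). take (length w) v = w}"

definition cell_edges :: "'s set \<Rightarrow> ('s list \<Rightarrow> 'a set) \<Rightarrow> nat \<Rightarrow> ('s list \<times> 's list) set" where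
  "cell_edges S X n = {(w, v). w \<in> words S n \<and> v \<in> words S n \<and> w \<noteq> v \<and> X w \<inter> X v \<noteq> {}}"

definition neighbours :: "'s set \<Rightarrow> ('s list \<Rightarrow> 'a set) \<Rightarrow> 's list \<Rightarrow> 's list set" where
  "neighbours S X w = {v \<in> words S (length w). X v \<inter> X w \<noteq> {}}"

definition p_energy ::
  "'s set \<Rightarrow> ('s list \<Rightarrow> 'a set) \<Rightarrow> real \<Rightarrow> nat \<Rightarrow> 's list set \<Rightarrow> ('s list \<Rightarrow> real) \<Rightarrow> real" where
  "p_energy S X p n A \<phi> =
     1 / 2 * (\<Sum>(u, v) \<in> (A \<times> A) \<inter> cell_edges S X n. \<bar>\<phi> u - \<phi> v\<bar> powr p)"

text \<open>Suprema and infima are taken in \<open>[0, \<infinity>]\<close>.  Functions on a set of words are represented by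
  functions on all lists, of which only the values on that set matter.\<close>

definition conductance_const ::
  "'s set \<Rightarrow> ('s list \<Rightarrow> 'a set) \<Rightarrow> real \<Rightarrow> nat \<Rightarrow> ennreal" where
  "conductance_const S X p m =
     (SUP w \<in> {w \<in> all_words S. length w \<ge> 1}.
        INF \<phi> \<in> {\<phi>. (\<forall>u\<in>descendants S m w. \<phi> u = 1) \<and>
                   (\<forall>v \<in> words S (length w) - neighbours S X w. \<forall>u\<in>descendants S m v. \<phi> u = 0)}.
          ennreal (p_energy S X p (length w + m) (words S (length w + m)) \<phi>))"

definition avg :: "('s list \<Rightarrow> real) \<Rightarrow> 's list set \<Rightarrow> real" where
  "avg \<phi> A = (\<Sum>u\<in>A. \<phi> u) / real (card A)"

text \<open>In \<open>ennreal\<close>, a quotient \<open>a / 0\<close> is \<open>\<infinity>\<close> for \<open>a > 0\<close> and \<open>0\<close> for \<open>a = 0\<close>.\<close>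

definition neighbour_disparity ::
  "'s set \<Rightarrow> ('s list \<Rightarrow> 'a set) \<Rightarrow> real \<Rightarrow> nat \<Rightarrow> ennreal" where
  "neighbour_disparity S X p m =
     (SUP n \<in> {1..}. SUP (w, v) \<in> cell_edges S X n.
        SUP \<phi> \<in> {\<phi>. \<not> \<phi> constant_on (descendants S m w \<union> descendants S m v)}.
          ennreal (\<bar>avg \<phi> (descendants S m w) - avg \<phi> (descendants S m v)\<bar> powr p) /
          ennreal (p_energy S X p (n + m) (descendants S m w \<union> descendants S m v) \<phi>))"

definition conductively_homogeneous ::
  "'s set \<Rightarrow> ('s list \<Rightarrow> 'a set) \<Rightarrow> real \<Rightarrow> bool" where
  "conductively_homogeneous S X p \<longleftrightarrow>
     (SUP m. neighbour_disparity S X p m * conductance_const S X p m) < \<infinity>"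


section \<open>Ahlfors regular conformal dimension\<close>

definition quasisymmetric_metrics ::
  "'a set \<Rightarrow> ('a \<Rightarrow> 'a \<Rightarrow> real) \<Rightarrow> ('a \<Rightarrow> 'a \<Rightarrow> real) \<Rightarrow> bool" where
  "quasisymmetric_metrics M d \<rho> \<longleftrightarrow>
     (\<exists>\<theta> \<theta>'. homeomorphism {0::real..} {0..} \<theta> \<theta>' \<and>
        (\<forall>x\<in>M. \<forall>y\<in>M. \<forall>z\<in>M. x \<noteq> z \<longrightarrow> \<rho> x y / \<rho> x z \<le> \<theta> (d x y / d x z)))"

definition metric_borel_sets :: "'a set \<Rightarrow> ('a \<Rightarrow> 'a \<Rightarrow> real) \<Rightarrow> 'a set set" where
  "metric_borel_sets M \<rho> = sigma_sets M {U. openin (Metric_space.mtopology M \<rho>) U}"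

definition borel_regular :: "'a set \<Rightarrow> ('a \<Rightarrow> 'a \<Rightarrow> real) \<Rightarrow> 'a measure \<Rightarrow> bool" where
  "borel_regular M \<rho> \<mu> \<longleftrightarrow> space \<mu> = M \<and> metric_borel_sets M \<rho> \<subseteq> sets \<mu> \<and>
     (\<forall>A\<in>sets \<mu>. \<exists>B\<in>metric_borel_sets M \<rho>. A \<subseteq> B \<and> emeasure \<mu> A = emeasure \<mu> B)"

text \<open>Radii range over \<open>0 < r \<le> diam(M, \<rho>)\<close>; the diameter is taken in \<open>[0, \<infinity>]\<close>.\<close>

definition ahlfors_regular ::
  "'a set \<Rightarrow> ('a \<Rightarrow> 'a \<Rightarrow> real) \<Rightarrow> real \<Rightarrow> 'a measure \<Rightarrow> bool" where
  "ahlfors_regular M \<rho> \<alpha> \<mu> \<longleftrightarrow>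
     (\<exists>c1>0. \<exists>c2>0. \<forall>x\<in>M. \<forall>r>0. ereal r \<le> (SUP y\<in>M. SUP z\<in>M. ereal (\<rho> y z)) \<longrightarrow>
        ennreal (c1 * r powr \<alpha>) \<le> emeasure \<mu> (Metric_space.mball M \<rho> x r) \<and>
        emeasure \<mu> (Metric_space.mball M \<rho> x r) \<le> ennreal (c2 * r powr \<alpha>))"

text \<open>The infimum of the empty set is \<open>\<infinity>\<close>.\<close>

definition dim_AR :: "'a set \<Rightarrow> ('a \<Rightarrow> 'a \<Rightarrow> real) \<Rightarrow> ereal" where
  "dim_AR M d = Inf {ereal \<alpha> | \<alpha>. \<alpha> \<ge> 0 \<and>
     (\<exists>\<rho> \<mu>. Metric_space M \<rho> \<and> quasisymmetric_metrics M d \<rho> \<and>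
        borel_regular M \<rho> \<mu> \<and> ahlfors_regular M \<rho> \<alpha> \<mu>)}"

end

theory Submission
  imports Defs
begin

text \<open>Local symmetry and strong connectedness make the folding of \<open>\<real>\<^sup>L\<close> along the hyperplanes of the
  level-\<open>n\<close> grid identify all level-\<open>n\<close> cells with one copy of \<open>K\<close>.  A path that leaves the
  neighbourhood of a cell crosses a full strip of a slightly finer grid, and folding turns it into a
  path in \<open>T\<^sub>m\<close> joining two opposite faces.  Hence, if \<open>\<phi>\<close> has small energy on \<open>T\<^sub>m\<close>, there is such a
  crossing along which \<open>\<phi>\<close> varies by at most a constant times the \<open>1/p\<close>-th power of energy over
  conductance: otherwise the folded gradient of \<open>\<phi>\<close> would be a cut-off weight of too small energy.
  A crossing in direction \<open>j\<close> meets its images under the diagonal reflections of (SDR), as it crosses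
  their hyperplanes; the union is a connected set touching all faces.  Unfolded to the cells of level
  \<open>k\<close>, these sets link up, so the oscillation at level \<open>k + m\<close> is controlled by the oscillation at level
  \<open>m\<close> and the inverse conductance.  The conductance is submultiplicative, and it tends to \<open>0\<close>
  because \<open>p > dim_AR\<close>, by means of cut-off functions that are Lipschitz in a quasisymmetric Ahlfors
  regular metric; for \<open>k\<close> large the recursion bounds the oscillation by a multiple of the inverse
  conductance.\<close>

section \<open>Connected sets of vertices\<close>

definition conn :: "('v \<times> 'v) set \<Rightarrow> 'v set \<Rightarrow> bool" where
  "conn E U \<longleftrightarrow> (\<forall>x\<in>U. \<forall>y\<in>U. (x, y) \<in> (E \<inter> U \<times> U)\<^sup>*)"

lemma connI_root:
  assumes "sym E" "r \<in> U" "\<And>x. x \<in> U \<Longrightarrow> (r, x) \<in> (E \<inter> U \<times> U)\<^sup>*"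
  shows "conn E U"
proof -
  have "sym (E \<inter> U \<times> U)" using assms(1) by (auto simp: sym_def)
  then have "sym ((E \<inter> U \<times> U)\<^sup>*)" by (rule sym_rtrancl)
  then show ?thesis unfolding conn_def using assms(3) by (meson rtrancl_trans symD)
qed

lemma conn_mono_rtrancl:
  assumes "(x, y) \<in> (E \<inter> U \<times> U)\<^sup>*" "U \<subseteq> V" shows "(x, y) \<in> (E \<inter> V \<times> V)\<^sup>*"
proof -
  have "E \<inter> U \<times> U \<subseteq> E \<inter> V \<times> V" using assms(2) by auto
  then show ?thesis using rtrancl_mono assms(1) by blast
qed

lemma conn_singleton: "conn E {x}"
  by (simp add: conn_def)

lemma conn_insert:
  assumes "sym E" "conn E U" "u \<in> U" "(u, v) \<in> E"
  shows "conn E (insert v U)"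
proof (rule connI_root[OF assms(1)])
  show "u \<in> insert v U" using assms by simp
  fix x assume "x \<in> insert v U"
  then consider "x = v" | "x \<in> U" by auto
  then show "(u, x) \<in> (E \<inter> insert v U \<times> insert v U)\<^sup>*"
  proof cases
    case 1 then show ?thesis using assms by (intro r_into_rtrancl) auto
  next
    case 2
    then have "(u, x) \<in> (E \<inter> U \<times> U)\<^sup>*" using assms(2,3) unfolding conn_def by blast
    then show ?thesis by (rule conn_mono_rtrancl) auto
  qed
qed

lemma conn_Un:
  assumes "sym E" "conn E U" "conn E V" "u \<in> U" "v \<in> V" "u = v \<or> (u, v) \<in> E"
  shows "conn E (U \<union> V)"
proof (rule connI_root[OF assms(1)])
  show "u \<in> U \<union> V" using assms by simp
  fix x assume "x \<in> U \<union> V"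
  then consider "x \<in> U" | "x \<in> V" by auto
  then show "(u, x) \<in> (E \<inter> (U \<union> V) \<times> (U \<union> V))\<^sup>*"
  proof cases
    case 1
    then have "(u, x) \<in> (E \<inter> U \<times> U)\<^sup>*" using assms(2,4) unfolding conn_def by blast
    then show ?thesis by (rule conn_mono_rtrancl) auto
  next
    case 2
    have "(u, v) \<in> (E \<inter> (U \<union> V) \<times> (U \<union> V))\<^sup>*" using assms(4-6) by auto
    moreover have "(v, x) \<in> (E \<inter> V \<times> V)\<^sup>*" using assms(3,5) 2 unfolding conn_def by blast
    then have "(v, x) \<in> (E \<inter> (U \<union> V) \<times> (U \<union> V))\<^sup>*" by (rule conn_mono_rtrancl) auto
    ultimately show ?thesis by (rule rtrancl_trans)
  qed
qed

lemma conn_UN: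
  assumes "sym E" "r \<in> R" "conn E R" "\<And>i. i \<in> I \<Longrightarrow> conn E (R \<union> U i)"
  shows "conn E (R \<union> (\<Union>i\<in>I. U i))"
proof (rule connI_root[OF assms(1), of r])
  show "r \<in> R \<union> (\<Union>i\<in>I. U i)" using assms by simp
  fix x assume "x \<in> R \<union> (\<Union>i\<in>I. U i)"
  then consider "x \<in> R" | i where "i \<in> I" "x \<in> U i" by blast
  then show "(r, x) \<in> (E \<inter> (R \<union> (\<Union>i\<in>I. U i)) \<times> (R \<union> (\<Union>i\<in>I. U i)))\<^sup>*"
  proof cases
    case 1
    then have "(r, x) \<in> (E \<inter> R \<times> R)\<^sup>*" using assms(2,3) unfolding conn_def by blast
    then show ?thesis by (rule conn_mono_rtrancl) auto
  next
    case (2 i)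
    then have "(r, x) \<in> (E \<inter> (R \<union> U i) \<times> (R \<union> U i))\<^sup>*"
      using assms(4)[OF 2(1)] assms(2) unfolding conn_def by blast
    then show ?thesis by (rule conn_mono_rtrancl) (use 2 in auto)
  qed
qed

lemma conn_image:
  assumes "conn E U" "\<And>u v. u \<in> U \<Longrightarrow> v \<in> U \<Longrightarrow> (u, v) \<in> E \<Longrightarrow> (h u, h v) \<in> E'"
  shows "conn E' (h ` U)"
proof -
  have "(h x, h y) \<in> (E' \<inter> h ` U \<times> h ` U)\<^sup>*" if "(x, y) \<in> (E \<inter> U \<times> U)\<^sup>*" for x y
    using that
  proof induction
    case (step y z)
    then have "(h y, h z) \<in> E' \<inter> h ` U \<times> h ` U" using assms(2) by auto
    then show ?case using step.IH by (meson rtrancl.rtrancl_into_rtrancl)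
  qed simp
  then show ?thesis using assms(1) unfolding conn_def by blast
qed

lemma last_exit:
  assumes "(x, y) \<in> R\<^sup>*" "x \<in> A" "y \<notin> A"
  shows "\<exists>a b. a \<in> A \<and> b \<notin> A \<and> (a, b) \<in> R \<and> (b, y) \<in> (R \<inter> (-A) \<times> (-A))\<^sup>*"
  using assms
proof (induction)
  case (step y z)
  show ?case
  proof (cases "y \<in> A")
    case True then show ?thesis using step by blast
  next
    case False
    then obtain a b where "a \<in> A" "b \<notin> A" "(a, b) \<in> R" "(b, y) \<in> (R \<inter> (-A) \<times> (-A))\<^sup>*"
      using step by blast
    moreover have "(y, z) \<in> R \<inter> (-A) \<times> (-A)" using step False by auto
    ultimately show ?thesis by (meson rtrancl.rtrancl_into_rtrancl)
  qed
qed simp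

lemma conn_reachable:
  assumes "sym E" shows "conn E {z. (b, z) \<in> (E \<inter> B \<times> B)\<^sup>*}" (is "conn E ?R")
proof (rule connI_root[OF assms])
  fix z assume "z \<in> ?R"
  then have "(b, z) \<in> (E \<inter> B \<times> B)\<^sup>*" by simp
  then show "(b, z) \<in> (E \<inter> ?R \<times> ?R)\<^sup>*"
  proof induction
    case (step y z)
    then have "(b, z) \<in> (E \<inter> B \<times> B)\<^sup>*" by (rule_tac rtrancl_into_rtrancl)
    then have "(y, z) \<in> E \<inter> ?R \<times> ?R" using step by auto
    then show ?case using step.IH by (rule_tac rtrancl_into_rtrancl)
  qed simp
qed simp

lemma conn_last_exit:
  assumes "sym E" "conn E U" "x \<in> U" "x \<in> A" "y \<in> U" "y \<notin> A"
  obtains a b W where "W \<subseteq> U - A" "conn E (insert a W)" "a \<in> U" "a \<in> A" "b \<in> W" "y \<in> W" "(a, b) \<in> E"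
proof -
  have "(x, y) \<in> (E \<inter> U \<times> U)\<^sup>*" using assms by (simp add: conn_def)
  from last_exit[OF this assms(4,6)] obtain a b where
    ab: "a \<in> A" "b \<notin> A" "(a, b) \<in> E \<inter> U \<times> U" "(b, y) \<in> ((E \<inter> U \<times> U) \<inter> (-A) \<times> (-A))\<^sup>*" by blast
  have eq: "(E \<inter> U \<times> U) \<inter> (-A) \<times> (-A) = E \<inter> (U - A) \<times> (U - A)" by auto
  define W where "W = {z. (b, z) \<in> (E \<inter> (U - A) \<times> (U - A))\<^sup>*}"
  have b: "b \<in> W" by (simp add: W_def)
  have "(b, a) \<in> E" using ab(3) assms(1) by (auto dest: symD)
  then have c: "conn E (insert a W)"
    using conn_insert[OF assms(1) conn_reachable[OF assms(1)]] b unfolding W_def by blast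
  have "W \<subseteq> U - A"
  proof
    fix z assume "z \<in> W"
    then have "(b, z) \<in> (E \<inter> (U - A) \<times> (U - A))\<^sup>*" by (simp add: W_def)
    then show "z \<in> U - A" by (cases rule: rtranclE) (use ab in auto)
  qed
  then show ?thesis using that c b ab unfolding eq W_def by blast
qed

lemma rtrancl_variation:
  fixes \<phi> :: "'v \<Rightarrow> real"
  assumes "finite U" "(x, y) \<in> (E \<inter> U \<times> U)\<^sup>*"
    "\<And>u v. u \<in> U \<Longrightarrow> v \<in> U \<Longrightarrow> (u, v) \<in> E \<Longrightarrow> \<bar>\<phi> u - \<phi> v\<bar> \<le> a u"
    "\<And>u. u \<in> U \<Longrightarrow> 0 \<le> a u"
  shows "\<bar>\<phi> x - \<phi> y\<bar> \<le> sum a U"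
  using assms
proof (induction "card U" arbitrary: U x rule: less_induct)
  case less
  show ?case
  proof (cases "x = y")
    case True then show ?thesis using less.prems(4) by (simp add: sum_nonneg)
  next
    case False
    then obtain b where b: "b \<noteq> x" "(x, b) \<in> E \<inter> U \<times> U"
      "(b, y) \<in> ((E \<inter> U \<times> U) \<inter> (-{x}) \<times> (-{x}))\<^sup>*"
      using last_exit[OF less.prems(2), of "{x}"] by auto
    have eq: "(E \<inter> U \<times> U) \<inter> (-{x}) \<times> (-{x}) = E \<inter> (U - {x}) \<times> (U - {x})" by auto
    have xU: "x \<in> U" using b by auto
    have "\<bar>\<phi> b - \<phi> y\<bar> \<le> sum a (U - {x})"
    proof (rule less.hyps)
      show "card (U - {x}) < card U" using less.prems(1) xU by (rule card_Diff1_less)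
    qed (use less.prems b eq in auto)
    moreover have "\<bar>\<phi> x - \<phi> b\<bar> \<le> a x" using b less.prems(3) by auto
    moreover have "sum a U = a x + sum a (U - {x})" using less.prems(1) xU by (simp add: sum.remove)
    ultimately show ?thesis by linarith
  qed
qed

lemma conn_variation:
  fixes \<phi> :: "'v \<Rightarrow> real"
  assumes "finite U" "conn E U" "x \<in> U" "y \<in> U"
    "\<And>u v. u \<in> U \<Longrightarrow> v \<in> U \<Longrightarrow> (u, v) \<in> E \<Longrightarrow> \<bar>\<phi> u - \<phi> v\<bar> \<le> a u"
    "\<And>u. u \<in> U \<Longrightarrow> 0 \<le> a u"
  shows "\<bar>\<phi> x - \<phi> y\<bar> \<le> sum a U"
  using assms rtrancl_variation[of U x y E \<phi> a] unfolding conn_def by blast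

text \<open>The potential is the distance to \<open>A\<close> with respect to the vertex weight \<open>\<rho>\<close>, rescaled and
  truncated; the length of a path is replaced by the weight of a connected set.\<close>

lemma potential:
  fixes \<rho> :: "'v \<Rightarrow> real"
  assumes "finite V" "sym E" "\<forall>u\<in>V. 0 \<le> \<rho> u" "0 < t"
  shows "\<exists>\<phi>. (\<forall>u\<in>A. \<phi> u = 0) \<and>
    (\<forall>u\<in>V. \<forall>v\<in>V. (u, v) \<in> E \<longrightarrow> \<bar>\<phi> u - \<phi> v\<bar> \<le> \<rho> u / t + \<rho> v / t) \<and>
    (\<forall>y\<in>V - A. (\<forall>U\<subseteq>V. conn E U \<longrightarrow> y \<in> U \<longrightarrow> U \<inter> A \<noteq> {} \<longrightarrow> t \<le> sum \<rho> U) \<longrightarrow> \<phi> y = (1::real))"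
proof -
  define P where "P u = {U. U \<subseteq> V \<and> conn E U \<and> u \<in> U \<and> U \<inter> A \<noteq> {}}" for u
  define d where "d u = Min (sum \<rho> ` P u)" for u
  define \<phi> where "\<phi> u = (if u \<in> A then 0 else if P u = {} then 1 else min 1 (d u / t))" for u
  have finP: "finite (P u)" for u
    by (rule finite_subset[of _ "Pow V"]) (use assms(1) in \<open>auto simp: P_def\<close>)
  have pos: "0 \<le> sum \<rho> U" if "U \<in> P u" for U u
    using that assms(3) by (intro sum_nonneg) (auto simp: P_def)
  have d_le: "d u \<le> sum \<rho> U" if "U \<in> P u" for U u
    unfolding d_def using finP that by (intro Min_le) auto
  have d_ex: "\<exists>U\<in>P u. d u = sum \<rho> U" if "P u \<noteq> {}" for u
  proof -
    have "d u \<in> sum \<rho> ` P u" unfolding d_def using finP that by (intro Min_in) auto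
    then show ?thesis by auto
  qed
  have d_nn: "0 \<le> d u" if "P u \<noteq> {}" for u using d_ex[OF that] pos by auto
  have ext: "P v \<noteq> {} \<and> d v \<le> d u + \<rho> v" if h: "P u \<noteq> {}" "(u, v) \<in> E" "v \<in> V" for u v
  proof -
    obtain U where U: "U \<in> P u" "d u = sum \<rho> U" using d_ex[OF h(1)] by auto
    have "insert v U \<in> P v" using U(1) h conn_insert[OF assms(2)] unfolding P_def by blast
    moreover have "sum \<rho> (insert v U) \<le> sum \<rho> U + \<rho> v"
      using U(1) assms(1,3) h finite_subset[of U V]
      by (cases "v \<in> U") (auto simp: P_def insert_absorb)
    ultimately show ?thesis using d_le[of "insert v U" v] U by fastforce
  qed
  have A_P: "{u, v} \<in> P v" if "u \<in> A" "u \<in> V" "v \<in> V" "(u, v) \<in> E" for u v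
    using that conn_insert[OF assms(2) conn_singleton[of E u], of u v]
    by (auto simp: P_def insert_commute)
  have sm: "\<bar>\<phi> u - \<phi> v\<bar> \<le> \<rho> u / t + \<rho> v / t" if uv: "(u, v) \<in> E" "u \<in> V" "v \<in> V" for u v
  proof -
    have vu: "(v, u) \<in> E" using uv assms(2) by (auto dest: symD)
    have nn: "0 \<le> \<rho> u / t" "0 \<le> \<rho> v / t" using assms(3,4) uv by auto
    have mixed: "\<bar>\<phi> v\<bar> \<le> \<rho> u / t + \<rho> v / t"
      if "u \<in> A" "v \<notin> A" "(u, v) \<in> E" "u \<in> V" "v \<in> V" for u v
    proof -
      have "{u, v} \<in> P v" using A_P that by blast
      moreover have "u \<noteq> v" using that by auto
      then have "sum \<rho> {u, v} = \<rho> u + \<rho> v" by simp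
      ultimately have d: "d v \<le> \<rho> u + \<rho> v" "P v \<noteq> {}" using d_le by force+
      have "0 \<le> d v / t" "d v / t \<le> (\<rho> u + \<rho> v) / t"
        using d_nn d assms(4) by (auto simp: divide_right_mono)
      then show ?thesis using that d by (simp add: \<phi>_def add_divide_distrib)
    qed
    consider "u \<in> A" "v \<in> A" | "u \<in> A" "v \<notin> A" | "u \<notin> A" "v \<in> A"
      | "u \<notin> A" "v \<notin> A" "P u = {}" | "u \<notin> A" "v \<notin> A" "P u \<noteq> {}" by blast
    then show ?thesis
    proof cases
      case 1 then show ?thesis using nn by (simp add: \<phi>_def)
    next
      case 2 then show ?thesis using mixed[of u v] uv by (simp add: \<phi>_def)
    next
      case 3 then show ?thesis using mixed[of v u] uv vu by (simp add: \<phi>_def)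
    next
      case 4 then have "P v = {}" using ext[OF _ vu] uv by blast
      then show ?thesis using 4 nn by (simp add: \<phi>_def)
    next
      case 5
      have v: "P v \<noteq> {}" "d v \<le> d u + \<rho> v" using ext[of u v] uv 5 by auto
      have u: "d u \<le> d v + \<rho> u" using ext[of v u] uv vu v by auto
      have "d v / t \<le> d u / t + \<rho> v / t" "d u / t \<le> d v / t + \<rho> u / t"
        using v u assms(4) by (auto simp: field_simps)
      then show ?thesis using 5 v nn by (auto simp: \<phi>_def min_def abs_if)
    qed
  qed
  show ?thesis
  proof (intro exI[of _ \<phi>] conjI ballI impI)
    show "\<phi> u = 0" if "u \<in> A" for u using that by (simp add: \<phi>_def)
    show "\<bar>\<phi> u - \<phi> v\<bar> \<le> \<rho> u / t + \<rho> v / t" if "u \<in> V" "v \<in> V" "(u, v) \<in> E" for u v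
      using sm that by blast
    fix y assume y: "y \<in> V - A"
      "\<forall>U\<subseteq>V. conn E U \<longrightarrow> y \<in> U \<longrightarrow> U \<inter> A \<noteq> {} \<longrightarrow> t \<le> sum \<rho> U"
    show "\<phi> y = 1"
    proof (cases "P y = {}")
      case True then show ?thesis using y by (simp add: \<phi>_def)
    next
      case False
      then obtain U where "U \<in> P y" "d y = sum \<rho> U" using d_ex by blast
      then have "t \<le> d y" using y(2) by (simp add: P_def)
      then show ?thesis using y(1) False assms(4) by (simp add: \<phi>_def min_def divide_le_eq_1)
    qed
  qed
qed

section \<open>Power sums\<close>

lemma sum_powr_le:
  fixes x :: "'i \<Rightarrow> real"
  assumes "finite I" "\<And>i. i \<in> I \<Longrightarrow> 0 \<le> x i" "0 < p"
  shows "(sum x I) powr p \<le> real (card I) powr p * (\<Sum>i\<in>I. x i powr p)"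
proof (cases "I = {}")
  case False
  define M where "M = Max (x ` I)"
  have M: "M \<in> x ` I" unfolding M_def using assms False by (intro Max_in) auto
  then obtain j where j: "j \<in> I" "M = x j" by auto
  have "sum x I \<le> (\<Sum>i\<in>I. M)"
    unfolding M_def using assms by (intro sum_mono Max_ge) auto
  then have "sum x I \<le> real (card I) * M" by simp
  then have "(sum x I) powr p \<le> (real (card I) * M) powr p"
    using assms by (intro powr_mono2) (auto intro: sum_nonneg)
  also have "\<dots> = real (card I) powr p * M powr p"
    using assms j by (simp add: powr_mult)
  also have "M powr p \<le> (\<Sum>i\<in>I. x i powr p)"
    unfolding j(2) using assms j by (intro member_le_sum) auto
  finally show ?thesis by (simp add: mult_left_mono)
qed simp

lemma sum_powr_le_bound:
  fixes x :: "'i \<Rightarrow> real"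
  assumes "finite I" "\<And>i. i \<in> I \<Longrightarrow> 0 \<le> x i" "0 < p" "real (card I) \<le> c"
  shows "(sum x I) powr p \<le> c powr p * (\<Sum>i\<in>I. x i powr p)"
proof -
  have "real (card I) powr p * (\<Sum>i\<in>I. x i powr p) \<le> c powr p * (\<Sum>i\<in>I. x i powr p)"
    using assms by (intro mult_right_mono powr_mono2 sum_nonneg) auto
  moreover have "sum x I powr p \<le> real (card I) powr p * (\<Sum>i\<in>I. x i powr p)"
    by (rule sum_powr_le) (use assms in auto)
  ultimately show ?thesis by linarith
qed

lemma add_powr_le:
  fixes x y :: real
  assumes "0 \<le> x" "0 \<le> y" "0 < p"
  shows "(x + y) powr p \<le> 2 powr p * (x powr p + y powr p)"
  using sum_powr_le_bound[of "{True, False}" "\<lambda>b. if b then x else y" p 2] assms by simp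

lemma add3_powr_le:
  fixes x y z :: real
  assumes "0 \<le> x" "0 \<le> y" "0 \<le> z" "0 < p"
  shows "(x + y + z) powr p \<le> 3 powr p * (x powr p + y powr p + z powr p)"
  using sum_powr_le_bound[of "{0, 1, 2::nat}" "\<lambda>b. if b = 0 then x else if b = 1 then y else z" p 3]
    assms by (simp add: add.assoc)

section \<open>Signed permutations\<close>

definition signed_perm :: "(real ^ 'n \<Rightarrow> real ^ 'n) \<Rightarrow> bool" where
  "signed_perm g \<longleftrightarrow> (\<exists>\<pi> e. bij \<pi> \<and> (\<forall>i. e i \<in> {1, -1}) \<and> g = (\<lambda>x. \<chi> i. e i * x $ \<pi> i))"

lemma cube_symmetries_signed_perm:
  fixes g :: "real ^ 'n \<Rightarrow> real ^ 'n"
  assumes "g \<in> cube_symmetries"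
  shows "signed_perm g"
proof -
  define A where "A = matrix g"
  have lin: "linear g" and orth: "orthogonal_matrix A" and im: "g ` cube = cube"
    using assms by (auto simp: cube_symmetries_def orthogonal_transformation_matrix A_def)
  have gA: "g x $ i = (\<Sum>k\<in>UNIV. A $ i $ k * x $ k)" for x i
    proof -
    have "g x = A *v x" unfolding A_def by (simp only: matrix_vector_mul(2)[OF lin])
    then have "g x $ i = (A *v x) $ i" by (rule arg_cong)
    also have "\<dots> = (\<Sum>k\<in>UNIV. A $ i $ k * x $ k)" by (simp only: matrix_vector_mult_def vec_lambda_beta)
    finally show ?thesis .
  qed
  have rows: "(\<Sum>k\<in>UNIV. (A $ i $ k)\<^sup>2) = 1" for i
  proof -
    have "row i A \<bullet> row i A = 1"
      using orth unfolding orthogonal_matrix_orthonormal_rows norm_eq_1 by blast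
    then show ?thesis by (simp add: inner_vec_def row_def power2_eq_square)
  qed
  have orows: "(\<Sum>k\<in>UNIV. A $ i $ k * A $ j $ k) = 0" if "i \<noteq> j" for i j
  proof -
    have "row i A \<bullet> row j A = 0"
      using orth that unfolding orthogonal_matrix_orthonormal_rows orthogonal_def by blast
    then show ?thesis by (simp add: inner_vec_def row_def)
  qed
  have l1: "(\<Sum>k\<in>UNIV. \<bar>A $ i $ k\<bar>) \<le> 1" for i
  proof -
    define x :: "real ^ 'n" where "x = (\<chi> k. sgn (A $ i $ k))"
    have "x \<in> cube" by (auto simp: cube_def x_def sgn_if)
    then have "g x \<in> cube" using im by auto
    then have "g x $ i \<le> 1" by (auto simp: cube_def)
    then show ?thesis unfolding gA x_def by (simp add: abs_sgn[symmetric])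
  qed
  have a1: "\<bar>A $ i $ k\<bar> \<le> 1" for i k
    using member_le_sum[of k UNIV "\<lambda>k. \<bar>A $ i $ k\<bar>"] l1[of i] by simp
  have sq: "(A $ i $ k)\<^sup>2 = \<bar>A $ i $ k\<bar>" for i k
  proof -
    have le: "(A $ i $ k)\<^sup>2 \<le> \<bar>A $ i $ k\<bar>" for k
      using mult_left_le[OF a1[of i k] abs_ge_zero[of "A $ i $ k"]] by (simp add: power2_eq_square abs_mult_self_eq)
    have "(\<Sum>k\<in>UNIV. \<bar>A $ i $ k\<bar> - (A $ i $ k)\<^sup>2) \<le> 0"
      using l1[of i] rows[of i] by (simp add: sum_subtractf)
    moreover have "\<bar>A $ i $ k\<bar> - (A $ i $ k)\<^sup>2 \<le> (\<Sum>k\<in>UNIV. \<bar>A $ i $ k\<bar> - (A $ i $ k)\<^sup>2)"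
      by (rule member_le_sum) (use le in auto)
    ultimately show ?thesis using le[of k] by linarith
  qed
  have val: "A $ i $ k \<in> {0, 1, -1}" for i k
  proof -
    have "\<bar>A $ i $ k\<bar> * \<bar>A $ i $ k\<bar> = \<bar>A $ i $ k\<bar> * 1"
      unfolding abs_mult_self_eq using sq[of i k] by (simp only: power2_eq_square mult_1_right)
    then have "\<bar>A $ i $ k\<bar> = 0 \<or> \<bar>A $ i $ k\<bar> = 1" unfolding mult_cancel_left by blast
    then show ?thesis by (simp add: abs_eq_iff')
  qed
  have ex: "\<exists>k. A $ i $ k \<noteq> 0" for i
  proof (rule ccontr)
    assume "\<not> ?thesis"
    then have "(\<Sum>k\<in>UNIV. (A $ i $ k)\<^sup>2) = 0" by simp
    then show False using rows[of i] by simp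
  qed
  define \<pi> where "\<pi> i = (SOME k. A $ i $ k \<noteq> 0)" for i
  have \<pi>: "A $ i $ \<pi> i \<noteq> 0" for i unfolding \<pi>_def by (rule someI_ex[OF ex])
  have z: "A $ i $ k = 0" if "k \<noteq> \<pi> i" for i k
  proof (rule ccontr)
    assume "A $ i $ k \<noteq> 0"
    then have "\<bar>A $ i $ k\<bar> = 1" "\<bar>A $ i $ \<pi> i\<bar> = 1" using val[of i k] val[of i "\<pi> i"] \<pi>[of i] by auto
    moreover have "(\<Sum>k\<in>{k, \<pi> i}. \<bar>A $ i $ k\<bar>) \<le> (\<Sum>k\<in>UNIV. \<bar>A $ i $ k\<bar>)"
      by (rule sum_mono2) auto
    ultimately show False using l1[of i] that by simp
  qed
  have s: "(\<Sum>k\<in>UNIV. A $ i $ k * y k) = A $ i $ \<pi> i * y (\<pi> i)" for i y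
    by (subst sum.remove[of _ "\<pi> i"]) (auto simp: z intro!: sum.neutral)
  have "inj \<pi>"
  proof (rule injI, rule ccontr)
    fix i j assume "\<pi> i = \<pi> j" "i \<noteq> j"
    then have "A $ i $ \<pi> i * A $ j $ \<pi> j = 0" using orows[of i j] s[of i "\<lambda>k. A $ j $ k"] by simp
    then show False using \<pi>[of i] \<pi>[of j] by simp
  qed
  then have "bij \<pi>" by (simp add: finite_UNIV_inj_surj bij_def)
  moreover have "\<forall>i. A $ i $ \<pi> i \<in> {1, -1}" using val \<pi> by blast
  moreover have "g = (\<lambda>x. \<chi> i. A $ i $ \<pi> i * x $ \<pi> i)"
    unfolding fun_eq_iff vec_eq_iff by (simp add: gA s)
  ultimately show ?thesis unfolding signed_perm_def
    by (intro exI[of _ \<pi>] exI[of _ "\<lambda>i. A $ i $ \<pi> i"] conjI)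
qed

lemma signed_permE:
  assumes "signed_perm g"
  obtains \<pi> e where "bij \<pi>" "\<And>i. e i = 1 \<or> e i = -1" "\<And>x i. g x $ i = e i * x $ \<pi> i"
proof -
  obtain \<pi> e where *: "bij \<pi>" "\<forall>i. e i \<in> {1, -1}" "g = (\<lambda>x. \<chi> i. e i * x $ \<pi> i)"
    using assms unfolding signed_perm_def by blast
  have "g x $ i = e i * x $ \<pi> i" for x i unfolding *(3) by simp
  then show ?thesis using that * by blast
qed

lemma signed_permI:
  assumes "bij \<pi>" "\<And>i. e i = 1 \<or> e i = -1" "\<And>x i. g x $ i = e i * x $ \<pi> i"
  shows "signed_perm g"
  unfolding signed_perm_def
  by (rule exI[of _ \<pi>], rule exI[of _ e]) (use assms in \<open>auto simp: vec_eq_iff fun_eq_iff\<close>)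

lemma signed_perm_id: "signed_perm (\<lambda>x. x)"
  by (rule signed_permI[of id "\<lambda>_. 1"]) auto

lemma signed_perm_comp:
  assumes "signed_perm g" "signed_perm h" shows "signed_perm (\<lambda>x. g (h x))"
proof -
  obtain \<pi> e where 1: "bij \<pi>" "\<And>i. e i = 1 \<or> e i = -1" "\<And>x i. g x $ i = e i * x $ \<pi> i"
    using signed_permE[OF assms(1)] by blast
  obtain \<pi>' e' where 2: "bij \<pi>'" "\<And>i. e' i = 1 \<or> e' i = -1" "\<And>x i. h x $ i = e' i * x $ \<pi>' i"
    using signed_permE[OF assms(2)] by blast
  show ?thesis
  proof (rule signed_permI)
    show "bij (\<pi>' \<circ> \<pi>)" using 1 2 bij_comp by blast
    show "e i * e' (\<pi> i) = 1 \<or> e i * e' (\<pi> i) = -1" for i using 1(2)[of i] 2(2)[of "\<pi> i"] by auto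
    show "g (h x) $ i = e i * e' (\<pi> i) * x $ (\<pi>' \<circ> \<pi>) i" for x i by (simp add: 1 2)
  qed
qed

lemma signed_perm_inverse:
  assumes "signed_perm g"
  obtains h where "signed_perm h" "\<And>x. g (h x) = x" "\<And>x. h (g x) = x"
proof -
  obtain \<pi> e where 1: "bij \<pi>" "\<And>i. e i = 1 \<or> e i = -1" "\<And>x i. g x $ i = e i * x $ \<pi> i"
    using signed_permE[OF assms] by blast
  define h :: "real ^ 'a \<Rightarrow> real ^ 'a" where "h x = (\<chi> i. e (inv \<pi> i) * x $ inv \<pi> i)" for x
  have ee: "e i * e i = 1" for i using 1(2)[of i] by auto
  have inv: "\<pi> (inv \<pi> i) = i" "inv \<pi> (\<pi> i) = i" for i
    using 1(1) by (auto simp: bij_is_surj surj_f_inv_f bij_is_inj)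
  show ?thesis
  proof
    show "signed_perm h" by (rule signed_permI[of "inv \<pi>" "e \<circ> inv \<pi>"])
        (use 1 in \<open>auto simp: h_def bij_imp_bij_inv\<close>)
    show "g (h x) = x" for x
      by (simp add: vec_eq_iff 1(3) h_def inv mult.assoc[symmetric] ee)
    show "h (g x) = x" for x
      by (simp add: vec_eq_iff 1(3) h_def inv mult.assoc[symmetric] ee)
  qed
qed

lemma signed_perm_inj: "signed_perm g \<Longrightarrow> inj g"
  by (metis injI signed_perm_inverse)

lemma signed_perm_continuous: "signed_perm g \<Longrightarrow> continuous_on A g"
  by (auto simp: signed_perm_def intro!: continuous_intros)

lemma signed_perm_cube: "signed_perm g \<Longrightarrow> x \<in> cube \<Longrightarrow> g x \<in> cube"
proof (erule signed_permE)
  fix \<pi> e assume x: "x \<in> cube" and e: "\<And>i. e i = 1 \<or> e i = -1" and g: "\<And>x i. g x $ i = e i * x $ \<pi> i"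
  have "-1 \<le> g x $ i \<and> g x $ i \<le> 1" for i
  proof -
    have "-1 \<le> x $ \<pi> i" "x $ \<pi> i \<le> 1" using x by (auto simp: cube_def)
    moreover have "g x $ i = x $ \<pi> i \<or> g x $ i = - x $ \<pi> i" using e[of i] g[of x i] by auto
    ultimately show ?thesis by linarith
  qed
  then show "g x \<in> cube" by (simp add: cube_def)
qed

lemma signed_perm_open_cube: "signed_perm g \<Longrightarrow> (\<And>i. \<bar>x $ i\<bar> < 1) \<Longrightarrow> \<bar>g x $ i\<bar> < 1"
proof (erule signed_permE)
  fix \<pi> e assume x: "\<And>i. \<bar>x $ i\<bar> < 1" and e: "\<And>i. e i = 1 \<or> e i = -1" and g: "\<And>x i. g x $ i = e i * x $ \<pi> i"
  have "g x $ i = x $ \<pi> i \<or> g x $ i = - x $ \<pi> i" using e[of i] g[of x i] by auto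
  then show "\<bar>g x $ i\<bar> < 1" using x[of "\<pi> i"] by linarith
qed

lemma signed_perm_face:
  fixes g :: "real ^ 'n \<Rightarrow> real ^ 'n"
  assumes "signed_perm g"
  shows "\<exists>k c. (c = 1 \<or> c = -1) \<and> (\<forall>x. g x $ k = c * x $ j)"
proof -
  obtain \<pi> e where 1: "bij \<pi>" "\<And>i. e i = 1 \<or> e i = -1" "\<And>x i. g x $ i = e i * x $ \<pi> i"
    using signed_permE[OF assms] by blast
  obtain k where "\<pi> k = j" using 1(1) by (metis bij_pointE)
  then show ?thesis using 1 by (intro exI[of _ k] exI[of _ "e k"]) simp
qed

lemma finite_signed_perms: "finite {g :: real ^ 'n \<Rightarrow> real ^ 'n. signed_perm g}"
proof -
  have "{g :: real ^ 'n \<Rightarrow> real ^ 'n. signed_perm g} \<subseteq>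
    (\<lambda>(\<pi>, b). \<lambda>x. \<chi> i. (if b i then 1 else -1) * x $ \<pi> i) ` (UNIV :: (('n \<Rightarrow> 'n) \<times> ('n \<Rightarrow> bool)) set)"
  proof (safe, erule signed_permE)
    fix g :: "real ^ 'n \<Rightarrow> real ^ 'n" and \<pi> e
    assume "\<And>i. e i = 1 \<or> e i = (-1 :: real)" "\<And>x i. g x $ i = e i * x $ \<pi> i"
    then have "g x $ i = (if e i = 1 then 1 else -1) * x $ \<pi> i" for x i by metis
    then have "g = (\<lambda>x. \<chi> i. (if e i = 1 then 1 else -1) * x $ \<pi> i)"
      unfolding fun_eq_iff vec_eq_iff by simp
    then show "g \<in> range (\<lambda>(\<pi>, b). \<lambda>x. \<chi> i. (if b i then 1 else -1) * x $ \<pi> i)"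
      by (intro image_eqI[of _ _ "(\<pi>, \<lambda>i. e i = 1)"]) auto
  qed
  then show ?thesis by (rule finite_subset) (intro finite_imageI finite)
qed

lemma signed_perm_zero: "signed_perm g \<Longrightarrow> g 0 = 0"
  by (erule signed_permE) (simp add: vec_eq_iff)

section \<open>Words\<close>

lemma words_0 [simp]: "words S 0 = {[]}"
  by (auto simp: words_def)

lemma word_map_Nil [simp]: "word_map f [] x = x"
  by (simp add: word_map_def)

lemma word_map_Cons: "word_map f (s # w) x = f s (word_map f w x)"
  by (simp add: word_map_def)

lemma word_map_append: "word_map f (u @ v) x = word_map f u (word_map f v x)"
  by (induction u) (auto simp: word_map_Cons)

lemma cell_append: "cell f K (u @ v) = word_map f u ` cell f K v"
  by (auto simp: cell_def word_map_append)

lemma cell_Nil [simp]: "cell f K [] = K"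
  by (auto simp: cell_def)

lemma append_words: "u \<in> words S n \<Longrightarrow> v \<in> words S m \<Longrightarrow> u @ v \<in> words S (n + m)"
  by (auto simp: words_def)

lemma words_addE:
  assumes "u \<in> words S (n + m)"
  obtains w v where "u = w @ v" "w \<in> words S n" "v \<in> words S m"
proof
  show "u = take n u @ drop n u" by simp
  show "take n u \<in> words S n" "drop n u \<in> words S m"
    using assms set_take_subset[of n u] set_drop_subset[of n u] by (auto simp: words_def)
qed

lemma finite_words: "finite S \<Longrightarrow> finite (words S n)"
  using finite_lists_length_eq[of S n] by (simp add: words_def conj_commute)

lemma words_length: "w \<in> words S n \<Longrightarrow> length w = n"
  by (simp add: words_def)

lemma take_words: "u \<in> words S (n + m) \<Longrightarrow> take n u \<in> words S n"
  by (auto simp: words_def dest: in_set_takeD)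

lemma drop_words: "u \<in> words S (n + m) \<Longrightarrow> drop n u \<in> words S m"
  by (auto simp: words_def dest: in_set_dropD)

lemma descendants_eq: "w \<in> words S n \<Longrightarrow> descendants S m w = (@) w ` words S m"
proof -
  assume w: "w \<in> words S n"
  then have l: "length w = n" by (rule words_length)
  show ?thesis
  proof (intro equalityI subsetI)
    fix u assume "u \<in> descendants S m w"
    then have u: "u \<in> words S (n + m)" "take n u = w" by (auto simp: descendants_def l)
    then have "u = w @ drop n u" by (metis append_take_drop_id)
    then show "u \<in> (@) w ` words S m" using drop_words[OF u(1)] by (rule image_eqI)
  next
    fix u assume "u \<in> (@) w ` words S m"
    then show "u \<in> descendants S m w" using w append_words[of w S n _ m]
      by (auto simp: descendants_def l)
  qed
qed

lemma descendants_take: "u \<in> words S (n + m) \<Longrightarrow> u \<in> descendants S m (take n u)"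
  by (auto simp: descendants_def words_def)

lemma in_descendants: "w \<in> words S n \<Longrightarrow> u \<in> descendants S m w \<longleftrightarrow> u \<in> words S (n + m) \<and> take n u = w"
  by (auto simp: descendants_def words_def)

section \<open>The cells of a subsystem of cubic tiling\<close>

locale cubic_tiling =
  fixes N :: nat and K :: "(real ^ 'n) set" and S :: "(nat ^ 'n) set"
    and f :: "nat ^ 'n \<Rightarrow> real ^ 'n \<Rightarrow> real ^ 'n"
  assumes N2: "2 \<le> N"
    and subsystem: "cubic_subsystem N K S f"
    and nondeg: "nondegenerate K"
    and locsym: "locally_symmetric K S f"
    and strong: "strongly_connected S f"
begin

abbreviation T :: "nat \<Rightarrow> (nat ^ 'n) list set" where "T \<equiv> words S"
abbreviation X :: "(nat ^ 'n) list \<Rightarrow> (real ^ 'n) set" where "X \<equiv> cell f K"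
abbreviation wm :: "(nat ^ 'n) list \<Rightarrow> real ^ 'n \<Rightarrow> real ^ 'n" where "wm \<equiv> word_map f"
abbreviation scl :: "nat \<Rightarrow> real" where "scl n \<equiv> real N ^ n"

lemma K_ne: "K \<noteq> {}" and K_compact: "compact K" and K_cube: "K \<subseteq> cube"
  and K_eq: "K = (\<Union>s\<in>S. f s ` K)" and S_range: "s \<in> S \<Longrightarrow> 1 \<le> s $ i \<and> s $ i \<le> N"
  using subsystem unfolding cubic_subsystem_def by auto

lemma N_pos [simp]: "N \<noteq> 0" "0 < N"
  using N2 by auto

lemma scl_pos [simp]: "0 < scl n" "scl n \<noteq> 0" "0 \<le> scl n"
  using N2 by auto

lemma f_coord:
  assumes "s \<in> S"
  obtains \<Phi> where "signed_perm \<Phi>"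
    "\<And>x i. f s x $ i = (\<Phi> x $ i + 2 * real (s $ i) - 1 - real N) / real N"
proof -
  obtain \<Phi> where \<Phi>: "\<Phi> \<in> cube_symmetries" "f s = (\<lambda>x. (1 / real N) *\<^sub>R \<Phi> x + center N s)"
    using assms subsystem unfolding cubic_subsystem_def by blast
  have "f s x $ i = (\<Phi> x $ i + 2 * real (s $ i) - 1 - real N) / real N" for x i
    using N2 by (simp add: \<Phi>(2) center_def add_divide_distrib diff_divide_distrib)
  then show ?thesis using that cube_symmetries_signed_perm[OF \<Phi>(1)] by blast
qed

lemma finite_S: "finite S"
proof -
  have "S \<subseteq> vec_lambda ` (PiE UNIV (\<lambda>_. {1..N}))"
  proof
    fix s assume "s \<in> S"
    then have "vec_nth s \<in> PiE UNIV (\<lambda>_. {1..N})" using S_range by auto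
    then show "s \<in> vec_lambda ` (PiE UNIV (\<lambda>_. {1..N}))"
      by (intro image_eqI[of _ _ "vec_nth s"]) (auto simp: vec_nth_inverse)
  qed
  then show ?thesis by (rule finite_subset) (intro finite_imageI finite_PiE; simp)
qed

lemma finite_T [simp]: "finite (T n)"
  by (rule finite_words[OF finite_S])

lemma word_coord_ex:
  assumes "w \<in> T n"
  shows "\<exists>\<Phi> a. signed_perm \<Phi> \<and>
    (\<forall>x i. wm w x $ i = (\<Phi> x $ i + 2 * of_int (a i) + 1 - scl n) / scl n)"
  using assms
proof (induction w arbitrary: n)
  case Nil
  then show ?case
    by (intro exI[of _ "\<lambda>x. x"] exI[of _ "\<lambda>_. 0"]) (auto simp: words_def signed_perm_id)
next
  case (Cons s w)
  then obtain m where m: "n = Suc m" "w \<in> T m" and s: "s \<in> S" by (auto simp: words_def)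
  obtain \<Phi> a where 1: "signed_perm \<Phi>"
    "\<And>x i. wm w x $ i = (\<Phi> x $ i + 2 * of_int (a i) + 1 - scl m) / scl m"
    using Cons.IH[OF m(2)] by blast
  obtain \<Psi> where 2: "signed_perm \<Psi>"
    "\<And>x i. f s x $ i = (\<Psi> x $ i + 2 * real (s $ i) - 1 - real N) / real N"
    using f_coord[OF s] by blast
  obtain \<pi> e where 3: "bij \<pi>" "\<And>i. e i = 1 \<or> e i = -1" "\<And>x i. \<Psi> x $ i = e i * x $ \<pi> i"
    using signed_permE[OF 2(1)] by blast
  define b where "b i = (if e i = 1 then a (\<pi> i) + N ^ m * (int (s $ i) - 1)
    else int (N ^ m) * int (s $ i) - a (\<pi> i) - 1)" for i
  have "wm (s # w) x $ i = (\<Psi> (\<Phi> x) $ i + 2 * of_int (b i) + 1 - scl n) / scl n" for x i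
    using 3(2)[of i]
    by (auto simp: word_map_Cons 1 2(2) 3(3) b_def m divide_simps) (simp_all add: algebra_simps)
  then show ?case using signed_perm_comp[OF 2(1) 1(1)] by blast
qed

definition rot :: "(nat ^ 'n) list \<Rightarrow> real ^ 'n \<Rightarrow> real ^ 'n" where
  "rot w = (SOME \<Phi>. \<exists>a. signed_perm \<Phi> \<and>
    (\<forall>x i. wm w x $ i = (\<Phi> x $ i + 2 * of_int (a i) + 1 - scl (length w)) / scl (length w)))"

definition idx :: "(nat ^ 'n) list \<Rightarrow> 'n \<Rightarrow> int" where
  "idx w = (SOME a.
    \<forall>x i. wm w x $ i = (rot w x $ i + 2 * of_int (a i) + 1 - scl (length w)) / scl (length w))"

lemma rot_idx:
  assumes "w \<in> T n"
  shows "signed_perm (rot w)"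
    "wm w x $ i = (rot w x $ i + 2 * of_int (idx w i) + 1 - scl n) / scl n"
proof -
  have l: "length w = n" using assms by (rule words_length)
  have "w \<in> T (length w)" using assms l by simp
  from someI_ex[OF word_coord_ex[OF this]]
  have *: "\<exists>a. signed_perm (rot w) \<and>
    (\<forall>x i. wm w x $ i = (rot w x $ i + 2 * of_int (a i) + 1 - scl (length w)) / scl (length w))"
    unfolding rot_def .
  then show "signed_perm (rot w)" by blast
  have "\<forall>x i. wm w x $ i = (rot w x $ i + 2 * of_int (idx w i) + 1 - scl (length w)) / scl (length w)"
  proof -
    have "\<exists>a. \<forall>x i. wm w x $ i = (rot w x $ i + 2 * of_int (a i) + 1 - scl (length w)) / scl (length w)"
      using * by blast
    from someI_ex[OF this] show ?thesis unfolding idx_def .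
  qed
  then show "wm w x $ i = (rot w x $ i + 2 * of_int (idx w i) + 1 - scl n) / scl n" using l by blast
qed

lemma scaled_coord:
  assumes "w \<in> T n"
  shows "scl n * (wm w x $ i + 1) - 1 = rot w x $ i + 2 * of_int (idx w i)"
proof -
  have "scl n * wm w x $ i = rot w x $ i + 2 * of_int (idx w i) + 1 - scl n"
    by (simp add: rot_idx(2)[OF assms])
  then show ?thesis by (simp add: distrib_left)
qed

lemma rot_bound: "w \<in> T n \<Longrightarrow> x \<in> cube \<Longrightarrow> \<bar>rot w x $ i\<bar> \<le> 1"
  using signed_perm_cube[OF rot_idx(1)] by (fastforce simp: cube_def abs_le_iff)

lemma rot_bound_open: "w \<in> T n \<Longrightarrow> (\<And>i. \<bar>x $ i\<bar> < 1) \<Longrightarrow> \<bar>rot w x $ i\<bar> < 1"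
  by (rule signed_perm_open_cube[OF rot_idx(1)])

lemma f_open: 
  assumes "s \<in> S" "\<And>i. \<bar>x $ i\<bar> < 1" shows "\<bar>f s x $ i\<bar> < 1"
proof -
  obtain \<Phi> where 1: "signed_perm \<Phi>"
    "\<And>x i. f s x $ i = (\<Phi> x $ i + 2 * real (s $ i) - 1 - real N) / real N"
    using f_coord[OF assms(1)] by blast
  have "\<bar>\<Phi> x $ i\<bar> < 1" using signed_perm_open_cube[OF 1(1)] assms(2) by blast
  moreover have "1 \<le> real (s $ i)" "real (s $ i) \<le> real N" using S_range[OF assms(1), of i] by auto
  ultimately show ?thesis using N2 unfolding 1(2) by (auto simp: abs_less_iff field_simps)
qed

lemma wm_open: "w \<in> T n \<Longrightarrow> (\<And>i. \<bar>x $ i\<bar> < 1) \<Longrightarrow> \<bar>wm w x $ i\<bar> < 1"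
proof (induction w arbitrary: n i)
  case (Cons s w)
  then have "s \<in> S" "w \<in> T (length w)" by (auto simp: words_def)
  then show ?case using Cons f_open by (simp add: word_map_Cons)
qed simp

lemma f_inj: "s \<in> S \<Longrightarrow> inj (f s)"
proof -
  assume "s \<in> S"
  then obtain \<Phi> where 1: "signed_perm \<Phi>"
    "\<And>x i. f s x $ i = (\<Phi> x $ i + 2 * real (s $ i) - 1 - real N) / real N"
    using f_coord by blast
  have "x = y" if "f s x = f s y" for x y
  proof -
    have "\<Phi> x = \<Phi> y" using that N2 unfolding vec_eq_iff 1(2) by simp
    then show ?thesis using signed_perm_inj[OF 1(1)] by (auto dest: injD)
  qed
  then show ?thesis by (rule injI)
qed

lemma wm_inj: "w \<in> T n \<Longrightarrow> inj (wm w)"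
proof (rule injI)
  fix x y assume w: "w \<in> T n" and "wm w x = wm w y"
  then have "rot w x = rot w y" unfolding vec_eq_iff using scaled_coord[OF w] by (metis add_right_cancel)
  then show "x = y" using signed_perm_inj[OF rot_idx(1)[OF w]] by (auto dest: injD)
qed

lemma wm_disjoint:
  assumes "w \<in> T n" "v \<in> T n" "\<And>i. \<bar>x $ i\<bar> < 1" "\<And>i. \<bar>y $ i\<bar> < 1" "wm w x = wm v y"
  shows "w = v"
  using assms
proof (induction w arbitrary: v n)
  case Nil
  then show ?case by (simp add: words_def)
next
  case (Cons s w)
  then obtain m where m: "n = Suc m" "w \<in> T m" and s: "s \<in> S" by (auto simp: words_def)
  then obtain t v' where v: "v = t # v'" "t \<in> S" "v' \<in> T m"
    using Cons.prems(2) by (cases v) (auto simp: words_def)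
  have eq: "f s (wm w x) = f t (wm v' y)" using Cons.prems(5) v by (simp add: word_map_Cons)
  have 1: "\<bar>wm w x $ i\<bar> < 1" "\<bar>wm v' y $ i\<bar> < 1" for i using wm_open m v Cons.prems by blast+
  obtain \<Phi> where \<Phi>: "signed_perm \<Phi>"
    "\<And>x i. f s x $ i = (\<Phi> x $ i + 2 * real (s $ i) - 1 - real N) / real N"
    using f_coord[OF s] by blast
  obtain \<Psi> where \<Psi>: "signed_perm \<Psi>"
    "\<And>x i. f t x $ i = (\<Psi> x $ i + 2 * real (t $ i) - 1 - real N) / real N"
    using f_coord[OF v(2)] by blast
  have "s $ i = t $ i" for i
  proof -
    have "\<bar>\<Phi> (wm w x) $ i\<bar> < 1" "\<bar>\<Psi> (wm v' y) $ i\<bar> < 1"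
      using signed_perm_open_cube \<Phi>(1) \<Psi>(1) 1 by blast+
    moreover have "\<Phi> (wm w x) $ i + 2 * real (s $ i) = \<Psi> (wm v' y) $ i + 2 * real (t $ i)"
      using arg_cong[OF eq, of "\<lambda>z. z $ i"] N2 unfolding \<Phi>(2) \<Psi>(2) by (simp add: field_simps)
    ultimately show ?thesis by linarith
  qed
  then have st: "s = t" by (simp add: vec_eq_iff)
  then have "wm w x = wm v' y" using eq f_inj[OF s] by (auto dest: injD)
  then show ?case using Cons.IH[OF m(2) v(3)] Cons.prems st v by blast
qed

lemma idx_inj: "w \<in> T n \<Longrightarrow> v \<in> T n \<Longrightarrow> idx w = idx v \<Longrightarrow> w = v"
  by (rule wm_disjoint[of w n v 0 0])
    (auto simp: vec_eq_iff rot_idx signed_perm_zero)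

lemma box_unique:
  assumes "w \<in> T n" "v \<in> T n" "\<And>i. \<bar>x $ i\<bar> < 1" "y \<in> cube" "wm w x = wm v y"
  shows "w = v"
proof (rule idx_inj[OF assms(1,2)], rule ext)
  fix i
  have "rot w x $ i + 2 * of_int (idx w i) = rot v y $ i + 2 * of_int (idx v i)"
    using assms(5) scaled_coord[OF assms(1), of x i] scaled_coord[OF assms(2), of y i] by simp
  moreover have "\<bar>rot w x $ i\<bar> < 1" "\<bar>rot v y $ i\<bar> \<le> 1"
    using rot_bound_open[OF assms(1)] assms(3) rot_bound[OF assms(2,4)] by blast+
  ultimately have "\<bar>of_int (idx w i - idx v i)\<bar> < (1::real)" by linarith
  then show "idx w i = idx v i" by linarith
qed

lemma f_cell_subset: "s \<in> S \<Longrightarrow> x \<in> K \<Longrightarrow> f s x \<in> K"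
  using K_eq by blast

lemma wm_K: "w \<in> T n \<Longrightarrow> x \<in> K \<Longrightarrow> wm w x \<in> K"
proof (induction w arbitrary: n)
  case (Cons s w)
  then have "s \<in> S" "w \<in> T (length w)" by (auto simp: words_def)
  then show ?case using Cons f_cell_subset by (simp add: word_map_Cons)
qed simp

lemma cell_subset: "w \<in> T n \<Longrightarrow> X w \<subseteq> K"
  using wm_K by (auto simp: cell_def)

lemma cell_cover: "x \<in> K \<Longrightarrow> \<exists>w\<in>T n. x \<in> X w"
proof (induction n arbitrary: x)
  case (Suc n)
  then obtain s y where s: "s \<in> S" "y \<in> K" "x = f s y" using K_eq by blast
  then obtain w where w: "w \<in> T n" "y \<in> X w" using Suc.IH by blast
  have "s # w \<in> T (Suc n)" using s w by (auto simp: words_def)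
  moreover have "x \<in> X (s # w)" using s w by (auto simp: cell_def word_map_Cons)
  ultimately show ?case by blast
qed simp

lemma sub_cell_cover:
  assumes "w \<in> T n" "x \<in> X w" shows "\<exists>v\<in>T m. x \<in> X (w @ v)"
proof -
  obtain y where y: "y \<in> K" "x = wm w y" using assms by (auto simp: cell_def)
  then obtain v where "v \<in> T m" "y \<in> X v" using cell_cover by blast
  then show ?thesis using y by (auto simp: cell_append)
qed

lemma cell_append_subset: "v \<in> T m \<Longrightarrow> X (w @ v) \<subseteq> X w"
  using wm_K by (auto simp: cell_append) (auto simp: cell_def)

lemma cell_ne: "X w \<noteq> {}" using K_ne by (simp add: cell_def)

lemma wm_continuous: "w \<in> T n \<Longrightarrow> continuous_on A (wm w)"
proof -
  assume w: "w \<in> T n"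
  have "wm w = (\<lambda>x. \<chi> i. (rot w x $ i + 2 * of_int (idx w i) + 1 - scl n) / scl n)"
    by (auto simp: fun_eq_iff vec_eq_iff rot_idx(2)[OF w])
  then show ?thesis
    using signed_perm_continuous[OF rot_idx(1)[OF w]] by (auto intro!: continuous_intros)
qed

lemma cell_compact: "w \<in> T n \<Longrightarrow> compact (X w)"
  unfolding cell_def by (intro compact_continuous_image wm_continuous K_compact)

lemma cell_coord_diff:
  assumes "w \<in> T n" "x \<in> X w" "y \<in> X w" shows "\<bar>x $ i - y $ i\<bar> \<le> 2 / scl n"
proof -
  obtain x' y' where *: "x' \<in> K" "y' \<in> K" "x = wm w x'" "y = wm w y'"
    using assms by (auto simp: cell_def)
  have "\<bar>rot w x' $ i\<bar> \<le> 1" "\<bar>rot w y' $ i\<bar> \<le> 1" using rot_bound[OF assms(1)] * K_cube by blast+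
  moreover have "x $ i - y $ i = (rot w x' $ i - rot w y' $ i) / scl n"
    by (simp add: * rot_idx[OF assms(1)] field_simps)
  ultimately show ?thesis by (simp add: abs_divide divide_right_mono)
qed

lemma cell_dist:
  assumes "w \<in> T n" "x \<in> X w" "y \<in> X w" shows "dist x y \<le> 2 * real CARD('n) / scl n"
proof -
  have "dist x y \<le> (\<Sum>i\<in>UNIV. \<bar>(x - y) $ i\<bar>)" unfolding dist_norm by (rule norm_le_l1_cart)
  also have "\<dots> \<le> (\<Sum>i\<in>(UNIV::'n set). 2 / scl n)"
    by (intro sum_mono) (use cell_coord_diff[OF assms] in simp)
  finally show ?thesis by (simp add: mult.commute)
qed

lemma scl_tendsto:
  assumes "0 < \<epsilon>" shows "\<exists>n\<ge>n0. c / scl n < \<epsilon>"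
proof -
  have "(\<lambda>n. c * (1 / real N) ^ n) \<longlonglongrightarrow> c * 0"
    using N2 by (intro tendsto_intros LIMSEQ_realpow_zero) auto
  then have "eventually (\<lambda>n. c * (1 / real N) ^ n < \<epsilon>) sequentially"
    using assms by (auto intro: order_tendstoD)
  then obtain n where "\<And>m. n \<le> m \<Longrightarrow> c * (1 / real N) ^ m < \<epsilon>"
    by (auto simp: eventually_sequentially)
  then show ?thesis by (intro exI[of _ "max n n0"]) (auto simp: power_one_over field_simps)
qed

lemma cell_two_points:
  assumes "w \<in> T n"
  obtains x y where "x \<in> X w" "y \<in> X w" "x $ i - y $ i = 2 / scl n"
proof -
  obtain \<pi> e where pe: "bij \<pi>" "\<And>i. e i = 1 \<or> e i = -1" "\<And>x i. rot w x $ i = e i * x $ \<pi> i"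
    using signed_permE[OF rot_idx(1)[OF assms]] by blast
  define k c where "k = \<pi> i" and "c = e i"
  then have k: "c = 1 \<or> c = -1" "\<And>x. rot w x $ i = c * x $ k" using pe by auto
  have "\<exists>x\<in>K. x $ k = c" "\<exists>x\<in>K. x $ k = -c"
    using nondeg k(1) unfolding nondegenerate_def face_def by fastforce+
  then obtain x y where "x \<in> K" "x $ k = c" "y \<in> K" "y $ k = - c" by blast
  then have "wm w x \<in> X w" "wm w y \<in> X w" "wm w x $ i - wm w y $ i = 2 / scl n"
    using k by (auto simp: cell_def rot_idx(2)[OF assms] field_simps)
  then show ?thesis using that by blast
qed

text \<open>A cell meets all faces of its cube, so next to a point with some coordinate \<open>\<plusminus>1\<close> there is
  another point of \<open>K\<close> with strictly fewer such coordinates.\<close>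

lemma interior_point: "\<exists>y\<in>K. \<forall>i. \<bar>y $ i\<bar> < 1"
proof -
  define c where "c x = card {i. \<bar>x $ i\<bar> = 1}" for x :: "real ^ 'n"
  obtain y where y: "y \<in> K" "\<And>z. z \<in> K \<Longrightarrow> c y \<le> c z"
    using K_ne ex_has_least_nat[of "\<lambda>z. z \<in> K" _ c] by blast
  have le1: "\<bar>x $ i\<bar> \<le> 1" if "x \<in> K" for x i using that K_cube by (auto simp: cube_def abs_le_iff)
  show ?thesis
  proof (rule ccontr)
    assume "\<not> ?thesis"
    then obtain j where j: "\<bar>y $ j\<bar> = 1" using y(1) le1 by (metis order_le_less)
    define \<delta> where "\<delta> = Min (insert 1 ((\<lambda>i. 1 - \<bar>y $ i\<bar>) ` {i. \<bar>y $ i\<bar> \<noteq> 1}))"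
    have "0 < \<delta>" unfolding \<delta>_def using le1[OF y(1)] by (subst Min_gr_iff) (auto simp: order_less_le)
    have \<delta>: "\<delta> \<le> 1" "\<And>i. \<bar>y $ i\<bar> \<noteq> 1 \<Longrightarrow> \<delta> \<le> 1 - \<bar>y $ i\<bar>" unfolding \<delta>_def by auto
    obtain n where n: "2 / scl n < \<delta>" using scl_tendsto[OF \<open>0 < \<delta>\<close>] by blast
    obtain w where w: "w \<in> T n" "y \<in> X w" using cell_cover y(1) by blast
    obtain p q where pq: "p \<in> X w" "q \<in> X w" "p $ j - q $ j = 2 / scl n"
      using cell_two_points[OF w(1)] by blast
    have ne: "p $ j \<noteq> q $ j" using pq(3) by auto
    obtain z where z: "z \<in> X w" "\<bar>z $ j\<bar> \<noteq> 1"
    proof (cases "\<bar>p $ j\<bar> = 1")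
      case True
      have "0 < p $ j - q $ j" unfolding pq(3) by simp
      moreover have "p $ j - q $ j < 1" unfolding pq(3) using n \<delta>(1) by linarith
      ultimately have "\<bar>q $ j\<bar> \<noteq> 1" using True by linarith
      then show ?thesis using that pq by blast
    qed (use that pq in blast)
    have "{i. \<bar>z $ i\<bar> = 1} \<subset> {i. \<bar>y $ i\<bar> = 1}"
    proof
      show "{i. \<bar>z $ i\<bar> = 1} \<subseteq> {i. \<bar>y $ i\<bar> = 1}"
      proof (safe, rule ccontr)
        fix i assume i: "\<bar>z $ i\<bar> = 1" "\<bar>y $ i\<bar> \<noteq> 1"
        have "\<bar>z $ i - y $ i\<bar> < \<delta>" using cell_coord_diff[OF w(1) z(1) w(2), of i] n by linarith
        then show False using i \<delta>(2)[of i] by linarith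
      qed
      show "{i. \<bar>z $ i\<bar> = 1} \<noteq> {i. \<bar>y $ i\<bar> = 1}" using z(2) j by auto
    qed
    then have "c z < c y" unfolding c_def by (intro psubset_card_mono) auto
    then show False using y(2) cell_subset[OF w(1)] z(1) by fastforce
  qed
qed

definition ipt :: "real ^ 'n" where "ipt = (SOME y. y \<in> K \<and> (\<forall>i. \<bar>y $ i\<bar> < 1))"

lemma ipt: "ipt \<in> K" "\<bar>ipt $ i\<bar> < 1"
proof -
  have "\<exists>y. y \<in> K \<and> (\<forall>i. \<bar>y $ i\<bar> < 1)" using interior_point by blast
  from someI_ex[OF this] show "ipt \<in> K" "\<bar>ipt $ i\<bar> < 1" unfolding ipt_def by auto
qed

lemma cell_ipt: "wm w ipt \<in> X w"
  using ipt by (auto simp: cell_def)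

lemma cell_ipt_unique: "w \<in> T n \<Longrightarrow> v \<in> T n \<Longrightarrow> wm w ipt \<in> X v \<Longrightarrow> w = v"
  using box_unique[of w n v ipt] ipt K_cube unfolding cell_def by blast

lemma cell_inj: "w \<in> T n \<Longrightarrow> v \<in> T n \<Longrightarrow> X w \<subseteq> X v \<Longrightarrow> w = v"
  using cell_ipt cell_ipt_unique by blast

lemma open_dense: "closure {x \<in> K. \<forall>i. \<bar>x $ i\<bar> < 1} = K"
proof
  show "closure {x \<in> K. \<forall>i. \<bar>x $ i\<bar> < 1} \<subseteq> K"
    by (rule closure_minimal) (auto intro: compact_imp_closed K_compact)
  show "K \<subseteq> closure {x \<in> K. \<forall>i. \<bar>x $ i\<bar> < 1}"
  proof
    fix x assume x: "x \<in> K"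
    show "x \<in> closure {x \<in> K. \<forall>i. \<bar>x $ i\<bar> < 1}"
      unfolding closure_approachable
    proof safe
      fix \<epsilon> :: real assume "0 < \<epsilon>"
      then obtain n where n: "2 * real CARD('n) / scl n < \<epsilon>" using scl_tendsto by blast
      obtain w where w: "w \<in> T n" "x \<in> X w" using cell_cover x by blast
      have "dist (wm w ipt) x < \<epsilon>" using cell_dist[OF w(1) cell_ipt w(2)] n by linarith
      moreover have "wm w ipt \<in> K" "\<forall>i. \<bar>wm w ipt $ i\<bar> < 1"
        using wm_K wm_open w(1) ipt by blast+
      ultimately show "\<exists>y\<in>{x \<in> K. \<forall>i. \<bar>x $ i\<bar> < 1}. dist y x < \<epsilon>" by blast
    qed
  qed
qed

lemma image_subset_closed:
  assumes "continuous_on K g" "closed C" "\<And>x. x \<in> K \<Longrightarrow> (\<And>i. \<bar>x $ i\<bar> < 1) \<Longrightarrow> g x \<in> C"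
  shows "g ` K \<subseteq> C"
  using image_closure_subset[of "{x \<in> K. \<forall>i. \<bar>x $ i\<bar> < 1}" g C] assms open_dense by auto

section \<open>Symmetries of \<open>K\<close> act on the cells\<close>

definition symmetry :: "(real ^ 'n \<Rightarrow> real ^ 'n) \<Rightarrow> bool" where
  "symmetry g \<longleftrightarrow> signed_perm g \<and> g ` K = K"

lemma symmetry_inverse:
  assumes "symmetry g"
  obtains h where "symmetry h" "\<And>x. g (h x) = x" "\<And>x. h (g x) = x"
proof -
  obtain h where h: "signed_perm h" "\<And>x. g (h x) = x" "\<And>x. h (g x) = x"
    using signed_perm_inverse assms unfolding symmetry_def by blast
  have "h ` K = h ` (g ` K)" using assms by (simp add: symmetry_def)
  also have "\<dots> = K" by (simp add: image_image h)
  finally show ?thesis using that h by (simp add: symmetry_def)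
qed

lemma symmetry_cell_subset:
  assumes "symmetry g" "y \<in> T m"
  obtains z where "z \<in> T m" "g ` X y \<subseteq> X z"
proof -
  have g: "signed_perm g" "g ` K = K" using assms by (auto simp: symmetry_def)
  obtain \<pi> e where 1: "bij \<pi>" "\<And>i. e i = 1 \<or> e i = -1" "\<And>x i. g x $ i = e i * x $ \<pi> i"
    using signed_permE[OF g(1)] by blast
  define A where "A i = (if e i = 1 then idx y (\<pi> i) else int (N ^ m) - 1 - idx y (\<pi> i))" for i
  have idx: "idx z = A" if h: "z \<in> T m" "x \<in> K" "\<And>i. \<bar>x $ i\<bar> < 1" "g (wm y x) \<in> X z" for x z
  proof
    fix i
    obtain r where r: "r \<in> K" "g (wm y x) = wm z r" using h(4) by (auto simp: cell_def)
    have b: "\<bar>rot z r $ i\<bar> \<le> 1" "\<bar>rot y x $ \<pi> i\<bar> < 1"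
      using rot_bound[OF h(1)] r K_cube rot_bound_open[OF assms(2) h(3)] by blast+
    have "rot z r $ i + 2 * of_int (idx z i) = scl m * (g (wm y x) $ i + 1) - 1"
      by (simp add: r scaled_coord[OF h(1)])
    also have "\<dots> = e i * rot y x $ \<pi> i + 2 * of_int (A i)"
      using 1(2)[of i] by (auto simp: 1(3) rot_idx(2)[OF assms(2)] A_def field_simps)
    finally have "\<bar>of_int (idx z i - A i)\<bar> < (1::real)" using b 1(2)[of i] by auto
    then show "idx z i = A i" by linarith
  qed
  have gK: "g (wm y x) \<in> K" if "x \<in> K" for x using wm_K[OF assms(2) that] g(2) by blast
  obtain z where z: "z \<in> T m" "g (wm y ipt) \<in> X z" using gK ipt cell_cover by blast
  have "(\<lambda>x. g (wm y x)) ` K \<subseteq> X z"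
  proof (rule image_subset_closed)
    show "continuous_on K (\<lambda>x. g (wm y x))"
      using continuous_on_compose2[OF signed_perm_continuous[OF g(1)] wm_continuous[OF assms(2)]]
      by (metis subset_UNIV)
    show "closed (X z)" using cell_compact z(1) compact_imp_closed by blast
    fix x assume x: "x \<in> K" "\<And>i. \<bar>x $ i\<bar> < 1"
    obtain z' where z': "z' \<in> T m" "g (wm y x) \<in> X z'" using gK x cell_cover by blast
    then have "idx z' = idx z" using idx[OF z'(1) x z'(2)] idx[OF z(1) ipt z(2)] by simp
    then show "g (wm y x) \<in> X z" using idx_inj z z' by blast
  qed
  then show ?thesis using that[OF z(1)] by (auto simp: cell_def)
qed

lemma symmetry_cell:
  assumes "symmetry g" "y \<in> T m"
  shows "\<exists>!z. z \<in> T m \<and> g ` X y = X z"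
proof -
  obtain h where h: "symmetry h" "\<And>x. g (h x) = x" "\<And>x. h (g x) = x"
    using symmetry_inverse[OF assms(1)] by blast
  obtain z where z: "z \<in> T m" "g ` X y \<subseteq> X z" using symmetry_cell_subset[OF assms] by blast
  obtain y' where y': "y' \<in> T m" "h ` X z \<subseteq> X y'" using symmetry_cell_subset[OF h(1) z(1)] by blast
  have "h ` g ` X y \<subseteq> X y'" using z(2) y'(2) by blast
  then have "X y \<subseteq> X y'" by (simp add: image_image h)
  then have "y = y'" using cell_inj assms(2) y'(1) by blast
  then have "g ` h ` X z \<subseteq> g ` X y" using y'(2) by blast
  then have "X z \<subseteq> g ` X y" by (simp add: image_image h)
  then show ?thesis using z cell_inj by (metis subset_antisym subset_refl)
qed

end

section \<open>Folding\<close>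

text \<open>The triangular wave of period 4 that is the identity on \<open>[-1, 1]\<close>.\<close>

definition tri :: "real \<Rightarrow> real" where
  "tri t = 2 / pi * arcsin (sin (pi * t / 2))"

definition parity_sign :: "int \<Rightarrow> real" where
  "parity_sign a = (if even a then 1 else -1)"

lemma tri_eq:
  assumes "\<bar>t - 2 * of_int a\<bar> \<le> 1"
  shows "tri t = parity_sign a * (t - 2 * of_int a)"
proof -
  define s where "s = pi * (t - 2 * of_int a) / 2"
  have "pi * \<bar>t - 2 * of_int a\<bar> \<le> pi * 1" using assms by (intro mult_left_mono) auto
  then have "\<bar>s\<bar> \<le> pi / 2" unfolding s_def by (simp add: abs_mult)
  then have s: "- (pi / 2) \<le> s" "s \<le> pi / 2" by (auto simp: abs_le_iff)
  have "pi * t / 2 = s + pi * of_int a" by (simp add: s_def field_simps)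
  then have "sin (pi * t / 2) = sin (s + pi * of_int a)" by (rule arg_cong)
  then have "sin (pi * t / 2) = parity_sign a * sin s"
    by (simp add: sin_add sin_npi_int cos_npi_int parity_sign_def)
  then have "arcsin (sin (pi * t / 2)) = parity_sign a * s"
    using s by (simp add: parity_sign_def arcsin_minus arcsin_sin)
  then have "tri t = parity_sign a * (2 / pi * s)" by (simp add: tri_def)
  moreover have "2 / pi * s = t - 2 * of_int a" by (simp add: s_def)
  ultimately show ?thesis by (simp only:)
qed

lemma tri_reflect:
  assumes "odd b" shows "tri (2 * of_int b - t) = tri t"
proof -
  have "pi * (2 * of_int b - t) / 2 = pi * of_int b - pi * t / 2" by (simp add: field_simps)
  then have "sin (pi * (2 * of_int b - t) / 2) = sin (pi * of_int b - pi * t / 2)" by (rule arg_cong)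
  then have "sin (pi * (2 * of_int b - t) / 2) = sin (pi * t / 2)"
    using assms by (simp add: sin_diff sin_npi_int cos_npi_int)
  then show ?thesis by (simp add: tri_def)
qed

lemma hyperplane_reflection_axis:
  "hyperplane_reflection (axis k 1) h (x :: real ^ 'n) $ i = (if i = k then 2 * h - x $ i else x $ i)"
  by (simp add: hyperplane_reflection_def inner_axis' inner_axis_axis) (simp add: axis_def)

context cubic_tiling
begin

definition unfold_map :: "nat \<Rightarrow> real ^ 'n \<Rightarrow> real ^ 'n" where
  "unfold_map n x = (\<chi> i. tri (scl n * (x $ i + 1) - 1))"

definition psi :: "(nat ^ 'n) list \<Rightarrow> real ^ 'n \<Rightarrow> real ^ 'n" where
  "psi w x = (\<chi> i. parity_sign (idx w i) * rot w x $ i)"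

lemma unfold_map_wm:
  assumes "w \<in> T n" "x \<in> cube" shows "unfold_map n (wm w x) = psi w x"
proof -
  have "tri (scl n * (wm w x $ i + 1) - 1) = parity_sign (idx w i) * rot w x $ i" for i
    unfolding scaled_coord[OF assms(1)] using rot_bound[OF assms, of i]
    by (subst tri_eq[of _ "idx w i"]) auto
  then show ?thesis by (simp add: unfold_map_def psi_def)
qed

lemma psi_signed_perm:
  assumes "w \<in> T n" shows "signed_perm (psi w)"
proof -
  obtain \<pi> e where *: "bij \<pi>" "\<And>i. e i = 1 \<or> e i = -1" "\<And>x i. rot w x $ i = e i * x $ \<pi> i"
    using signed_permE[OF rot_idx(1)[OF assms]] by blast
  show ?thesis
  proof (rule signed_permI[OF *(1)])
    show "psi w x $ i = (parity_sign (idx w i) * e i) * x $ \<pi> i" for x i by (simp add: psi_def *(3))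
    show "parity_sign (idx w i) * e i = 1 \<or> parity_sign (idx w i) * e i = -1" for i
      using *(2)[of i] by (auto simp: parity_sign_def)
  qed
qed

lemma face_edge_hyperplane:
  assumes "(w, v) \<in> face_edges S f n"
  shows "\<exists>j i k c. wm w ` cube \<inter> wm v ` cube = wm w ` face j i \<and> (i = 1 \<or> i = -1) \<and>
    (c = 1 \<or> c = -1) \<and> (\<forall>x. rot w x $ k = c * x $ j) \<and> w \<in> T n \<and> v \<in> T n"
proof -
  have w: "w \<in> T n" "v \<in> T n" using assms by (auto simp: face_edges_def)
  obtain j i where ji: "i = 1 \<or> i = -1" "wm w ` cube \<inter> wm v ` cube = wm w ` face j i"
    using assms by (auto simp: face_edges_def)
  obtain k c where "c = 1 \<or> c = -1" "\<And>x. rot w x $ k = c * x $ j"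
    using signed_perm_face[OF rot_idx(1)[OF w(1)], of j] by blast
  then show ?thesis using ji w by blast
qed

lemma psi_face_edge:
  assumes "1 \<le> n" "(w, v) \<in> face_edges S f n"
  shows "psi w ` K \<subseteq> psi v ` K"
proof -
  obtain j i k c where F: "wm w ` cube \<inter> wm v ` cube = wm w ` face j i" and i: "i = 1 \<or> i = -1"
    and c: "c = 1 \<or> c = -1" "\<And>x. rot w x $ k = c * x $ j" and w: "w \<in> T n" "v \<in> T n"
    using face_edge_hyperplane[OF assms(2)] by blast
  define b where "b = (if c * i = 1 then 1 else -1) + 2 * idx w k"
  have b: "of_int b = c * i + 2 * of_int (idx w k)" "odd b" using c i by (auto simp: b_def)
  define h where "h = (of_int b + 1) / scl n - 1"
  define R :: "real ^ 'n \<Rightarrow> real ^ 'n" where "R = hyperplane_reflection (axis k 1) h"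
  have R: "R x $ l = (if l = k then 2 * h - x $ l else x $ l)" for x l
    unfolding R_def by (rule hyperplane_reflection_axis)
  have Rk: "scl n * (R x $ k + 1) - 1 = 2 * of_int b - (scl n * (x $ k + 1) - 1)" for x
  proof -
    have "scl n * h = of_int b + 1 - scl n" by (simp add: h_def right_diff_distrib)
    moreover have "scl n * (R x $ k + 1) - 1 = 2 * (scl n * h) - scl n * x $ k + scl n - 1"
      by (simp add: R algebra_simps)
    ultimately show ?thesis by (simp add: algebra_simps)
  qed
  have fold: "unfold_map n (R x) = unfold_map n x" for x
  proof -
    have "tri (scl n * (R x $ l + 1) - 1) = tri (scl n * (x $ l + 1) - 1)" for l
    proof (cases "l = k")
      case True
      show ?thesis unfolding True Rk by (rule tri_reflect[OF b(2)])
    qed (simp add: R)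
    then show ?thesis by (simp add: unfold_map_def)
  qed
  have "wm w ` cube \<inter> wm v ` cube \<subseteq> {x. axis k 1 \<bullet> x = h}"
  proof -
    have "wm w x $ k = h" if "x \<in> face j i" for x
    proof -
      have "rot w x $ k = c * i" using that c by (simp add: face_def)
      then show ?thesis by (simp add: rot_idx(2)[OF w(1)] h_def b(1) diff_divide_distrib)
    qed
    then show ?thesis unfolding F by (auto simp: inner_axis')
  qed
  moreover have "\<forall>a b. a \<noteq> 0 \<longrightarrow> wm w ` cube \<inter> wm v ` cube \<subseteq> {x. a \<bullet> x = b} \<longrightarrow>
      hyperplane_reflection a b ` (X w \<union> X v) = X w \<union> X v"
    using locsym[unfolded locally_symmetric_def, rule_format, OF assms] by simp
  moreover have "axis k (1::real) \<noteq> 0" by (simp add: axis_eq_0_iff)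
  ultimately have sym: "R ` (X w \<union> X v) = X w \<union> X v" unfolding R_def by blast
  show ?thesis
  proof (rule image_subset_closed)
    show "continuous_on K (psi w)" by (rule signed_perm_continuous[OF psi_signed_perm[OF w(1)]])
    show "closed (psi v ` K)"
      by (intro compact_imp_closed compact_continuous_image K_compact
          signed_perm_continuous[OF psi_signed_perm[OF w(2)]])
    fix x assume x: "x \<in> K" "\<And>i. \<bar>x $ i\<bar> < 1"
    have "wm w x \<in> X w" using x by (simp add: cell_def)
    then have "R (wm w x) \<in> X w \<union> X v" using sym by blast
    moreover have "R (wm w x) \<notin> X w"
    proof
      assume "R (wm w x) \<in> X w"
      then obtain y where y: "y \<in> K" "R (wm w x) = wm w y" by (auto simp: cell_def)
      have "rot w y $ k + 2 * of_int (idx w k) = 2 * of_int b - (rot w x $ k + 2 * of_int (idx w k))"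
        using Rk[of "wm w x"] unfolding y(2) scaled_coord[OF w(1)] .
      then have "rot w y $ k = 2 * (c * i) - rot w x $ k" unfolding b(1) by simp
      moreover have "\<bar>rot w x $ k\<bar> < 1" by (rule rot_bound_open[OF w(1) x(2)])
      moreover have "\<bar>rot w y $ k\<bar> \<le> 1" using rot_bound[OF w(1)] y(1) K_cube by blast
      moreover have "c * i = 1 \<or> c * i = -1" using c(1) i by auto
      ultimately show False by linarith
    qed
    ultimately obtain y where y: "y \<in> K" "R (wm w x) = wm v y" by (auto simp: cell_def)
    have "psi w x = unfold_map n (wm w x)" using unfold_map_wm[OF w(1)] x K_cube by auto
    also have "\<dots> = unfold_map n (wm v y)" using fold y by metis
    also have "\<dots> = psi v y" using unfold_map_wm[OF w(2)] y K_cube by auto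
    finally show "psi w x \<in> psi v ` K" using y by blast
  qed
qed

lemma psi_const:
  assumes "1 \<le> n" "w \<in> T n" "v \<in> T n" shows "psi w ` K = psi v ` K"
proof -
  have *: "psi w ` K \<subseteq> psi v ` K" if "(w, v) \<in> (face_edges S f n)\<^sup>*" for w v
    using that by induction (use psi_face_edge[OF assms(1)] in blast)+
  have "(w, v) \<in> (face_edges S f n)\<^sup>*" "(v, w) \<in> (face_edges S f n)\<^sup>*"
    using strong assms unfolding strongly_connected_def by auto
  then show ?thesis using * by blast
qed

lemma T_ne: "\<exists>w. w \<in> T n"
  using cell_cover[OF ipt(1)] by blast

lemma fold_map_ex:
  assumes "1 \<le> n"
  shows "\<exists>G. (\<forall>w\<in>T n. \<exists>g. symmetry g \<and> (\<forall>x\<in>cube. G (wm w x) = g x)) \<and>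
    (\<forall>k. \<exists>j c. (c = 1 \<or> c = -1) \<and> (\<forall>x. G x $ j = c * tri (scl n * (x $ k + 1) - 1)))"
proof -
  obtain b where b: "b \<in> T n" using T_ne by blast
  obtain h where h: "signed_perm h" "\<And>x. psi b (h x) = x" "\<And>x. h (psi b x) = x"
    using signed_perm_inverse[OF psi_signed_perm[OF b]] by blast
  define G where "G x = h (unfold_map n x)" for x
  have "\<exists>g. symmetry g \<and> (\<forall>x\<in>cube. G (wm w x) = g x)" if w: "w \<in> T n" for w
  proof (intro exI conjI ballI)
    have "(\<lambda>x. h (psi w x)) ` K = h ` psi w ` K" by (simp add: image_image)
    also have "\<dots> = h ` psi b ` K" by (simp only: psi_const[OF assms w b])
    also have "\<dots> = K" by (simp add: image_image h)
    finally show "symmetry (\<lambda>x. h (psi w x))"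
      unfolding symmetry_def using signed_perm_comp[OF h(1) psi_signed_perm[OF w]] by blast
    show "G (wm w x) = h (psi w x)" if "x \<in> cube" for x
      by (simp add: G_def unfold_map_wm[OF w that])
  qed
  moreover have "\<exists>j c. (c = 1 \<or> c = -1) \<and> (\<forall>x. G x $ j = c * tri (scl n * (x $ k + 1) - 1))" for k
  proof -
    obtain j c where "c = 1 \<or> c = -1" "\<And>x. h x $ j = c * x $ k"
      using signed_perm_face[OF h(1), of k] by blast
    then show ?thesis by (intro exI[of _ j] exI[of _ c]) (simp add: G_def unfold_map_def)
  qed
  ultimately show ?thesis by blast
qed

definition fold_map :: "nat \<Rightarrow> real ^ 'n \<Rightarrow> real ^ 'n" where
  "fold_map n = (SOME G. (\<forall>w\<in>T n. \<exists>g. symmetry g \<and> (\<forall>x\<in>cube. G (wm w x) = g x)) \<and>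
    (\<forall>k. \<exists>j c. (c = 1 \<or> c = -1) \<and> (\<forall>x. G x $ j = c * tri (scl n * (x $ k + 1) - 1))))"

lemma fold_map:
  assumes "1 \<le> n"
  shows fold_map_wm: "w \<in> T n \<Longrightarrow> \<exists>g. symmetry g \<and> (\<forall>x\<in>cube. fold_map n (wm w x) = g x)"
    and fold_map_coord: "\<exists>j c. (c = 1 \<or> c = -1) \<and>
      (\<forall>x. fold_map n x $ j = c * tri (scl n * (x $ k + 1) - 1))"
  using someI_ex[OF fold_map_ex[OF assms]] unfolding fold_map_def by blast+

definition fold_word :: "nat \<Rightarrow> (nat ^ 'n) list \<Rightarrow> (nat ^ 'n) list" where
  "fold_word n u = (THE z. z \<in> T (length u - n) \<and> fold_map n ` X u = X z)"

definition adj :: "nat \<Rightarrow> ((nat ^ 'n) list \<times> (nat ^ 'n) list) set" where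
  "adj n = {(u, v). u \<in> T n \<and> v \<in> T n \<and> X u \<inter> X v \<noteq> {}}"

definition touches :: "(nat ^ 'n) list \<Rightarrow> 'n \<Rightarrow> real \<Rightarrow> bool" where
  "touches z j e \<longleftrightarrow> X z \<inter> face j e \<noteq> {}"

lemma sym_adj: "sym (adj n)"
  by (auto simp: sym_def adj_def)

lemma adj_refl: "u \<in> T n \<Longrightarrow> (u, u) \<in> adj n"
  using cell_ne by (auto simp: adj_def)

lemma cell_cube: "y \<in> T m \<Longrightarrow> X y \<subseteq> cube"
  using cell_subset K_cube by blast

lemma fold_cell:
  assumes "w \<in> T n" "y \<in> T m" "\<And>x. x \<in> cube \<Longrightarrow> fold_map n (wm w x) = g x"
  shows "fold_map n ` X (w @ y) = g ` X y"
  using assms(3) cell_cube[OF assms(2)] by (force simp: cell_append image_image)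

lemma fold_word:
  assumes "1 \<le> n" "u \<in> T (n + m)"
  shows "fold_word n u \<in> T m" "fold_map n ` X u = X (fold_word n u)"
proof -
  obtain w y where u: "u = w @ y" "w \<in> T n" "y \<in> T m" using words_addE[OF assms(2)] by blast
  obtain g where g: "symmetry g" "\<And>x. x \<in> cube \<Longrightarrow> fold_map n (wm w x) = g x"
    using fold_map_wm[OF assms(1) u(2)] by blast
  have l: "length u - n = m" using assms(2) by (simp add: words_length)
  have "fold_map n ` X u = g ` X y" unfolding u(1) by (rule fold_cell[OF u(2,3) g(2)])
  then have "\<exists>!z. z \<in> T (length u - n) \<and> fold_map n ` X u = X z"
    unfolding l using symmetry_cell[OF g(1) u(3)] by simp
  from theI'[OF this] show "fold_word n u \<in> T m" "fold_map n ` X u = X (fold_word n u)"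
    unfolding fold_word_def l by auto
qed

lemma fold_adj:
  assumes "1 \<le> n" "(u, v) \<in> adj (n + m)" shows "(fold_word n u, fold_word n v) \<in> adj m"
proof -
  have u: "u \<in> T (n + m)" "v \<in> T (n + m)" using assms by (auto simp: adj_def)
  obtain x where "x \<in> X u" "x \<in> X v" using assms by (auto simp: adj_def)
  then have "fold_map n x \<in> X (fold_word n u) \<inter> X (fold_word n v)"
    unfolding fold_word(2)[OF assms(1) u(1), symmetric] fold_word(2)[OF assms(1) u(2), symmetric] by blast
  then show ?thesis using fold_word(1)[OF assms(1)] u by (auto simp: adj_def)
qed

lemma fold_descendants:
  assumes "1 \<le> n" "w \<in> T n"
  shows "bij_betw (fold_word n) (descendants S m w) (T m)"
    "\<And>u v. u \<in> descendants S m w \<Longrightarrow> v \<in> descendants S m w \<Longrightarrow>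
      (fold_word n u, fold_word n v) \<in> adj m \<Longrightarrow> (u, v) \<in> adj (n + m)"
proof -
  obtain g where g: "symmetry g" "\<And>x. x \<in> cube \<Longrightarrow> fold_map n (wm w x) = g x"
    using fold_map_wm[OF assms] by blast
  obtain h where h: "symmetry h" "\<And>x. g (h x) = x" "\<And>x. h (g x) = x"
    using symmetry_inverse[OF g(1)] by blast
  have inj: "inj g" using h(3) by (metis injI)
  have im: "X (fold_word n (w @ y)) = g ` X y" if "y \<in> T m" for y
    using fold_word(2)[OF assms(1) append_words[OF assms(2) that]] fold_cell[OF assms(2) that g(2)] by simp
  show "bij_betw (fold_word n) (descendants S m w) (T m)"
    unfolding bij_betw_def
  proof
    show "inj_on (fold_word n) (descendants S m w)"
      unfolding descendants_eq[OF assms(2)]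
    proof (rule inj_onI)
      fix u u' assume uu: "u \<in> (@) w ` T m" "u' \<in> (@) w ` T m" "fold_word n u = fold_word n u'"
      then obtain y y' where u: "u = w @ y" "u' = w @ y'" and
        y: "y \<in> T m" "y' \<in> T m" "fold_word n (w @ y) = fold_word n (w @ y')" by blast
      then have "g ` X y = g ` X y'" using im by metis
      then have "X y = X y'" using inj by (simp add: inj_image_eq_iff)
      then show "u = u'" unfolding u using cell_inj y by blast
    qed
    show "fold_word n ` descendants S m w = T m"
      unfolding descendants_eq[OF assms(2)]
    proof (safe)
      show "fold_word n (w @ y) \<in> T m" if "y \<in> T m" for y
        using fold_word(1)[OF assms(1) append_words[OF assms(2) that]] .
      fix z assume z: "z \<in> T m"
      then obtain y where y: "y \<in> T m" "h ` X z = X y" using symmetry_cell[OF h(1)] by blast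
      have "X (fold_word n (w @ y)) = X z" unfolding im[OF y(1)] y(2)[symmetric] by (simp add: image_image h)
      then have "fold_word n (w @ y) = z"
        using cell_inj fold_word(1)[OF assms(1) append_words[OF assms(2) y(1)]] z by blast
      then show "z \<in> fold_word n ` (@) w ` T m" using y by blast
    qed
  qed
  fix u v assume uv: "u \<in> descendants S m w" "v \<in> descendants S m w"
    and a: "(fold_word n u, fold_word n v) \<in> adj m"
  obtain y z where y: "y \<in> T m" "z \<in> T m" "u = w @ y" "v = w @ z"
    using uv unfolding descendants_eq[OF assms(2)] by blast
  have "g ` X y \<inter> g ` X z \<noteq> {}" using a im y by (auto simp: adj_def)
  then have "X y \<inter> X z \<noteq> {}" using inj by (auto dest: injD)
  then show "(u, v) \<in> adj (n + m)"
    using append_words[OF assms(2)] y by (auto simp: adj_def cell_append)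
qed

lemma fold_strip:
  assumes "1 \<le> n"
  shows "\<exists>j. \<forall>b. \<exists>e. (e = 1 \<or> e = -1) \<and> (\<forall>m. \<forall>u\<in>T (n + m). \<forall>x\<in>X u.
     (scl n * (x $ k + 1) - 1 = 2 * of_int b - 1 \<longrightarrow> touches (fold_word n u) j e) \<and>
     (scl n * (x $ k + 1) - 1 = 2 * of_int b + 1 \<longrightarrow> touches (fold_word n u) j (-e)))"
proof -
  obtain j c where c: "c = 1 \<or> c = -1" "\<And>x. fold_map n x $ j = c * tri (scl n * (x $ k + 1) - 1)"
    using fold_map_coord[OF assms] by blast
  have t: "touches (fold_word n u) j (fold_map n x $ j)" if u: "u \<in> T (n + m)" and x: "x \<in> X u" for m u x
  proof -
    have "fold_map n x \<in> X (fold_word n u)" using fold_word(2)[OF assms u] x by blast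
    moreover have "fold_map n x \<in> cube"
      using cell_cube[OF fold_word(1)[OF assms u]] calculation by blast
    ultimately show ?thesis unfolding touches_def face_def by blast
  qed
  have v: "fold_map n x $ j = - c * parity_sign b" if "scl n * (x $ k + 1) - 1 = 2 * of_int b - 1" for x b
    unfolding c(2) that by (subst tri_eq[of _ b]) auto
  have v': "fold_map n x $ j = - (- c * parity_sign b)" if "scl n * (x $ k + 1) - 1 = 2 * of_int b + 1" for x b
    unfolding c(2) that by (subst tri_eq[of _ b]) auto
  have "- c * parity_sign b = 1 \<or> - c * parity_sign b = -1" for b
    using c(1) by (auto simp: parity_sign_def)
  then show ?thesis using t v v' by metis
qed

lemma fold_glue:
  assumes "1 \<le> n" "(w, v) \<in> face_edges S f n"
  shows "\<exists>j e. (e = 1 \<or> e = -1) \<and> (\<forall>m. \<forall>u\<in>descendants S m w. \<forall>u'\<in>descendants S m v.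
    fold_word n u = fold_word n u' \<longrightarrow> touches (fold_word n u) j e \<longrightarrow> (u, u') \<in> adj (n + m))"
proof -
  obtain j i where F: "wm w ` cube \<inter> wm v ` cube = wm w ` face j i" and i: "i = 1 \<or> i = -1" and w: "w \<in> T n" "v \<in> T n"
    using face_edge_hyperplane[OF assms(2)] by blast
  obtain g where g: "symmetry g" "\<And>x. x \<in> cube \<Longrightarrow> fold_map n (wm w x) = g x"
    using fold_map_wm[OF assms(1) w(1)] by blast
  obtain g' where g': "symmetry g'" "\<And>x. x \<in> cube \<Longrightarrow> fold_map n (wm v x) = g' x"
    using fold_map_wm[OF assms(1) w(2)] by blast
  obtain h where h: "symmetry h" "\<And>x. g (h x) = x" "\<And>x. h (g x) = x"
    using symmetry_inverse[OF g(1)] by blast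
  have inj': "inj g'" using g'(1) signed_perm_inj by (auto simp: symmetry_def)
  obtain k c where kc: "c = 1 \<or> c = -1" "\<And>x. g x $ k = c * x $ j"
    using signed_perm_face[OF conjunct1[OF g(1)[unfolded symmetry_def]], of j] by blast
  show ?thesis
  proof (intro exI conjI allI ballI impI)
    show "c * i = 1 \<or> c * i = -1" using kc i by auto
    fix m u u' assume uu: "u \<in> descendants S m w" "u' \<in> descendants S m v"
      and eq: "fold_word n u = fold_word n u'" and t: "touches (fold_word n u) k (c * i)"
    obtain y y' where y: "y \<in> T m" "u = w @ y" "y' \<in> T m" "u' = v @ y'"
      using uu unfolding descendants_eq[OF w(1)] descendants_eq[OF w(2)] by blast
    have im: "X (fold_word n u) = g ` X y"
      using fold_word(2)[OF assms(1) append_words[OF w(1) y(1)]] fold_cell[OF w(1) y(1) g(2)] y by simp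
    have im': "X (fold_word n u') = g' ` X y'"
      using fold_word(2)[OF assms(1) append_words[OF w(2) y(3)]] fold_cell[OF w(2) y(3) g'(2)] y by simp
    obtain q where q: "q \<in> X (fold_word n u)" "q \<in> cube" "q $ k = c * i"
      using t by (auto simp: touches_def face_def)
    obtain x where x: "x \<in> X y" "q = g x" using q(1) im by blast
    have "x $ j = i" using q(3) kc(1) unfolding x(2) kc(2) by auto
    moreover have xc: "x \<in> cube" using cell_cube[OF y(1)] x by blast
    ultimately have "wm w x \<in> wm w ` face j i" by (auto simp: face_def)
    then obtain r where r: "r \<in> cube" "wm w x = wm v r" using F by blast
    have "g' r = q" using g(2)[OF xc] g'(2)[OF r(1)] r(2) x by simp
    moreover have "q \<in> g' ` X y'" using q(1) im' eq by simp
    ultimately have "r \<in> X y'" using inj' by (auto dest: injD)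
    then have "wm w x \<in> X u'" using r y by (simp add: cell_append)
    moreover have "wm w x \<in> X u" using x y by (simp add: cell_append)
    ultimately show "(u, u') \<in> adj (n + m)"
      using append_words w y by (auto simp: adj_def)
  qed
qed

section \<open>Connectedness and separation\<close>

lemma touches_Nil: "e = 1 \<or> e = -1 \<Longrightarrow> touches [] j e"
  using nondeg by (auto simp: touches_def nondegenerate_def)

lemma face_edge_adj:
  assumes "1 \<le> n" "(w, v) \<in> face_edges S f n" shows "(w, v) \<in> adj n"
proof -
  have w: "w \<in> T n" "v \<in> T n" using assms(2) by (auto simp: face_edges_def)
  have d: "w \<in> descendants S 0 w" "v \<in> descendants S 0 v"
    using w by (auto simp: in_descendants words_def)
  have "fold_word n w = []" "fold_word n v = []" using fold_word(1)[OF assms(1), of _ 0] w by auto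
  then show ?thesis using fold_glue[OF assms] d touches_Nil by fastforce
qed

lemma conn_T: "conn (adj n) (T n)"
proof (cases "n = 0")
  case True then show ?thesis by (simp add: conn_singleton)
next
  case False
  show ?thesis unfolding conn_def
  proof (intro ballI)
    fix x y assume xy: "x \<in> T n" "y \<in> T n"
    have "(x, y) \<in> (face_edges S f n)\<^sup>*" using strong False xy by (auto simp: strongly_connected_def)
    moreover have "face_edges S f n \<subseteq> adj n \<inter> T n \<times> T n"
      using face_edge_adj[of n] False by (auto simp: face_edges_def)
    ultimately show "(x, y) \<in> (adj n \<inter> T n \<times> T n)\<^sup>*" by (meson in_mono rtrancl_mono)
  qed
qed

lemma connected_K: "connected K"
  unfolding connected_closed
proof clarify
  fix A B assume AB: "closed A" "closed B" "K \<subseteq> A \<union> B" "A \<inter> B \<inter> K = {}"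
    and ne: "A \<inter> K \<noteq> {}" "B \<inter> K \<noteq> {}"
  have "compact (K \<inter> A)" "closed (K \<inter> B)" "K \<inter> A \<inter> (K \<inter> B) = {}"
    using AB K_compact by (auto simp: compact_Int_closed closed_Int compact_imp_closed)
  then obtain d where d: "0 < d" "\<And>x y. x \<in> K \<inter> A \<Longrightarrow> y \<in> K \<inter> B \<Longrightarrow> d \<le> dist x y"
    using separate_compact_closed by metis
  obtain n where n: "2 * real CARD('n) / scl n < d" using scl_tendsto[OF d(1)] by blast
  have mono: "X w \<subseteq> A" if h: "w \<in> T n" "X w \<inter> A \<noteq> {}" for w
  proof
    fix y assume y: "y \<in> X w"
    obtain x where x: "x \<in> X w" "x \<in> A" using h by blast
    have "dist x y < d" using cell_dist[OF h(1) x(1) y] n by linarith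
    moreover have "x \<in> K" "y \<in> K" using cell_subset[OF h(1)] x y by auto
    ultimately show "y \<in> A" using d(2)[of x y] x AB(3) by fastforce
  qed
  obtain a b where ab: "a \<in> A" "a \<in> K" "b \<in> B" "b \<in> K" using ne by blast
  obtain w v where w: "w \<in> T n" "a \<in> X w" and v: "v \<in> T n" "b \<in> X v" using cell_cover ab by metis
  have "(w, v) \<in> (adj n \<inter> T n \<times> T n)\<^sup>*" using conn_T w v by (auto simp: conn_def)
  then have "X v \<subseteq> A"
  proof induction
    case base then show ?case using mono w ab by blast
  next
    case (step y z) then show ?case using mono[of z] by (auto simp: adj_def)
  qed
  then show False using v ab AB(4) by blast
qed

lemma connected_cell: "w \<in> T n \<Longrightarrow> connected (X w)"
  unfolding cell_def by (intro connected_continuous_image wm_continuous connected_K)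

lemma idx_near:
  assumes "w \<in> T n" "v \<in> T n" "x \<in> X w" "y \<in> X v"
  shows "2 * (\<bar>of_int (idx w i - idx v i)\<bar> - 1) / scl n \<le> \<bar>x $ i - y $ i\<bar>"
proof -
  obtain x' y' where *: "x' \<in> K" "y' \<in> K" "x = wm w x'" "y = wm v y'"
    using assms by (auto simp: cell_def)
  have "\<bar>rot w x' $ i\<bar> \<le> 1" "\<bar>rot v y' $ i\<bar> \<le> 1"
    using rot_bound[OF assms(1)] rot_bound[OF assms(2)] * K_cube by blast+
  moreover have "x $ i - y $ i = (rot w x' $ i - rot v y' $ i + 2 * of_int (idx w i - idx v i)) / scl n"
    by (simp add: * rot_idx(2)[OF assms(1)] rot_idx(2)[OF assms(2)] diff_divide_distrib[symmetric])
  then have "\<bar>x $ i - y $ i\<bar> * scl n = \<bar>rot w x' $ i - rot v y' $ i + 2 * of_int (idx w i - idx v i)\<bar>"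
    by (simp add: abs_divide)
  moreover have "2 * (\<bar>d\<bar> - 1) \<le> \<bar>a - b + 2 * d\<bar>" if "\<bar>a\<bar> \<le> 1" "\<bar>b\<bar> \<le> 1" for a b d :: real
    using that by (smt (verit))
  ultimately have "2 * (\<bar>of_int (idx w i - idx v i)\<bar> - 1) \<le> \<bar>x $ i - y $ i\<bar> * scl n" by metis
  then show ?thesis by (simp add: pos_divide_le_eq)
qed

text \<open>Up to scaling there are only finitely many relative positions of two cells with touching
  cubes, which makes the separation of disjoint cells uniform.\<close>

lemma separation:
  "\<exists>c>0. \<forall>n. \<forall>w\<in>T n. \<forall>v\<in>T n. X w \<inter> X v = {} \<longrightarrow>
     (\<forall>x\<in>X w. \<forall>y\<in>X v. \<exists>i. c / scl n \<le> \<bar>x $ i - y $ i\<bar>)"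
proof -
  define D :: "('n \<Rightarrow> int) set" where "D = PiE UNIV (\<lambda>_. {-1..1})"
  define P where "P = {g :: real ^ 'n \<Rightarrow> real ^ 'n. signed_perm g} \<times> {g :: real ^ 'n \<Rightarrow> real ^ 'n. signed_perm g} \<times> D"
  have finP: "finite P" unfolding P_def D_def
    by (intro finite_cartesian_product finite_signed_perms finite_PiE) auto
  define shift where "shift = (\<lambda>(\<delta> :: 'n \<Rightarrow> int) (x :: real ^ 'n). \<chi> i. x $ i + 2 * of_int (\<delta> i))"
  have "\<exists>d>0. g ` K \<inter> shift \<delta> ` h ` K = {} \<longrightarrow> (\<forall>x\<in>K. \<forall>y\<in>K. d \<le> dist (g x) (shift \<delta> (h y)))"
    if "(g, h, \<delta>) \<in> P" for g h \<delta>
  proof (cases "g ` K \<inter> shift \<delta> ` h ` K = {}")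
    case True
    have "compact (g ` K)" "compact (shift \<delta> ` h ` K)"
      using that unfolding P_def shift_def
      by (auto intro!: compact_continuous_image K_compact signed_perm_continuous continuous_intros)
    then obtain d where "d > 0" "\<And>x y. x \<in> g ` K \<Longrightarrow> y \<in> shift \<delta> ` h ` K \<Longrightarrow> d \<le> dist x y"
      using separate_compact_closed[OF _ compact_imp_closed True] by metis
    then show ?thesis by blast
  qed (use zero_less_one in blast)
  then have "\<forall>q\<in>P. \<exists>d>0. case q of (g, h, \<delta>) \<Rightarrow>
    g ` K \<inter> shift \<delta> ` h ` K = {} \<longrightarrow> (\<forall>x\<in>K. \<forall>y\<in>K. d \<le> dist (g x) (shift \<delta> (h y)))" by auto
  from bchoice[OF this] obtain d where dP: "\<forall>q\<in>P. 0 < d q \<and> (case q of (g, h, \<delta>) \<Rightarrow>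
    g ` K \<inter> shift \<delta> ` h ` K = {} \<longrightarrow> (\<forall>x\<in>K. \<forall>y\<in>K. d q \<le> dist (g x) (shift \<delta> (h y))))"
    by (rule exE)
  have d: "0 < d q" if "q \<in> P" for q using dP that by blast
  have d2: "d (g, h, \<delta>) \<le> dist (g x) (shift \<delta> (h y))"
    if "(g, h, \<delta>) \<in> P" "g ` K \<inter> shift \<delta> ` h ` K = {}" "x \<in> K" "y \<in> K" for g h \<delta> x y
    using bspec[OF dP that(1)] that(2-4) by simp
  define c where "c = Min (insert 2 (d ` P)) / real CARD('n)"
  have m0: "0 < Min (insert 2 (d ` P))" using finP d by (subst Min_gr_iff) auto
  have m1: "Min (insert 2 (d ` P)) \<le> 2" "\<And>q. q \<in> P \<Longrightarrow> Min (insert 2 (d ` P)) \<le> d q"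
    using finP by auto
  have c0: "0 < c" unfolding c_def using m0 by simp
  have c2: "c \<le> 2"
  proof -
    have "c \<le> Min (insert 2 (d ` P)) / 1" unfolding c_def using m0 by (intro divide_left_mono) auto
    then show ?thesis using m1(1) by simp
  qed
  show ?thesis
  proof (intro exI[of _ c] conjI allI ballI impI c0)
    fix n w v x y assume w: "w \<in> T n" and v: "v \<in> T n" and dis: "X w \<inter> X v = {}"
      and x: "x \<in> X w" and y: "y \<in> X v"
    show "\<exists>i. c / scl n \<le> \<bar>x $ i - y $ i\<bar>"
    proof (cases "\<exists>i. 2 \<le> \<bar>idx w i - idx v i\<bar>")
      case True
      then obtain i where "2 \<le> \<bar>idx w i - idx v i\<bar>" by blast
      then have "2 * 1 / scl n \<le> 2 * (\<bar>of_int (idx w i - idx v i)\<bar> - 1) / scl n"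
        by (intro divide_right_mono) auto
      also have "\<dots> \<le> \<bar>x $ i - y $ i\<bar>" by (rule idx_near[OF w v x y])
      finally have "2 / scl n \<le> \<bar>x $ i - y $ i\<bar>" by simp
      moreover have "c / scl n \<le> 2 / scl n" using c2 by (intro divide_right_mono) auto
      ultimately have "c / scl n \<le> \<bar>x $ i - y $ i\<bar>" by linarith
      then show ?thesis ..
    next
      case False
      define \<delta> where "\<delta> i = idx v i - idx w i" for i
      have "\<delta> i \<in> {-1..1}" for i
      proof -
        have "\<not> 2 \<le> \<bar>idx w i - idx v i\<bar>" using False by blast
        then show ?thesis unfolding \<delta>_def by simp linarith
      qed
      then have "\<delta> \<in> D" unfolding D_def by blast
      then have q: "(rot w, rot v, \<delta>) \<in> P" unfolding P_def using rot_idx(1) w v by auto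
      have eq: "(wm w x' $ i - wm v y' $ i) * scl n = rot w x' $ i - shift \<delta> (rot v y') $ i" for x' y' i
        using scaled_coord[OF w, of x' i] scaled_coord[OF v, of y' i]
        by (simp add: shift_def \<delta>_def algebra_simps)
      have "rot w ` K \<inter> shift \<delta> ` rot v ` K = {}"
      proof (rule ccontr)
        assume "\<not> ?thesis"
        then obtain x' y' where *: "x' \<in> K" "y' \<in> K" "rot w x' = shift \<delta> (rot v y')" by blast
        have "(wm w x' $ i - wm v y' $ i) * scl n = 0" for i unfolding eq *(3) by simp
        then have "wm w x' = wm v y'" by (simp add: vec_eq_iff)
        then show False using dis * by (auto simp: cell_def)
      qed
      note dd = d2[OF q this]
      obtain x' y' where *: "x' \<in> K" "y' \<in> K" "x = wm w x'" "y = wm v y'"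
        using x y by (auto simp: cell_def)
      have "Min (insert 2 (d ` P)) \<le> dist (rot w x') (shift \<delta> (rot v y'))"
        using dd[OF *(1,2)] m1(2)[OF q] by linarith
      also have "\<dots> \<le> (\<Sum>i\<in>UNIV. \<bar>(rot w x' - shift \<delta> (rot v y')) $ i\<bar>)"
        unfolding dist_norm by (rule norm_le_l1_cart)
      also have "\<dots> = (\<Sum>i\<in>UNIV. \<bar>x $ i - y $ i\<bar> * scl n)"
      proof (rule sum.cong[OF refl])
        fix i
        have "\<bar>(rot w x' - shift \<delta> (rot v y')) $ i\<bar> = \<bar>(x $ i - y $ i) * scl n\<bar>"
          unfolding *(3,4) eq by simp
        then show "\<bar>(rot w x' - shift \<delta> (rot v y')) $ i\<bar> = \<bar>x $ i - y $ i\<bar> * scl n"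
          by (simp add: abs_mult)
      qed
      finally have le: "Min (insert 2 (d ` P)) \<le> (\<Sum>i\<in>(UNIV::'n set). \<bar>x $ i - y $ i\<bar> * scl n)" .
      show ?thesis
      proof (rule ccontr)
        assume "\<not> ?thesis"
        then have "\<bar>x $ i - y $ i\<bar> * scl n < c" for i by (auto simp: not_le field_simps)
        then have "(\<Sum>i\<in>(UNIV::'n set). \<bar>x $ i - y $ i\<bar> * scl n) < (\<Sum>i\<in>(UNIV::'n set). c)"
          by (intro sum_strict_mono) auto
        then show False using le by (simp add: c_def)
      qed
    qed
  qed
qed

end

section \<open>Energies and weights\<close>

locale cubic_tiling_energy = cubic_tiling N K S f
  for N :: nat and K :: "(real ^ 'n) set" and S :: "(nat ^ 'n) set"
    and f :: "nat ^ 'n \<Rightarrow> real ^ 'n \<Rightarrow> real ^ 'n" +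
  fixes p :: real
  assumes p_pos: "0 < p"
begin

abbreviation energy :: "nat \<Rightarrow> ((nat ^ 'n) list \<Rightarrow> real) \<Rightarrow> real" where
  "energy n \<phi> \<equiv> p_energy S X p n (T n) \<phi>"

definition nbr :: "nat \<Rightarrow> (nat ^ 'n) list \<Rightarrow> (nat ^ 'n) list set" where
  "nbr n u = {v. (u, v) \<in> adj n}"

definition nbr2 :: "nat \<Rightarrow> (nat ^ 'n) list \<Rightarrow> (nat ^ 'n) list set" where
  "nbr2 n u = (\<Union>v\<in>nbr n u. nbr n v)"

definition deg :: real where "deg = real (card (PiE (UNIV :: 'n set) (\<lambda>_. {-1..1::int})))"

lemma nbr_T: "nbr n u \<subseteq> T n" by (auto simp: nbr_def adj_def)
lemma nbr2_T: "nbr2 n u \<subseteq> T n" using nbr_T by (auto simp: nbr2_def)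
lemma finite_nbr [simp]: "finite (nbr n u)" using finite_subset[OF nbr_T] by simp
lemma finite_nbr2 [simp]: "finite (nbr2 n u)" using finite_subset[OF nbr2_T] by simp
lemma nbr_sym: "v \<in> nbr n u \<longleftrightarrow> u \<in> nbr n v" using sym_adj by (auto simp: nbr_def dest: symD)
lemma nbr_self: "u \<in> T n \<Longrightarrow> u \<in> nbr n u" by (simp add: nbr_def adj_refl)
lemma nbr_nbr2: "v \<in> nbr n u \<Longrightarrow> v \<in> nbr2 n u" using nbr_T nbr_self[of v n] unfolding nbr2_def by blast

lemma neighbours_nbr: "w \<in> T n \<Longrightarrow> neighbours S X w = nbr n w"
  by (auto simp: neighbours_def nbr_def adj_def words_length)

lemma card_nbr: "real (card (nbr n u)) \<le> deg"
proof (cases "u \<in> T n")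
  case True
  let ?P = "PiE (UNIV :: 'n set) (\<lambda>_. {-1..1::int})"
  have "card (nbr n u) \<le> card ?P"
  proof (rule card_inj_on_le)
    show "inj_on (\<lambda>v i. idx v i - idx u i) (nbr n u)"
    proof (rule inj_onI)
      fix v v' assume v: "v \<in> nbr n u" "v' \<in> nbr n u" "(\<lambda>i. idx v i - idx u i) = (\<lambda>i. idx v' i - idx u i)"
      have "idx v i = idx v' i" for i using fun_cong[OF v(3), of i] by simp
      then show "v = v'" using idx_inj nbr_T v by blast
    qed
    show "(\<lambda>v i. idx v i - idx u i) ` nbr n u \<subseteq> ?P"
    proof
      fix d assume "d \<in> (\<lambda>v i. idx v i - idx u i) ` nbr n u"
      then obtain v where v: "v \<in> nbr n u" "d = (\<lambda>i. idx v i - idx u i)" by blast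
      then obtain x where x: "x \<in> X u" "x \<in> X v" "v \<in> T n" by (auto simp: nbr_def adj_def)
      have "idx v i - idx u i \<in> {-1..1}" for i
      proof -
        have "(\<bar>of_int (idx v i - idx u i)\<bar> :: real) - 1 \<le> 0"
          using idx_near[OF x(3) True x(2,1), of i] by (simp add: pos_divide_le_eq)
        then have "\<bar>idx v i - idx u i\<bar> \<le> 1" by linarith
        then show ?thesis by auto
      qed
      then show "d \<in> ?P" unfolding v(2) by blast
    qed
    show "finite ?P" by (intro finite_PiE) auto
  qed
  then show ?thesis by (simp add: deg_def)
next
  case False
  then have "nbr n u = {}" by (auto simp: nbr_def adj_def)
  then show ?thesis by (simp add: deg_def)
qed

lemma deg_nonneg: "0 \<le> deg" by (simp add: deg_def)

lemma card_nbr2: "real (card (nbr2 n u)) \<le> deg * deg"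
proof -
  have "card (nbr2 n u) \<le> (\<Sum>v\<in>nbr n u. card (nbr n v))"
    unfolding nbr2_def by (rule card_UN_le) simp
  then have "real (card (nbr2 n u)) \<le> (\<Sum>v\<in>nbr n u. real (card (nbr n v)))"
    by (metis of_nat_le_iff of_nat_sum)
  also have "\<dots> \<le> (\<Sum>v\<in>nbr n u. deg)" by (intro sum_mono card_nbr)
  also have "\<dots> \<le> deg * deg" using mult_right_mono[OF card_nbr[of n u] deg_nonneg] by simp
  finally show ?thesis .
qed

lemma energy_nonneg: "0 \<le> p_energy S X p n A \<phi>"
  by (auto simp: p_energy_def intro!: sum_nonneg)

lemma energy_eq: "energy n \<phi> = 1 / 2 * (\<Sum>u\<in>T n. \<Sum>v\<in>nbr n u. \<bar>\<phi> u - \<phi> v\<bar> powr p)"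
proof -
  have "(\<Sum>u\<in>T n. \<Sum>v\<in>nbr n u. \<bar>\<phi> u - \<phi> v\<bar> powr p) = (\<Sum>(u, v)\<in>Sigma (T n) (nbr n). \<bar>\<phi> u - \<phi> v\<bar> powr p)"
    by (rule sum.Sigma) auto
  also have "\<dots> = (\<Sum>(u, v)\<in>(T n \<times> T n) \<inter> cell_edges S X n. \<bar>\<phi> u - \<phi> v\<bar> powr p)"
    by (rule sum.mono_neutral_right) (auto simp: nbr_def adj_def cell_edges_def)
  finally show ?thesis by (simp add: p_energy_def)
qed

lemma energy_le:
  assumes "\<And>u v. (u, v) \<in> adj n \<Longrightarrow> \<bar>\<phi> u - \<phi> v\<bar> \<le> r u + r v" "\<And>u. u \<in> T n \<Longrightarrow> 0 \<le> r u"
  shows "energy n \<phi> \<le> 2 powr p * deg * (\<Sum>u\<in>T n. r u powr p)"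
proof -
  define s where "s = (\<Sum>u\<in>T n. \<Sum>v\<in>nbr n u. r u powr p)"
  have s: "s \<le> deg * (\<Sum>u\<in>T n. r u powr p)"
    unfolding s_def sum_distrib_left by (intro sum_mono) (simp add: card_nbr mult_right_mono)
  have sw: "(\<Sum>u\<in>T n. \<Sum>v\<in>nbr n u. r v powr p) = s"
  proof -
    have "(\<Sum>u\<in>T n. \<Sum>v\<in>nbr n u. r v powr p) = (\<Sum>u\<in>T n. \<Sum>v\<in>{v\<in>T n. (u, v) \<in> adj n}. r v powr p)"
      by (intro sum.cong) (auto simp: nbr_def adj_def)
    also have "\<dots> = (\<Sum>v\<in>T n. \<Sum>u\<in>{u\<in>T n. (u, v) \<in> adj n}. r v powr p)"
      by (rule sum.swap_restrict) auto
    also have "\<dots> = s" unfolding s_def using sym_adj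
      by (intro sum.cong) (auto simp: nbr_def adj_def)
    finally show ?thesis .
  qed
  have "(\<Sum>u\<in>T n. \<Sum>v\<in>nbr n u. \<bar>\<phi> u - \<phi> v\<bar> powr p)
      \<le> (\<Sum>u\<in>T n. \<Sum>v\<in>nbr n u. 2 powr p * (r u powr p + r v powr p))"
  proof (intro sum_mono)
    fix u v assume u: "u \<in> T n" and v: "v \<in> nbr n u"
    have "\<bar>\<phi> u - \<phi> v\<bar> powr p \<le> (r u + r v) powr p"
      using assms(1)[of u v] v p_pos by (intro powr_mono2) (auto simp: nbr_def)
    also have "\<dots> \<le> 2 powr p * (r u powr p + r v powr p)"
      using add_powr_le assms(2) u v nbr_T p_pos by blast
    finally show "\<bar>\<phi> u - \<phi> v\<bar> powr p \<le> 2 powr p * (r u powr p + r v powr p)" .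
  qed
  also have "\<dots> = 2 powr p * (s + s)"
    unfolding sum_distrib_left[symmetric] sum.distrib sw by (simp only: s_def)
  finally have "energy n \<phi> \<le> 2 powr p * s" unfolding energy_eq by simp
  also have "\<dots> \<le> 2 powr p * (deg * (\<Sum>u\<in>T n. r u powr p))" by (intro mult_left_mono s) auto
  finally show ?thesis by (simp add: mult.assoc)
qed

definition grad :: "nat \<Rightarrow> ((nat ^ 'n) list \<Rightarrow> real) \<Rightarrow> (nat ^ 'n) list \<Rightarrow> real" where
  "grad n \<phi> u = (\<Sum>v\<in>nbr n u. \<bar>\<phi> u - \<phi> v\<bar>)"

lemma grad_nonneg: "0 \<le> grad n \<phi> u" by (simp add: grad_def sum_nonneg)

lemma grad_ge: "(u, v) \<in> adj n \<Longrightarrow> \<bar>\<phi> u - \<phi> v\<bar> \<le> grad n \<phi> u"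
  unfolding grad_def by (rule member_le_sum[of v]) (auto simp: nbr_def[of n u] intro: finite_nbr[unfolded nbr_def])

lemma grad_energy: "(\<Sum>u\<in>T n. grad n \<phi> u powr p) \<le> 2 * deg powr p * energy n \<phi>"
proof -
  have "(\<Sum>u\<in>T n. grad n \<phi> u powr p) \<le> (\<Sum>u\<in>T n. deg powr p * (\<Sum>v\<in>nbr n u. \<bar>\<phi> u - \<phi> v\<bar> powr p))"
    unfolding grad_def by (intro sum_mono sum_powr_le_bound) (auto simp: p_pos card_nbr)
  then show ?thesis unfolding energy_eq by (simp add: sum_distrib_left)
qed

lemma grad_variation:
  assumes "U \<subseteq> T n" "conn (adj n) U" "x \<in> U" "y \<in> U"
  shows "\<bar>\<phi> x - \<phi> y\<bar> \<le> sum (grad n \<phi>) U"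
  by (rule conn_variation[OF _ assms(2-4)])
    (use assms(1) grad_ge grad_nonneg finite_subset[OF _ finite_T] in auto)

lemma sum_descendants:
  assumes "V \<subseteq> T n"
  shows "(\<Sum>u\<in>{u\<in>T (n + m). take n u \<in> V}. h u) = (\<Sum>w\<in>V. \<Sum>u\<in>descendants S m w. h u)"
proof -
  have "descendants S m w = {u \<in> {u\<in>T (n + m). take n u \<in> V}. take n u = w}" if "w \<in> V" for w
    using subsetD[OF assms that] that in_descendants[of w S n _ m] by auto
  then have "(\<Sum>w\<in>V. \<Sum>u\<in>descendants S m w. h u) =
      (\<Sum>w\<in>V. sum h {u \<in> {u\<in>T (n + m). take n u \<in> V}. take n u = w})" by (intro sum.cong) auto
  also have "\<dots> = (\<Sum>u\<in>{u\<in>T (n + m). take n u \<in> V}. h u)"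
    by (rule sum.group) (use finite_subset[OF assms finite_T] in auto)
  finally show ?thesis ..
qed

lemma sum_fold_word:
  fixes h :: "(nat ^ 'n) list \<Rightarrow> real"
  assumes "1 \<le> n" "V \<subseteq> T n"
  shows "(\<Sum>u\<in>{u\<in>T (n + m). take n u \<in> V}. h (fold_word n u)) = real (card V) * sum h (T m)"
proof -
  have "(\<Sum>u\<in>descendants S m w. h (fold_word n u)) = sum h (T m)" if "w \<in> V" for w
    by (rule sum.reindex_bij_betw, rule fold_descendants(1)) (use assms that in auto)
  then show ?thesis unfolding sum_descendants[OF assms(2)] by simp
qed

lemma cell_take: "u \<in> T (n + m) \<Longrightarrow> X u \<subseteq> X (take n u)"
  using cell_append_subset[OF drop_words, of u n m "take n u"] by simp

lemma adj_take: "(u, v) \<in> adj (n + m) \<Longrightarrow> (take n u, take n v) \<in> adj n"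
  using cell_take[of _ n m] take_words unfolding adj_def by blast

abbreviation conductance :: "nat \<Rightarrow> ennreal" where
  "conductance m \<equiv> conductance_const S X p m"

definition admissible :: "nat \<Rightarrow> nat \<Rightarrow> (nat ^ 'n) list \<Rightarrow> ((nat ^ 'n) list \<Rightarrow> real) \<Rightarrow> bool" where
  "admissible n m w \<phi> \<longleftrightarrow> (\<forall>u\<in>T (n + m).
     (take n u = w \<longrightarrow> \<phi> u = 1) \<and> (take n u \<notin> nbr n w \<longrightarrow> \<phi> u = 0))"

lemma admissible_iff:
  assumes "w \<in> T n"
  shows "admissible n m w \<phi> \<longleftrightarrow> (\<forall>u\<in>descendants S m w. \<phi> u = 1) \<and>
    (\<forall>v \<in> words S (length w) - neighbours S X w. \<forall>u\<in>descendants S m v. \<phi> u = 0)"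
proof -
  have l: "length w = n" using assms by (rule words_length)
  show ?thesis
    unfolding neighbours_nbr[OF assms] l
  proof (intro iffI conjI ballI)
    fix u assume adm: "admissible n m w \<phi>"
    show "\<phi> u = 1" if "u \<in> descendants S m w"
      using adm that in_descendants[OF assms, of u m] by (simp add: admissible_def)
    show "\<phi> u = 0" if "v \<in> T n - nbr n w" "u \<in> descendants S m v" for v
      using adm that in_descendants[of v S n u m] by (simp add: admissible_def)
  next
    assume r: "(\<forall>u\<in>descendants S m w. \<phi> u = 1) \<and> (\<forall>v\<in>T n - nbr n w. \<forall>u\<in>descendants S m v. \<phi> u = 0)"
    show "admissible n m w \<phi>"
      unfolding admissible_def
    proof (intro ballI conjI impI)
      fix u assume u: "u \<in> T (n + m)"
      show "\<phi> u = 1" if "take n u = w" using r descendants_take[OF u] that by simp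
      show "\<phi> u = 0" if "take n u \<notin> nbr n w"
        using r descendants_take[OF u] take_words[OF u] that by blast
    qed
  qed
qed

lemma conductance_le:
  assumes "\<And>n w. 1 \<le> n \<Longrightarrow> w \<in> T n \<Longrightarrow> \<exists>\<phi>. admissible n m w \<phi> \<and> energy (n + m) \<phi> \<le> c"
  shows "conductance m \<le> ennreal c"
  unfolding conductance_const_def
proof (rule SUP_least, clarify)
  fix w assume "w \<in> all_words S" "1 \<le> length w"
  then have w: "w \<in> T (length w)" by (auto simp: all_words_def words_def)
  obtain \<phi> where \<phi>: "admissible (length w) m w \<phi>" "energy (length w + m) \<phi> \<le> c"
    using assms[OF \<open>1 \<le> length w\<close> w] by blast
  show "(INF \<phi> \<in> {\<phi>. (\<forall>u\<in>descendants S m w. \<phi> u = 1) \<and>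
         (\<forall>v \<in> words S (length w) - neighbours S X w. \<forall>u\<in>descendants S m v. \<phi> u = 0)}.
          ennreal (p_energy S X p (length w + m) (words S (length w + m)) \<phi>)) \<le> ennreal c"
    by (rule INF_lower2[of \<phi>]) (use \<phi> admissible_iff[OF w] ennreal_leI in auto)
qed

lemma conductance_less:
  assumes "conductance m < ennreal c" "1 \<le> n" "w \<in> T n"
  obtains \<phi> where "admissible n m w \<phi>" "energy (n + m) \<phi> \<le> c"
proof -
  have l: "length w = n" using assms(3) by (rule words_length)
  let ?A = "{\<phi>. (\<forall>u\<in>descendants S m w. \<phi> u = 1) \<and>
         (\<forall>v \<in> words S (length w) - neighbours S X w. \<forall>u\<in>descendants S m v. \<phi> u = 0)}"
  have "w \<in> {w \<in> all_words S. length w \<ge> 1}" using assms l by (auto simp: all_words_def)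
  then have "(INF \<phi> \<in> ?A. ennreal (p_energy S X p (length w + m) (words S (length w + m)) \<phi>)) \<le> conductance m"
    unfolding conductance_const_def by (rule SUP_upper)
  then have "(INF \<phi> \<in> ?A. ennreal (p_energy S X p (length w + m) (words S (length w + m)) \<phi>)) < ennreal c"
    using assms(1) by (rule le_less_trans)
  then obtain \<phi> where \<phi>: "\<phi> \<in> ?A" "ennreal (energy (n + m) \<phi>) < ennreal c"
    unfolding INF_less_iff l by blast
  then have "energy (n + m) \<phi> \<le> c" using energy_nonneg by (simp add: ennreal_less_iff)
  moreover have "admissible n m w \<phi>" using \<phi>(1) admissible_iff[OF assms(3)] by blast
  ultimately show ?thesis using that by blast
qed

lemma weight_admissible:
  assumes "w \<in> T n" "0 < t" "\<And>u. u \<in> T (n + m) \<Longrightarrow> 0 \<le> r u"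
    and "\<And>U x y. U \<subseteq> T (n + m) \<Longrightarrow> conn (adj (n + m)) U \<Longrightarrow> x \<in> U \<Longrightarrow> take n x \<notin> nbr n w \<Longrightarrow>
      y \<in> U \<Longrightarrow> take n y = w \<Longrightarrow> t \<le> sum r U"
  shows "\<exists>\<phi>. admissible n m w \<phi> \<and>
    energy (n + m) \<phi> \<le> 2 powr p * deg * (\<Sum>u\<in>T (n + m). r u powr p) / t powr p"
proof -
  define A where "A = {u \<in> T (n + m). take n u \<notin> nbr n w}"
  have r0: "\<forall>u\<in>T (n + m). 0 \<le> r u" using assms(3) by blast
  obtain \<phi> where \<phi>: "\<forall>u\<in>A. \<phi> u = (0::real)"
    "\<forall>u\<in>T (n + m). \<forall>v\<in>T (n + m). (u, v) \<in> adj (n + m) \<longrightarrow> \<bar>\<phi> u - \<phi> v\<bar> \<le> r u / t + r v / t"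
    "\<forall>y\<in>T (n + m) - A. (\<forall>U\<subseteq>T (n + m). conn (adj (n + m)) U \<longrightarrow> y \<in> U \<longrightarrow> U \<inter> A \<noteq> {} \<longrightarrow>
       t \<le> sum r U) \<longrightarrow> \<phi> y = 1"
    using potential[OF finite_T sym_adj[of "n + m"] r0 assms(2), of A] by blast
  have "admissible n m w \<phi>"
    unfolding admissible_def
  proof (intro ballI conjI impI)
    fix u assume u: "u \<in> T (n + m)"
    show "\<phi> u = 0" if "take n u \<notin> nbr n w" using \<phi>(1) u that by (simp add: A_def)
    show "\<phi> u = 1" if "take n u = w"
    proof -
      have "\<forall>U\<subseteq>T (n + m). conn (adj (n + m)) U \<longrightarrow> u \<in> U \<longrightarrow> U \<inter> A \<noteq> {} \<longrightarrow> t \<le> sum r U"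
      proof (intro allI impI)
        fix U assume U: "U \<subseteq> T (n + m)" "conn (adj (n + m)) U" "u \<in> U" "U \<inter> A \<noteq> {}"
        then obtain x where "x \<in> U" "take n x \<notin> nbr n w" by (auto simp: A_def)
        then show "t \<le> sum r U" using assms(4) U that by blast
      qed
      moreover have "u \<in> T (n + m) - A" using u that nbr_self[OF assms(1)] by (simp add: A_def)
      ultimately show ?thesis using \<phi>(3) by blast
    qed
  qed
  moreover have "energy (n + m) \<phi> \<le> 2 powr p * deg * (\<Sum>u\<in>T (n + m). r u powr p) / t powr p"
  proof -
    have "energy (n + m) \<phi> \<le> 2 powr p * deg * (\<Sum>u\<in>T (n + m). (r u / t) powr p)"
      by (rule energy_le) (use \<phi>(2) assms(2,3) in \<open>auto simp: adj_def\<close>)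
    also have "(\<Sum>u\<in>T (n + m). (r u / t) powr p) = (\<Sum>u\<in>T (n + m). r u powr p) / t powr p"
      using assms(2,3) by (simp add: powr_divide sum_divide_distrib)
    finally show ?thesis by simp
  qed
  ultimately show ?thesis by blast
qed

lemma weight_admissible_local:
  assumes "w \<in> T n" "0 < t" "\<And>u. u \<in> T (n + m) \<Longrightarrow> 0 \<le> r u"
    and "\<And>U x y. U \<subseteq> {u \<in> T (n + m). take n u \<in> nbr2 n w} \<Longrightarrow> conn (adj (n + m)) U \<Longrightarrow>
      x \<in> U \<Longrightarrow> take n x \<notin> nbr n w \<Longrightarrow> y \<in> U \<Longrightarrow> take n y = w \<Longrightarrow> t \<le> sum r U"
  shows "\<exists>\<phi>. admissible n m w \<phi> \<and> energy (n + m) \<phi> \<le>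
    2 powr p * deg * (\<Sum>u\<in>{u\<in>T (n + m). take n u \<in> nbr2 n w}. r u powr p) / t powr p"
proof -
  define r' where "r' u = (if take n u \<in> nbr2 n w then r u else 0)" for u
  have "\<exists>\<phi>. admissible n m w \<phi> \<and>
    energy (n + m) \<phi> \<le> 2 powr p * deg * (\<Sum>u\<in>T (n + m). r' u powr p) / t powr p"
  proof (rule weight_admissible[OF assms(1,2)])
    show "0 \<le> r' u" if "u \<in> T (n + m)" for u using assms(3) that by (simp add: r'_def)
    fix U x y assume U: "U \<subseteq> T (n + m)" "conn (adj (n + m)) U"
      and x: "x \<in> U" "take n x \<notin> nbr n w" and y: "y \<in> U" "take n y = w"
    let ?A = "{u. take n u \<notin> nbr n w}"
    obtain a b W where W: "W \<subseteq> U - ?A" "conn (adj (n + m)) (insert a W)" "a \<in> U" "a \<in> ?A"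
        "b \<in> W" "y \<in> W" "(a, b) \<in> adj (n + m)"
      by (rule conn_last_exit[OF sym_adj U(2) x(1), of ?A y]) (use x y nbr_self[OF assms(1)] in auto)
    have "take n a \<in> nbr n (take n b)" using adj_take[OF W(7)] nbr_sym by (simp add: nbr_def)
    then have W2: "take n u \<in> nbr2 n w" if "u \<in> insert a W" for u
      using that W(1,5) nbr_nbr2 by (auto simp: nbr2_def)
    have "t \<le> sum r (insert a W)"
      by (rule assms(4)[OF _ W(2), of a y]) (use W W2 U(1) y in auto)
    also have "\<dots> = sum r' (insert a W)" using W2 by (intro sum.cong) (auto simp: r'_def)
    also have "\<dots> \<le> sum r' U"
      by (rule sum_mono2) (use W U finite_subset[OF U(1)] assms(3) in \<open>auto simp: r'_def\<close>)
    finally show "t \<le> sum r' U" .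
  qed
  moreover have "(\<Sum>u\<in>T (n + m). r' u powr p) = (\<Sum>u\<in>{u\<in>T (n + m). take n u \<in> nbr2 n w}. r u powr p)"
    by (rule sum.mono_neutral_cong_right) (auto simp: r'_def)
  ultimately show ?thesis by simp
qed

section \<open>Crossing sets\<close>

definition crossing :: "nat \<Rightarrow> 'n \<Rightarrow> (nat ^ 'n) list set \<Rightarrow> bool" where
  "crossing m j U \<longleftrightarrow> U \<subseteq> T m \<and> conn (adj m) U \<and> (\<forall>e\<in>{1, -1}. \<exists>z\<in>U. touches z j e)"

lemma connected_conn:
  assumes "U \<subseteq> T n" "conn (adj n) U"
  shows "connected (\<Union>u\<in>U. X u)"
proof (cases "U = {}")
  case False
  then obtain r where r: "r \<in> U" by blast
  have ex: "\<exists>C. connected C \<and> X r \<subseteq> C \<and> X x \<subseteq> C \<and> C \<subseteq> (\<Union>u\<in>U. X u)" if "x \<in> U" for x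
  proof -
    have "(r, x) \<in> (adj n \<inter> U \<times> U)\<^sup>*" using assms(2) r that by (simp add: conn_def)
    then show ?thesis
    proof induction
      case base
      have "connected (X r)" using connected_cell assms(1) r by blast
      then show ?case using r by (intro exI[of _ "X r"]) auto
    next
      case (step y z)
      then obtain C where C: "connected C" "X r \<subseteq> C" "X y \<subseteq> C" "C \<subseteq> (\<Union>u\<in>U. X u)" by blast
      have z: "connected (X z)" "C \<inter> X z \<noteq> {}" "z \<in> U"
        using step(2) connected_cell assms(1) C(3) unfolding adj_def by blast+
      show ?case using connected_Un[OF C(1) z(1,2)] C z(3)
        by (intro exI[of _ "C \<union> X z"]) auto
    qed
  qed
  define F where "F = {C. connected C \<and> X r \<subseteq> C \<and> C \<subseteq> (\<Union>u\<in>U. X u)}"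
  have "connected (\<Union>F)"
    by (rule connected_Union) (use cell_ne[of r] in \<open>auto simp: F_def\<close>)
  moreover have "\<Union>F = (\<Union>u\<in>U. X u)"
  proof (intro equalityI subsetI)
    fix x assume "x \<in> (\<Union>u\<in>U. X u)"
    then obtain u where u: "u \<in> U" "x \<in> X u" by blast
    obtain C where "C \<in> F" "X u \<subseteq> C" using ex[OF u(1)] unfolding F_def by auto
    then show "x \<in> \<Union>F" using u(2) by blast
  qed (auto simp: F_def)
  ultimately show ?thesis by simp
qed simp

lemma strip_crossing:
  assumes "1 \<le> n" "U \<subseteq> T (n + m)" "conn (adj (n + m)) U"
    "x \<in> U" "P \<in> X x" "y \<in> U" "Q \<in> X y" "P $ i + 4 / scl n \<le> Q $ i"
  shows "\<exists>j. crossing m j (fold_word n ` U)"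
proof -
  obtain j where j: "\<And>b. \<exists>e. (e = 1 \<or> e = -1) \<and> (\<forall>m. \<forall>u\<in>T (n + m). \<forall>x\<in>X u.
     (scl n * (x $ i + 1) - 1 = 2 * of_int b - 1 \<longrightarrow> touches (fold_word n u) j e) \<and>
     (scl n * (x $ i + 1) - 1 = 2 * of_int b + 1 \<longrightarrow> touches (fold_word n u) j (-e)))"
    using fold_strip[OF assms(1), of i] by blast
  define s where "s x = scl n * (x $ i + 1) - 1" for x :: "real ^ 'n"
  define b where "b = \<lceil>(s P + 1) / 2\<rceil>"
  have PQ: "s P + 4 \<le> s Q"
  proof -
    have "scl n * (P $ i + 4 / scl n) \<le> scl n * Q $ i" using assms(8) by (rule mult_left_mono) simp
    then show ?thesis by (simp add: s_def distrib_left)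
  qed
  have "(s P + 1) / 2 \<le> of_int b" "of_int b < (s P + 1) / 2 + 1" unfolding b_def by linarith+
  then have "s P + 1 \<le> 2 * of_int b" "2 * of_int b < s P + 3" by (simp_all add: field_simps)
  then have b: "s P \<le> 2 * of_int b - 1" "2 * of_int b + 1 \<le> s Q" using PQ by simp_all
  have ivt: "\<exists>u\<in>U. \<exists>x\<in>X u. s x = c" if c: "s P \<le> c" "c \<le> s Q" for c
  proof -
    have "\<exists>z\<in>(\<Union>u\<in>U. X u). z $ i = (c + 1) / scl n - 1"
    proof (rule connected_ivt_component_cart[OF connected_conn[OF assms(2,3)]])
      show "P \<in> (\<Union>u\<in>U. X u)" "Q \<in> (\<Union>u\<in>U. X u)" using assms by blast+
      show "P $ i \<le> (c + 1) / scl n - 1" "(c + 1) / scl n - 1 \<le> Q $ i"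
        using c by (auto simp: s_def field_simps)
    qed
    then obtain u z where z: "u \<in> U" "z \<in> X u" "z $ i = (c + 1) / scl n - 1" by blast
    have "s z = c" unfolding s_def z(3) by simp
    then show ?thesis using z by blast
  qed
  obtain u1 x1 where 1: "u1 \<in> U" "x1 \<in> X u1" "s x1 = 2 * of_int b - 1"
    using ivt[of "2 * of_int b - 1"] b by auto
  obtain u2 x2 where 2: "u2 \<in> U" "x2 \<in> X u2" "s x2 = 2 * of_int b + 1"
    using ivt[of "2 * of_int b + 1"] b by auto
  have uT: "u1 \<in> T (n + m)" "u2 \<in> T (n + m)" using 1 2 assms(2) by blast+
  obtain e :: real where e: "e = 1 \<or> e = -1" and
    e': "\<forall>m. \<forall>u\<in>T (n + m). \<forall>x\<in>X u.
     (scl n * (x $ i + 1) - 1 = 2 * of_int b - 1 \<longrightarrow> touches (fold_word n u) j e) \<and>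
     (scl n * (x $ i + 1) - 1 = 2 * of_int b + 1 \<longrightarrow> touches (fold_word n u) j (-e))"
    using j[of b] by blast
  have t1: "touches (fold_word n u1) j e"
    using bspec[OF bspec[OF spec[OF e', of m] uT(1)] 1(2)] 1(3) unfolding s_def by blast
  have t2: "touches (fold_word n u2) j (-e)"
    using bspec[OF bspec[OF spec[OF e', of m] uT(2)] 2(2)] 2(3) unfolding s_def by blast
  have "conn (adj m) (fold_word n ` U)"
    by (rule conn_image[OF assms(3)]) (rule fold_adj[OF assms(1)])
  moreover have "fold_word n ` U \<subseteq> T m" using fold_word(1)[OF assms(1)] assms(2) by blast
  moreover have "\<forall>e'\<in>{1, -1}. \<exists>z\<in>fold_word n ` U. touches z j e'"
    using e t1 t2 1(1) 2(1) by auto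
  ultimately show ?thesis unfolding crossing_def by blast
qed

lemma separation_scale:
  assumes "0 < b"
  obtains k0 where "\<And>k n w v x y. k0 \<le> k \<Longrightarrow> w \<in> T n \<Longrightarrow> v \<in> T n \<Longrightarrow> X w \<inter> X v = {} \<Longrightarrow>
     x \<in> X w \<Longrightarrow> y \<in> X v \<Longrightarrow> \<exists>i. b / scl (n + k) < \<bar>x $ i - y $ i\<bar>"
proof -
  obtain c where c: "c > 0" "\<forall>n. \<forall>w\<in>T n. \<forall>v\<in>T n. X w \<inter> X v = {} \<longrightarrow>
     (\<forall>x\<in>X w. \<forall>y\<in>X v. \<exists>i. c / scl n \<le> \<bar>x $ i - y $ i\<bar>)" using separation by blast
  obtain k0 where k0: "b / scl k0 < c" using scl_tendsto[OF c(1)] by blast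
  have "b / scl (n + k) < c / scl n" if "k0 \<le> k" for n k
  proof -
    have "b / scl k \<le> b / scl k0" using that assms N2 by (intro divide_left_mono power_increasing) auto
    then have "b / scl k < c" using k0 by linarith
    then have "b / scl k / scl n < c / scl n" by (intro divide_strict_right_mono) auto
    then show ?thesis by (simp add: power_add mult.commute)
  qed
  then show ?thesis using that[of k0] c(2) by (meson less_le_trans)
qed

lemma crossing_conductance:
  obtains k0 where "\<And>k. k0 \<le> k \<Longrightarrow> \<exists>C\<ge>0. \<forall>m \<rho> t. (\<forall>z. 0 \<le> \<rho> z) \<longrightarrow> 0 < t \<longrightarrow>
     (\<forall>j U. crossing m j U \<longrightarrow> t \<le> sum \<rho> U) \<longrightarrow>
     conductance (k + m) \<le> ennreal (C * (\<Sum>z\<in>T m. \<rho> z powr p) / t powr p)"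
proof -
  obtain k0 where k0: "\<And>k n w v x y. k0 \<le> k \<Longrightarrow> w \<in> T n \<Longrightarrow> v \<in> T n \<Longrightarrow> X w \<inter> X v = {} \<Longrightarrow>
     x \<in> X w \<Longrightarrow> y \<in> X v \<Longrightarrow> \<exists>i. 4 / scl (n + k) < \<bar>x $ i - y $ i\<bar>"
    using separation_scale[of 4] by auto
  show ?thesis
  proof (rule that[of k0], intro exI conjI allI impI)
    fix k assume k: "k0 \<le> k"
    show "0 \<le> 2 powr p * deg * (deg * deg * real (card (T k)))" using deg_nonneg by simp
    fix m t and \<rho> :: "(nat ^ 'n) list \<Rightarrow> real"
    assume \<rho>: "\<forall>z. 0 \<le> \<rho> z" and t: "0 < t" and cr: "\<forall>j U. crossing m j U \<longrightarrow> t \<le> sum \<rho> U"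
    show "conductance (k + m) \<le>
      ennreal (2 powr p * deg * (deg * deg * real (card (T k))) * (\<Sum>z\<in>T m. \<rho> z powr p) / t powr p)"
    proof (rule conductance_le)
      fix n w assume n: "1 \<le> n" and w: "w \<in> T n"
      have nk: "1 \<le> n + k" using n by simp
      have assoc: "n + k + m = n + (k + m)" by simp
      define V where "V = {v \<in> T (n + k). take n v \<in> nbr2 n w}"
      have VT: "V \<subseteq> T (n + k)" by (auto simp: V_def)
      have cV: "real (card V) \<le> deg * deg * real (card (T k))"
      proof -
        have "real (card V) = (\<Sum>v\<in>V. 1)" by simp
        also have "\<dots> = (\<Sum>w\<in>nbr2 n w. \<Sum>u\<in>descendants S k w. 1)"
          unfolding V_def by (rule sum_descendants[OF nbr2_T])
        also have "\<dots> = (\<Sum>w\<in>nbr2 n w. real (card (T k)))"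
        proof (rule sum.cong[OF refl])
          fix v assume "v \<in> nbr2 n w"
          then have "v \<in> T n" using nbr2_T by blast
          from bij_betw_same_card[OF fold_descendants(1)[OF n this]]
          show "(\<Sum>u\<in>descendants S k v. 1) = real (card (T k))" by simp
        qed
        also have "\<dots> \<le> deg * deg * real (card (T k))"
          using card_nbr2[of n w] by (simp add: mult_right_mono)
        finally show ?thesis .
      qed
      have sum_r: "(\<Sum>u\<in>{u\<in>T (n + (k + m)). take n u \<in> nbr2 n w}. \<rho> (fold_word (n + k) u) powr p) \<le>
        deg * deg * real (card (T k)) * (\<Sum>z\<in>T m. \<rho> z powr p)"
      proof -
        have "{u\<in>T (n + (k + m)). take n u \<in> nbr2 n w} = {u\<in>T (n + k + m). take (n + k) u \<in> V}"
          using take_words[of _ S "n + k" m] by (auto simp: V_def assoc[symmetric] min_def)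
        then have "(\<Sum>u\<in>{u\<in>T (n + (k + m)). take n u \<in> nbr2 n w}. \<rho> (fold_word (n + k) u) powr p) =
            real (card V) * (\<Sum>z\<in>T m. \<rho> z powr p)"
          using sum_fold_word[OF nk VT, where h = "\<lambda>z. \<rho> z powr p"] by simp
        also have "\<dots> \<le> deg * deg * real (card (T k)) * (\<Sum>z\<in>T m. \<rho> z powr p)"
          by (intro mult_right_mono cV sum_nonneg) auto
        finally show ?thesis .
      qed
      have "\<exists>\<phi>. admissible n (k + m) w \<phi> \<and> energy (n + (k + m)) \<phi> \<le> 2 powr p * deg *
          (\<Sum>u\<in>{u\<in>T (n + (k + m)). take n u \<in> nbr2 n w}. \<rho> (fold_word (n + k) u) powr p) / t powr p"
      proof (rule weight_admissible_local[OF w t])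
        show "0 \<le> \<rho> (fold_word (n + k) u)" for u using \<rho> by simp
        fix U x y assume U: "U \<subseteq> {u \<in> T (n + (k + m)). take n u \<in> nbr2 n w}" "conn (adj (n + (k + m))) U"
          and x: "x \<in> U" "take n x \<notin> nbr n w" and y: "y \<in> U" "take n y = w"
        have UT: "U \<subseteq> T (n + k + m)" "conn (adj (n + k + m)) U" using U by (auto simp: assoc)
        have xT: "x \<in> T (n + (k + m))" "y \<in> T (n + (k + m))" using U(1) x y by auto
        obtain P where P: "P \<in> X x" using cell_ne by blast
        obtain Q where Q: "Q \<in> X y" using cell_ne by blast
        have "take n x \<in> T n" using take_words xT(1) by blast
        moreover have "X (take n x) \<inter> X w = {}" using x(2) w calculation by (auto simp: nbr_def adj_def)
        moreover have "P \<in> X (take n x)" using P cell_take[OF xT(1)] by blast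
        moreover have "Q \<in> X w" using Q y(2) cell_take[OF xT(2)] by blast
        ultimately obtain i where i: "4 / scl (n + k) < \<bar>P $ i - Q $ i\<bar>"
          using k0[OF k _ w] by blast
        have "\<exists>j. crossing m j (fold_word (n + k) ` U)"
        proof (cases "P $ i \<le> Q $ i")
          case True
          then have "P $ i + 4 / scl (n + k) \<le> Q $ i" using i by linarith
          then show ?thesis by (rule strip_crossing[OF nk UT x(1) P y(1) Q])
        next
          case False
          then have "Q $ i + 4 / scl (n + k) \<le> P $ i" using i by linarith
          then show ?thesis by (rule strip_crossing[OF nk UT y(1) Q x(1) P])
        qed
        then have "t \<le> sum \<rho> (fold_word (n + k) ` U)" using cr by blast
        also have "\<dots> \<le> (\<Sum>u\<in>U. \<rho> (fold_word (n + k) u))"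
          by (rule sum_image_le[unfolded comp_def]) (use \<rho> finite_subset[OF UT(1)] in auto)
        finally show "t \<le> (\<Sum>u\<in>U. \<rho> (fold_word (n + k) u))" .
      qed
      then obtain \<phi> where \<phi>: "admissible n (k + m) w \<phi>" "energy (n + (k + m)) \<phi> \<le> 2 powr p * deg *
          (\<Sum>u\<in>{u\<in>T (n + (k + m)). take n u \<in> nbr2 n w}. \<rho> (fold_word (n + k) u) powr p) / t powr p" by blast
      note \<phi>(2)
      also have "2 powr p * deg * (\<Sum>u\<in>{u\<in>T (n + (k + m)). take n u \<in> nbr2 n w}.
          \<rho> (fold_word (n + k) u) powr p) / t powr p \<le>
        2 powr p * deg * (deg * deg * real (card (T k)) * (\<Sum>z\<in>T m. \<rho> z powr p)) / t powr p"
        using deg_nonneg t by (intro divide_right_mono mult_left_mono sum_r) auto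
      finally show "\<exists>\<phi>. admissible n (k + m) w \<phi> \<and> energy (n + (k + m)) \<phi> \<le>
        2 powr p * deg * (deg * deg * real (card (T k))) * (\<Sum>z\<in>T m. \<rho> z powr p) / t powr p"
        using \<phi>(1) by (intro exI[of _ \<phi>]) (simp add: mult.assoc)
    qed
  qed
qed

section \<open>Submultiplicativity of the conductance constants\<close>

lemma conductance_submult:
  "\<exists>k0 C. 0 \<le> C \<and> (\<forall>k m a b. k0 \<le> k \<longrightarrow> conductance k < ennreal a \<longrightarrow>
    conductance m < ennreal b \<longrightarrow> conductance (k + m) \<le> ennreal (C * a * b))"
proof -
  obtain k0 where k0: "\<And>k n w v x y. k0 \<le> k \<Longrightarrow> w \<in> T n \<Longrightarrow> v \<in> T n \<Longrightarrow> X w \<inter> X v = {} \<Longrightarrow>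
     x \<in> X w \<Longrightarrow> y \<in> X v \<Longrightarrow> \<exists>i. 2 / scl (n + k) < \<bar>x $ i - y $ i\<bar>"
    using separation_scale[of 2] by auto
  define C where "C = 2 powr p * deg * ((deg * deg) powr p * (2 * deg powr p) * (2 * deg powr p))"
  show ?thesis
  proof (intro exI[of _ k0] exI[of _ C] conjI allI impI)
    show "0 \<le> C" using deg_nonneg by (simp add: C_def)
    fix k m and a b :: real
    assume k: "k0 \<le> k" and a: "conductance k < ennreal a" and b: "conductance m < ennreal b"
    show "conductance (k + m) \<le> ennreal (C * a * b)"
    proof (rule conductance_le)
      fix n w assume n: "1 \<le> n" and w: "w \<in> T n"
      have nk: "1 \<le> n + k" using n by simp
      have assoc: "n + (k + m) = n + k + m" by simp
      obtain \<phi> where \<phi>: "admissible n k w \<phi>" "energy (n + k) \<phi> \<le> a"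
        using conductance_less[OF a n w] .
      have "\<forall>u\<in>T (n + k). \<exists>\<psi>. admissible (n + k) m u \<psi> \<and> energy (n + k + m) \<psi> \<le> b"
        using conductance_less[OF b nk] by metis
      then obtain \<psi> where \<psi>: "\<And>u. u \<in> T (n + k) \<Longrightarrow> admissible (n + k) m u (\<psi> u)"
        "\<And>u. u \<in> T (n + k) \<Longrightarrow> energy (n + k + m) (\<psi> u) \<le> b" by metis
      define \<alpha> where "\<alpha> = grad (n + k) \<phi>"
      define \<beta> where "\<beta> u = grad (n + k + m) (\<psi> u)" for u
      have nn: "0 \<le> \<alpha> u" "0 \<le> \<beta> u z" for u z by (auto simp: \<alpha>_def \<beta>_def grad_nonneg)
      define r where "r z = (\<Sum>u\<in>T (n + k). \<alpha> u * \<beta> u z)" for z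
      have r0: "0 \<le> r z" for z unfolding r_def by (intro sum_nonneg mult_nonneg_nonneg nn)
      have sum_r: "(\<Sum>z\<in>T (n + k + m). r z powr p) \<le>
          (deg * deg) powr p * (2 * deg powr p) * (2 * deg powr p) * a * b"
      proof -
        have rz: "r z powr p \<le> (deg * deg) powr p * (\<Sum>u\<in>T (n + k). (\<alpha> u * \<beta> u z) powr p)"
          if z: "z \<in> T (n + k + m)" for z
        proof -
          let ?I = "nbr2 (n + k) (take (n + k) z)"
          have zero: "\<beta> u z = 0" if u: "u \<in> T (n + k)" "u \<notin> ?I" for u
          proof -
            have "\<psi> u z' = 0" if "z' \<in> nbr (n + k + m) z" for z'
            proof -
              have z': "z' \<in> T (n + k + m)" using that nbr_T by blast
              have "take (n + k) z' \<in> nbr (n + k) (take (n + k) z)"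
                using that adj_take by (simp add: nbr_def)
              then have "take (n + k) z' \<notin> nbr (n + k) u" using u(2) nbr_sym by (auto simp: nbr2_def)
              then show ?thesis using \<psi>(1)[OF u(1)] z' by (simp add: admissible_def)
            qed
            then show ?thesis using nbr_self[OF z] by (simp add: \<beta>_def grad_def)
          qed
          have "r z = (\<Sum>u\<in>?I. \<alpha> u * \<beta> u z)"
            unfolding r_def by (rule sum.mono_neutral_right) (use zero nbr2_T in auto)
          then have "r z powr p \<le> (deg * deg) powr p * (\<Sum>u\<in>?I. (\<alpha> u * \<beta> u z) powr p)"
            using sum_powr_le_bound[of ?I "\<lambda>u. \<alpha> u * \<beta> u z" p "deg * deg"] nn p_pos card_nbr2 by simp
          also have "\<dots> \<le> (deg * deg) powr p * (\<Sum>u\<in>T (n + k). (\<alpha> u * \<beta> u z) powr p)"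
            by (intro mult_left_mono sum_mono2 nbr2_T) auto
          finally show ?thesis .
        qed
        have b0: "0 \<le> b" using \<psi>(2) energy_nonneg T_ne by (meson order_trans)
        have bz: "(\<Sum>z\<in>T (n + k + m). \<beta> u z powr p) \<le> 2 * deg powr p * b" if "u \<in> T (n + k)" for u
          unfolding \<beta>_def using grad_energy[of "n + k + m" "\<psi> u"]
            mult_left_mono[OF \<psi>(2)[OF that], of "2 * deg powr p"] by simp
        have "(\<Sum>z\<in>T (n + k + m). r z powr p) \<le>
            (\<Sum>z\<in>T (n + k + m). (deg * deg) powr p * (\<Sum>u\<in>T (n + k). (\<alpha> u * \<beta> u z) powr p))"
          by (intro sum_mono rz)
        also have "\<dots> = (deg * deg) powr p * (\<Sum>z\<in>T (n + k + m). \<Sum>u\<in>T (n + k). \<alpha> u powr p * \<beta> u z powr p)"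
          unfolding sum_distrib_left[symmetric] by (simp add: powr_mult nn)
        also have "\<dots> = (deg * deg) powr p * (\<Sum>u\<in>T (n + k). \<alpha> u powr p * (\<Sum>z\<in>T (n + k + m). \<beta> u z powr p))"
          by (subst sum.swap) (simp add: sum_distrib_left)
        also have "\<dots> \<le> (deg * deg) powr p * (\<Sum>u\<in>T (n + k). \<alpha> u powr p * (2 * deg powr p * b))"
          by (intro mult_left_mono sum_mono bz) auto
        also have "\<dots> = (deg * deg) powr p * ((\<Sum>u\<in>T (n + k). \<alpha> u powr p) * (2 * deg powr p * b))"
          by (simp add: sum_distrib_right)
        also have "\<dots> \<le> (deg * deg) powr p * ((2 * deg powr p * a) * (2 * deg powr p * b))"
        proof (intro mult_left_mono mult_right_mono)
          show "(\<Sum>u\<in>T (n + k). \<alpha> u powr p) \<le> 2 * deg powr p * a"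
            unfolding \<alpha>_def using grad_energy[of "n + k" \<phi>]
              mult_left_mono[OF \<phi>(2), of "2 * deg powr p"] by simp
        qed (use b0 in auto)
        finally show ?thesis by (simp add: ac_simps)
      qed
      have "\<exists>\<xi>. admissible n (k + m) w \<xi> \<and> energy (n + (k + m)) \<xi> \<le>
          2 powr p * deg * (\<Sum>u\<in>T (n + (k + m)). r u powr p) / 1 powr p"
      proof (rule weight_admissible[OF w])
        show "0 \<le> r u" for u by (rule r0)
        fix U x y assume U: "U \<subseteq> T (n + (k + m))" "conn (adj (n + (k + m))) U"
          and x: "x \<in> U" "take n x \<notin> nbr n w" and y: "y \<in> U" "take n y = w"
        have U': "U \<subseteq> T (n + k + m)" "conn (adj (n + k + m)) U" using U by (simp_all add: assoc)
        let ?P = "take (n + k) ` U"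
        have PT: "?P \<subseteq> T (n + k)" using U' take_words by blast
        have finU: "finite U" using finite_subset[OF U(1)] by simp
        have connP: "conn (adj (n + k)) ?P" by (rule conn_image[OF U'(2) adj_take])
        have "\<phi> (take (n + k) x) = 0" "\<phi> (take (n + k) y) = 1"
          using \<phi>(1) PT x y by (auto simp: admissible_def min_def)
        moreover have "\<bar>\<phi> (take (n + k) x) - \<phi> (take (n + k) y)\<bar> \<le> sum \<alpha> ?P"
          unfolding \<alpha>_def by (rule grad_variation[OF PT connP]) (use x y in auto)
        ultimately have 1: "1 \<le> sum \<alpha> ?P" by simp
        have 2: "1 \<le> sum (\<beta> u) U" if u: "u \<in> ?P" for u
        proof -
          have uT: "u \<in> T (n + k)" using u PT by blast
          obtain z0 where z0: "z0 \<in> U" "take (n + k) z0 = u" using u by blast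
          have p0: "\<psi> u z0 = 1" using \<psi>(1)[OF uT] z0 U' by (auto simp: admissible_def)
          have "\<exists>z1\<in>U. take (n + k) z1 \<notin> nbr (n + k) u"
          proof (rule ccontr)
            assume "\<not> ?thesis"
            then have "take (n + k) x \<in> nbr (n + k) u" "take (n + k) y \<in> nbr (n + k) u" using x y by auto
            then obtain P Q where PQ: "P \<in> X u" "P \<in> X (take (n + k) x)" "Q \<in> X u" "Q \<in> X (take (n + k) y)"
              by (auto simp: nbr_def adj_def)
            have xT: "take (n + k) x \<in> T (n + k)" "take (n + k) y \<in> T (n + k)" using x y PT by auto
            have "P \<in> X (take n x)" using cell_take[OF xT(1)] PQ by (auto simp: min_def)
            moreover have "Q \<in> X w" using cell_take[OF xT(2)] PQ y(2) by (auto simp: min_def)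
            moreover have xn: "take n x \<in> T n" using take_words[OF xT(1)] by (simp add: min_def)
            moreover have "X (take n x) \<inter> X w = {}" using x(2) w xn by (auto simp: nbr_def adj_def)
            ultimately obtain i where "2 / scl (n + k) < \<bar>P $ i - Q $ i\<bar>" using k0[OF k _ w] by blast
            then show False using cell_coord_diff[OF uT PQ(1,3), of i] by linarith
          qed
          then obtain z1 where z1: "z1 \<in> U" "take (n + k) z1 \<notin> nbr (n + k) u" by blast
          have p1: "\<psi> u z1 = 0" using \<psi>(1)[OF uT] z1 U' by (auto simp: admissible_def)
          have "\<bar>\<psi> u z0 - \<psi> u z1\<bar> \<le> sum (\<beta> u) U"
            unfolding \<beta>_def by (rule grad_variation[OF U']) (use z0 z1 in auto)
          then show ?thesis by (simp add: p0 p1)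
        qed
        have "1 \<le> sum \<alpha> ?P" by (rule 1)
        also have "\<dots> \<le> (\<Sum>u\<in>?P. \<alpha> u * sum (\<beta> u) U)"
          by (intro sum_mono) (use 2 mult_left_mono[OF 2 nn(1)] in force)
        also have "\<dots> \<le> (\<Sum>u\<in>T (n + k). \<alpha> u * sum (\<beta> u) U)"
          by (rule sum_mono2[OF finite_T PT]) (intro mult_nonneg_nonneg sum_nonneg nn)
        also have "\<dots> = sum r U"
          unfolding r_def sum_distrib_left by (rule sum.swap)
        finally show "1 \<le> sum r U" .
      qed simp
      then obtain \<xi> where \<xi>: "admissible n (k + m) w \<xi>"
        "energy (n + (k + m)) \<xi> \<le> 2 powr p * deg * (\<Sum>u\<in>T (n + k + m). r u powr p)"
        by (auto simp: assoc)
      have "2 powr p * deg * (\<Sum>u\<in>T (n + k + m). r u powr p) \<le>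
          2 powr p * deg * ((deg * deg) powr p * (2 * deg powr p) * (2 * deg powr p) * a * b)"
        using deg_nonneg by (intro mult_left_mono sum_r) auto
      also have "\<dots> = C * a * b" unfolding C_def by (simp only: mult.assoc)
      finally show "\<exists>\<xi>. admissible n (k + m) w \<xi> \<and> energy (n + (k + m)) \<xi> \<le> C * a * b"
        using \<xi> by (intro exI[of _ \<xi>]) simp
    qed
  qed
qed

section \<open>Oscillation bounds\<close>

definition osc_bound :: "nat \<Rightarrow> real \<Rightarrow> bool" where
  "osc_bound m B \<longleftrightarrow> (\<forall>\<phi>. \<forall>u\<in>T m. \<forall>v\<in>T m. \<bar>\<phi> u - \<phi> v\<bar> powr p \<le> B * energy m \<phi>)"

lemma osc_bound_ex: "\<exists>B\<ge>0. osc_bound m B"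
proof (intro exI conjI)
  show "0 \<le> real (card (T m)) powr p * (2 * deg powr p)" by simp
  show "osc_bound m (real (card (T m)) powr p * (2 * deg powr p))"
    unfolding osc_bound_def
  proof (intro allI ballI)
    fix \<phi> u v assume uv: "u \<in> T m" "v \<in> T m"
    have "\<bar>\<phi> u - \<phi> v\<bar> powr p \<le> (sum (grad m \<phi>) (T m)) powr p"
      using grad_variation[OF order_refl conn_T uv] p_pos by (intro powr_mono2) auto
    also have "\<dots> \<le> real (card (T m)) powr p * (\<Sum>u\<in>T m. grad m \<phi> u powr p)"
      by (rule sum_powr_le) (auto simp: grad_nonneg p_pos)
    also have "\<dots> \<le> real (card (T m)) powr p * (2 * deg powr p * energy m \<phi>)"
      by (intro mult_left_mono grad_energy) auto
    finally show "\<bar>\<phi> u - \<phi> v\<bar> powr p \<le> real (card (T m)) powr p * (2 * deg powr p) * energy m \<phi>"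
      by (simp add: mult.assoc)
  qed
qed

lemma disjoint_cells: "\<exists>w\<in>T 2. \<exists>v\<in>T 2. X w \<inter> X v = {}"
proof -
  fix j :: 'n
  obtain P Q where P: "P \<in> K" "P $ j = 1" and Q: "Q \<in> K" "Q $ j = -1"
    using nondeg unfolding nondegenerate_def face_def by fastforce
  obtain w where w: "w \<in> T 2" "P \<in> X w" using cell_cover P by blast
  obtain v where v: "v \<in> T 2" "Q \<in> X v" using cell_cover Q by blast
  have "4 \<le> scl 2" using power_mono[of 2 "real N" 2] N2 by simp
  then have q: "2 / scl 2 \<le> 1 / 2" by (simp add: field_simps)
  have "x \<notin> X w \<inter> X v" for x
  proof
    assume "x \<in> X w \<inter> X v"
    then have "\<bar>P $ j - x $ j\<bar> \<le> 2 / scl 2" "\<bar>x $ j - Q $ j\<bar> \<le> 2 / scl 2"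
      using cell_coord_diff[OF w(1) w(2)] cell_coord_diff[OF v(1) _ v(2)] by blast+
    then show False using P Q q by linarith
  qed
  then show ?thesis using w v by blast
qed

lemma conductance_pos: "0 < conductance m"
proof -
  obtain w v where w: "w \<in> T 2" "v \<in> T 2" "X w \<inter> X v = {}" using disjoint_cells by blast
  obtain B where B: "0 \<le> B" "osc_bound (2 + m) B" using osc_bound_ex by blast
  obtain z where z: "z \<in> T m" using T_ne by blast
  have u: "w @ z \<in> T (2 + m)" "v @ z \<in> T (2 + m)" using append_words w z by blast+
  have t: "take 2 (w @ z) = w" "take 2 (v @ z) = v" using w by (auto simp: words_length)
  show ?thesis
  proof (rule ccontr)
    assume "\<not> ?thesis"
    then have "conductance m < ennreal (1 / (2 * (B + 1)))" using B by simp
    from conductance_less[OF this _ w(1)] obtain \<phi> where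
      \<phi>: "admissible 2 m w \<phi>" "energy (2 + m) \<phi> \<le> 1 / (2 * (B + 1))" by auto
    have "v \<notin> nbr 2 w" using w(3) by (auto simp: nbr_def adj_def)
    then have "\<phi> (w @ z) = 1" "\<phi> (v @ z) = 0" using \<phi>(1) u t by (auto simp: admissible_def)
    moreover have "\<bar>\<phi> (w @ z) - \<phi> (v @ z)\<bar> powr p \<le> B * energy (2 + m) \<phi>"
      using B(2) u by (auto simp: osc_bound_def)
    moreover have "B * energy (2 + m) \<phi> \<le> B * (1 / (2 * (B + 1)))" by (intro mult_left_mono \<phi>(2) B(1))
    moreover have "B * (1 / (2 * (B + 1))) < 1" using B(1) by (simp add: field_simps)
    ultimately show False by simp
  qed
qed

end

lemma sum_UN_le:
  fixes h :: "'b \<Rightarrow> real"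
  assumes "finite I" "\<And>i. i \<in> I \<Longrightarrow> finite (A i)" "\<And>x. 0 \<le> h x"
  shows "sum h (\<Union>i\<in>I. A i) \<le> (\<Sum>i\<in>I. sum h (A i))"
proof -
  have "(\<Union>i\<in>I. A i) = snd ` Sigma I A" by force
  then have "sum h (\<Union>i\<in>I. A i) \<le> sum (h \<circ> snd) (Sigma I A)"
    using sum_image_le[of "Sigma I A" h snd] assms by simp
  also have "\<dots> = (\<Sum>i\<in>I. sum h (A i))"
    using assms by (subst sum.Sigma) (auto simp: case_prod_unfold comp_def)
  finally show ?thesis .
qed

lemma abs_avg_diff_le:
  assumes "finite A" "finite B" "A \<noteq> {}" "B \<noteq> {}" "\<And>u v. u \<in> A \<Longrightarrow> v \<in> B \<Longrightarrow> \<bar>\<phi> u - \<phi> v\<bar> \<le> M"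
  shows "\<bar>avg \<phi> A - avg \<phi> B\<bar> \<le> M"
proof -
  have c: "0 < real (card A)" "0 < real (card B)" using assms by (auto simp: card_gt_0_iff)
  have "(\<Sum>u\<in>A. \<Sum>v\<in>B. \<phi> u - \<phi> v) = real (card B) * sum \<phi> A - real (card A) * sum \<phi> B"
    by (simp add: sum_subtractf sum_distrib_left)
  then have "avg \<phi> A - avg \<phi> B = (\<Sum>u\<in>A. \<Sum>v\<in>B. \<phi> u - \<phi> v) / (real (card A) * real (card B))"
    using c by (simp add: avg_def field_simps)
  also have "\<bar>\<dots>\<bar> \<le> (\<Sum>u\<in>A. \<Sum>v\<in>B. M) / (real (card A) * real (card B))"
  proof -
    have "\<bar>\<Sum>u\<in>A. \<Sum>v\<in>B. \<phi> u - \<phi> v\<bar> \<le> (\<Sum>u\<in>A. \<bar>\<Sum>v\<in>B. \<phi> u - \<phi> v\<bar>)" by (rule sum_abs)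
    also have "\<dots> \<le> (\<Sum>u\<in>A. \<Sum>v\<in>B. \<bar>\<phi> u - \<phi> v\<bar>)" by (intro sum_mono sum_abs)
    also have "\<dots> \<le> (\<Sum>u\<in>A. \<Sum>v\<in>B. M)" by (intro sum_mono assms(5))
    finally have "\<bar>\<Sum>u\<in>A. \<Sum>v\<in>B. \<phi> u - \<phi> v\<bar> / (real (card A) * real (card B))
        \<le> (\<Sum>u\<in>A. \<Sum>v\<in>B. M) / (real (card A) * real (card B))"
      using c by (intro divide_right_mono) auto
    then show ?thesis by (simp only: abs_divide abs_mult abs_of_nat)
  qed
  also have "\<dots> = M" using c by simp
  finally show ?thesis .
qed

section \<open>Diagonal reflections and spiders\<close>

lemma coord_reflection_nth:
  assumes "j1 \<noteq> j2" "i = 1 \<or> i = -1"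
  shows "coord_reflection j1 j2 i (x :: real ^ 'n) $ l =
    (if l = j1 then i * x $ j2 else if l = j2 then i * x $ j1 else x $ l)"
proof -
  define a :: "real ^ 'n" where "a = axis j1 1 - i *\<^sub>R axis j2 1"
  have ii: "i * i = 1" using assms by auto
  have ax: "a \<bullet> x = x $ j1 - i * x $ j2" by (simp add: a_def inner_diff_left inner_axis')
  have a: "a $ l = (if l = j1 then 1 else if l = j2 then - i else 0)" for l
    using assms by (simp add: a_def axis_def)
  have "a \<bullet> a = a $ j1 - i * a $ j2" unfolding a_def by (simp add: inner_diff_left inner_axis')
  then have aa: "a \<bullet> a = 2" using assms ii by (simp add: a)
  have "coord_reflection j1 j2 i x $ l = x $ l - (x $ j1 - i * x $ j2) * a $ l"
    unfolding coord_reflection_def hyperplane_reflection_def a_def[symmetric] by (simp add: aa ax)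
  then show ?thesis using assms ii by (auto simp: a algebra_simps)
qed

lemma signed_perm_coord_reflection:
  assumes "j1 \<noteq> j2" "i = 1 \<or> i = -1"
  shows "signed_perm (coord_reflection j1 j2 i :: real ^ 'n \<Rightarrow> real ^ 'n)"
proof (rule signed_permI)
  define \<pi> where "\<pi> l = (if l = j1 then j2 else if l = j2 then j1 else l)" for l
  have "\<pi> (\<pi> l) = l" for l by (simp add: \<pi>_def)
  then show "bij \<pi>" by (intro o_bij[of \<pi>]) auto
  show "(if l = j1 \<or> l = j2 then i else 1) = 1 \<or> (if l = j1 \<or> l = j2 then i else 1) = -1" for l
    using assms by auto
  show "coord_reflection j1 j2 i x $ l = (if l = j1 \<or> l = j2 then i else 1) * x $ \<pi> l" for x l
    by (simp add: coord_reflection_nth[OF assms] \<pi>_def)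
qed

context cubic_tiling_energy
begin

definition act :: "(real ^ 'n \<Rightarrow> real ^ 'n) \<Rightarrow> (nat ^ 'n) list \<Rightarrow> (nat ^ 'n) list" where
  "act g z = (THE z'. z' \<in> T (length z) \<and> g ` X z = X z')"

lemma act:
  assumes "symmetry g" "z \<in> T m" shows "act g z \<in> T m" "g ` X z = X (act g z)"
  using theI'[OF symmetry_cell[OF assms]] words_length[OF assms(2)] unfolding act_def by auto

lemma act_inj:
  assumes "symmetry g" shows "inj_on (act g) (T m)"
proof (rule inj_onI)
  fix y z assume yz: "y \<in> T m" "z \<in> T m" "act g y = act g z"
  have "inj g" using assms signed_perm_inj by (auto simp: symmetry_def)
  moreover have "g ` X y = g ` X z" using act(2)[OF assms] yz by metis
  ultimately show "y = z" using cell_inj yz by (simp add: inj_image_eq_iff)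
qed

lemma act_adj:
  assumes "symmetry g" "(y, z) \<in> adj m" shows "(act g y, act g z) \<in> adj m"
proof -
  have yz: "y \<in> T m" "z \<in> T m" "X y \<inter> X z \<noteq> {}" using assms by (auto simp: adj_def)
  then have "X (act g y) \<inter> X (act g z) \<noteq> {}"
    unfolding act(2)[OF assms(1) yz(1), symmetric] act(2)[OF assms(1) yz(2), symmetric] by blast
  then show ?thesis using act(1)[OF assms(1)] yz by (simp add: adj_def)
qed

lemma symmetry_id: "symmetry (\<lambda>x. x)"
  by (simp add: symmetry_def signed_perm_id)

lemma act_id: "z \<in> T m \<Longrightarrow> act (\<lambda>x. x) z = z"
  using act[OF symmetry_id] cell_inj by (metis image_ident order_refl)

definition symmetries :: "(real ^ 'n \<Rightarrow> real ^ 'n) set" where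
  "symmetries = {g. symmetry g}"

lemma finite_symmetries: "finite symmetries"
  by (rule finite_subset[OF _ finite_signed_perms]) (auto simp: symmetries_def symmetry_def)

lemma SDR_symmetry:
  assumes "SDR K S f" "j1 \<noteq> j2"
  shows "\<exists>i. (i = 1 \<or> i = -1) \<and> symmetry (coord_reflection j1 j2 i)"
proof -
  obtain i where i: "i = 1 \<or> i = -1" "coord_reflection j1 j2 i \<in> cell_homeos K S f"
    using assms unfolding SDR_def by blast
  then have "coord_reflection j1 j2 i ` K = K"
    unfolding cell_homeos_def homeomorphism_def by blast
  then show ?thesis using i signed_perm_coord_reflection[OF assms(2)] by (auto simp: symmetry_def)
qed

lemma crossing_reflect:
  assumes U: "crossing m j U" and "j \<noteq> j'" and i: "i = 1 \<or> i = -1"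
    and g: "symmetry (coord_reflection j j' i)"
  shows "conn (adj m) (U \<union> act (coord_reflection j j' i) ` U)"
    and "\<And>e. e \<in> {1, -1} \<Longrightarrow> \<exists>z\<in>act (coord_reflection j j' i) ` U. touches z j' e"
proof -
  let ?R = "coord_reflection j j' i"
  have UT: "U \<subseteq> T m" "conn (adj m) U" and ends: "\<And>e. e \<in> {1, -1} \<Longrightarrow> \<exists>z\<in>U. touches z j e"
    using U by (auto simp: crossing_def)
  obtain z1 x1 where 1: "z1 \<in> U" "x1 \<in> X z1" "x1 \<in> face j 1" using ends[of 1] by (auto simp: touches_def)
  obtain z2 x2 where 2: "z2 \<in> U" "x2 \<in> X z2" "x2 \<in> face j (-1)" using ends[of "-1"] by (auto simp: touches_def)
  let ?a = "axis j 1 - i *\<^sub>R axis j' 1 :: real ^ 'n"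
  have ax: "?a \<bullet> x = x $ j - i * x $ j'" for x by (simp add: inner_diff_left inner_axis')
  have "\<exists>x\<in>(\<Union>u\<in>U. X u). ?a \<bullet> x = 0"
  proof (rule connected_ivt_hyperplane[OF connected_conn[OF UT]])
    show "x2 \<in> (\<Union>u\<in>U. X u)" "x1 \<in> (\<Union>u\<in>U. X u)" using 1 2 by blast+
    have "-1 \<le> x1 $ j'" "x1 $ j' \<le> 1" "-1 \<le> x2 $ j'" "x2 $ j' \<le> 1"
      using 1 2 by (auto simp: face_def cube_def)
    then show "?a \<bullet> x2 \<le> 0" "0 \<le> ?a \<bullet> x1" using i 1(3) 2(3) unfolding ax by (auto simp: face_def)
  qed
  then obtain u x where u: "u \<in> U" "x \<in> X u" "?a \<bullet> x = 0" by blast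
  have "?R x = x" unfolding coord_reflection_def hyperplane_reflection_def using u(3) by simp
  then have "x \<in> X (act ?R u)" using act(2)[OF g, of u m] u UT by (metis image_eqI subsetD)
  then have "(u, act ?R u) \<in> adj m" using u UT act(1)[OF g, of u m] by (auto simp: adj_def)
  moreover have "conn (adj m) (act ?R ` U)" by (rule conn_image[OF UT(2) act_adj[OF g]])
  ultimately show "conn (adj m) (U \<union> act ?R ` U)"
    using conn_Un[OF sym_adj UT(2)] u(1) by blast
  fix e :: real assume e: "e \<in> {1, -1}"
  then have "i * e \<in> {1, -1}" using i by auto
  then obtain z x where z: "z \<in> U" "x \<in> X z" "x \<in> cube" "x $ j = i * e"
    using ends[of "i * e"] by (auto simp: touches_def face_def)
  have "?R x $ j' = e" using coord_reflection_nth[OF assms(2) i, of x j'] z(4) i assms(2) by auto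
  moreover have "?R x \<in> X (act ?R z)" using act(2)[OF g, of z m] z UT by blast
  moreover have "?R x \<in> cube" using signed_perm_cube[OF signed_perm_coord_reflection[OF assms(2) i] z(3)] .
  ultimately show "\<exists>z\<in>act ?R ` U. touches z j' e" using z(1) by (auto simp: touches_def face_def)
qed

lemma spider:
  assumes "SDR K S f" "crossing m j U"
  obtains W where "W \<subseteq> T m" "conn (adj m) W" "W \<subseteq> (\<Union>g\<in>symmetries. act g ` U)"
    "\<And>l e. e \<in> {1, -1} \<Longrightarrow> \<exists>z\<in>W. touches z l e"
proof -
  have "\<forall>j'\<in>-{j}. \<exists>i. (i = 1 \<or> i = -1) \<and> symmetry (coord_reflection j j' i)"
    using SDR_symmetry[OF assms(1), of j] by auto
  from bchoice[OF this] obtain i where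
    i: "\<forall>j'\<in>-{j}. (i j' = 1 \<or> i j' = -1) \<and> symmetry (coord_reflection j j' (i j'))" by blast
  define V where "V j' = act (coord_reflection j j' (i j')) ` U" for j'
  define W where "W = U \<union> (\<Union>j'\<in>-{j}. V j')"
  have UT: "U \<subseteq> T m" "conn (adj m) U" and ends: "\<And>e. e \<in> {1, -1} \<Longrightarrow> \<exists>z\<in>U. touches z j e"
    using assms(2) by (auto simp: crossing_def)
  obtain r where r: "r \<in> U" using ends[of 1] by blast
  have cV: "conn (adj m) (U \<union> V j')" if "j' \<in> -{j}" for j'
    unfolding V_def using crossing_reflect(1)[OF assms(2), of j' "i j'"] i that by blast
  show ?thesis
  proof (rule that)
    show "W \<subseteq> T m"
    proof -
      have "V j' \<subseteq> T m" if "j' \<in> -{j}" for j'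
        unfolding V_def using act(1)[of "coord_reflection j j' (i j')" _ m] i that UT(1) by blast
      then show ?thesis unfolding W_def using UT(1) by blast
    qed
    show "conn (adj m) W"
      unfolding W_def by (rule conn_UN[OF sym_adj r UT(2)]) (rule cV)
    have "U \<subseteq> act (\<lambda>x. x) ` U"
    proof
      fix z assume "z \<in> U"
      then show "z \<in> act (\<lambda>x. x) ` U" using act_id[of z m] UT(1) by (intro image_eqI[of _ _ z]) auto
    qed
    moreover have "(\<lambda>x. x) \<in> symmetries" by (simp add: symmetries_def symmetry_id)
    moreover have "coord_reflection j j' (i j') \<in> symmetries" if "j' \<in> -{j}" for j'
      using i that by (simp add: symmetries_def)
    ultimately show "W \<subseteq> (\<Union>g\<in>symmetries. act g ` U)"
      unfolding W_def V_def by (intro Un_least UN_least) auto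
    show "\<exists>z\<in>W. touches z l e" if "e \<in> {1, -1}" for l e
    proof (cases "l = j")
      case True then show ?thesis using ends[OF that] by (auto simp: W_def)
    next
      case False
      then have "\<exists>z\<in>V l. touches z l e"
        unfolding V_def using crossing_reflect(2)[OF assms(2), of l "i l" e] i that by blast
      then show ?thesis using False by (auto simp: W_def)
    qed
  qed
qed

lemma unfolded_spider:
  assumes "1 \<le> k" "W \<subseteq> T m" "conn (adj m) W" "\<And>l e. e \<in> {1, -1} \<Longrightarrow> \<exists>z\<in>W. touches z l e"
  defines "V \<equiv> {u \<in> T (k + m). fold_word k u \<in> W}"
  shows "conn (adj (k + m)) V" "\<And>x. x \<in> T k \<Longrightarrow> \<exists>u\<in>V. take k u = x"
proof -
  let ?E = "adj (k + m)"
  have ex: "\<exists>u\<in>V. take k u = x \<and> fold_word k u = z" if "x \<in> T k" "z \<in> W" for x z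
  proof -
    have "z \<in> fold_word k ` descendants S m x"
      using fold_descendants(1)[OF assms(1) that(1), of m] that(2) assms(2) unfolding bij_betw_def by blast
    then show ?thesis using that by (auto simp: V_def in_descendants[OF that(1)])
  qed
  fix l :: 'n
  obtain z0 where z0: "z0 \<in> W" using assms(4)[of 1 l] by blast
  show "\<exists>u\<in>V. take k u = x" if "x \<in> T k" for x using ex[OF that z0] by blast
  have piece: "conn ?E {u \<in> V. take k u = x}" if x: "x \<in> T k" for x
  proof -
    let ?D = "descendants S m x"
    have bij: "bij_betw (fold_word k) ?D (T m)" by (rule fold_descendants(1)[OF assms(1) x])
    define h where "h = the_inv_into ?D (fold_word k)"
    have h: "h z \<in> ?D" "fold_word k (h z) = z" if "z \<in> T m" for z
      using bij that bij_betwE[OF bij_betw_the_inv_into[OF bij]] f_the_inv_into_f_bij_betw[OF bij]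
      unfolding h_def by auto
    have hh: "h (fold_word k u) = u" if "u \<in> ?D" for u
      unfolding h_def by (rule the_inv_into_f_f) (use bij that in \<open>auto simp: bij_betw_def\<close>)
    have "conn ?E (h ` W)"
    proof (rule conn_image[OF assms(3)])
      fix u v assume uv: "u \<in> W" "v \<in> W" "(u, v) \<in> adj m"
      then have "u \<in> T m" "v \<in> T m" using assms(2) by auto
      then show "(h u, h v) \<in> ?E" using fold_descendants(2)[OF assms(1) x] h uv(3) by simp
    qed
    moreover have "h ` W = {u \<in> V. take k u = x}"
    proof (intro equalityI subsetI)
      fix u assume "u \<in> h ` W"
      then obtain z where z: "z \<in> W" "u = h z" by blast
      then have "u \<in> ?D" "fold_word k u = z" using h assms(2) by auto
      then show "u \<in> {u \<in> V. take k u = x}" using z by (simp add: V_def in_descendants[OF x])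
    next
      fix u assume "u \<in> {u \<in> V. take k u = x}"
      then have u: "u \<in> ?D" "fold_word k u \<in> W" by (auto simp: V_def in_descendants[OF x])
      then show "u \<in> h ` W" using hh[OF u(1)] by (metis image_eqI)
    qed
    ultimately show ?thesis by simp
  qed
  obtain x0 where x0: "x0 \<in> T k" using T_ne by blast
  obtain r where r: "r \<in> V" "take k r = x0" using ex[OF x0 z0] by blast
  have within: "(u, v) \<in> (?E \<inter> V \<times> V)\<^sup>*" if "x \<in> T k" "u \<in> V" "v \<in> V" "take k u = x" "take k v = x" for x u v
  proof -
    have "(u, v) \<in> (?E \<inter> {u \<in> V. take k u = x} \<times> {u \<in> V. take k u = x})\<^sup>*"
      using piece[OF that(1)] that unfolding conn_def by blast
    then show ?thesis by (rule conn_mono_rtrancl) auto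
  qed
  have reach: "\<forall>u\<in>V. take k u = x \<longrightarrow> (r, u) \<in> (?E \<inter> V \<times> V)\<^sup>*" if "(x0, x) \<in> (face_edges S f k)\<^sup>*" for x
    using that
  proof induction
    case base
    then show ?case using within[OF x0 r(1)] r(2) by blast
  next
    case (step y x)
    have T: "y \<in> T k" "x \<in> T k" using step(2) by (auto simp: face_edges_def)
    obtain j e where je: "e = 1 \<or> e = -1" "\<forall>m. \<forall>u\<in>descendants S m y. \<forall>u'\<in>descendants S m x.
        fold_word k u = fold_word k u' \<longrightarrow> touches (fold_word k u) j e \<longrightarrow> (u, u') \<in> adj (k + m)"
      using fold_glue[OF assms(1) step(2)] by blast
    obtain z where z: "z \<in> W" "touches z j e" using assms(4)[of e j] je(1) by blast
    obtain u where u: "u \<in> V" "take k u = y" "fold_word k u = z" using ex[OF T(1) z(1)] by blast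
    obtain u' where u': "u' \<in> V" "take k u' = x" "fold_word k u' = z" using ex[OF T(2) z(1)] by blast
    have "u \<in> descendants S m y" "u' \<in> descendants S m x"
      using u u' T by (auto simp: V_def in_descendants)
    then have "(u, u') \<in> ?E" using je(2) u(3) u'(3) z(2) by simp
    then have "(u, u') \<in> ?E \<inter> V \<times> V" using u(1) u'(1) by blast
    moreover have "(r, u) \<in> (?E \<inter> V \<times> V)\<^sup>*" using step.IH u by blast
    ultimately have ru': "(r, u') \<in> (?E \<inter> V \<times> V)\<^sup>*" by (rule_tac rtrancl_into_rtrancl)
    show ?case
    proof (intro ballI impI)
      fix v assume "v \<in> V" "take k v = x"
      then have "(u', v) \<in> (?E \<inter> V \<times> V)\<^sup>*" using within[OF T(2) u'(1)] u'(2) by blast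
      then show "(r, v) \<in> (?E \<inter> V \<times> V)\<^sup>*" using ru' by (rule_tac rtrancl_trans)
    qed
  qed
  show "conn ?E V"
  proof (rule connI_root[OF sym_adj r(1)])
    fix u assume u: "u \<in> V"
    then have "take k u \<in> T k" using take_words by (auto simp: V_def)
    then have "(x0, take k u) \<in> (face_edges S f k)\<^sup>*"
      using strong assms(1) x0 unfolding strongly_connected_def by blast
    then show "(r, u) \<in> (?E \<inter> V \<times> V)\<^sup>*" using reach u by blast
  qed
qed

section \<open>The recursion for the oscillation\<close>

lemma energy_mono:
  assumes "A \<subseteq> B" "finite B" shows "p_energy S X p n A \<phi> \<le> p_energy S X p n B \<phi>"
  unfolding p_energy_def
  by (intro mult_left_mono sum_mono2) (use assms in \<open>auto intro: finite_subset[of _ "B \<times> B"]\<close>)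

lemma energy_descendants:
  assumes "w \<in> T n"
  shows "p_energy S X p (n + m) (descendants S m w) \<phi> = energy m (\<lambda>y. \<phi> (w @ y))"
proof -
  have inj: "inj (wm w)" by (rule wm_inj[OF assms])
  have "bij_betw (\<lambda>(y, z). (w @ y, w @ z)) ((T m \<times> T m) \<inter> cell_edges S X m)
      ((descendants S m w \<times> descendants S m w) \<inter> cell_edges S X (n + m))"
    unfolding bij_betw_def
  proof
    show "inj_on (\<lambda>(y, z). (w @ y, w @ z)) ((T m \<times> T m) \<inter> cell_edges S X m)"
      by (auto simp: inj_on_def)
    have e: "(w @ y, w @ z) \<in> cell_edges S X (n + m) \<longleftrightarrow> (y, z) \<in> cell_edges S X m"
      if "y \<in> T m" "z \<in> T m" for y z
      using that append_words[OF assms] inj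
      by (auto simp: cell_edges_def cell_append dest: injD)
    show "(\<lambda>(y, z). (w @ y, w @ z)) ` ((T m \<times> T m) \<inter> cell_edges S X m) =
        (descendants S m w \<times> descendants S m w) \<inter> cell_edges S X (n + m)"
      unfolding descendants_eq[OF assms] using e by auto
  qed
  from sum.reindex_bij_betw[OF this, of "\<lambda>(u, v). \<bar>\<phi> u - \<phi> v\<bar> powr p"]
  show ?thesis unfolding p_energy_def by (simp add: case_prod_unfold)
qed

lemma osc_descendants:
  assumes "osc_bound m B" "w \<in> T n" "0 \<le> B" "u \<in> descendants S m w" "v \<in> descendants S m w"
    "descendants S m w \<subseteq> A" "finite A"
  shows "\<bar>\<phi> u - \<phi> v\<bar> powr p \<le> B * p_energy S X p (n + m) A \<phi>"
proof -
  obtain y z where yz: "y \<in> T m" "z \<in> T m" "u = w @ y" "v = w @ z"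
    using assms(4,5) unfolding descendants_eq[OF assms(2)] by blast
  have "\<bar>\<phi> u - \<phi> v\<bar> powr p \<le> B * energy m (\<lambda>y. \<phi> (w @ y))"
    unfolding yz(3,4) by (rule assms(1)[unfolded osc_bound_def, rule_format, OF yz(1,2)])
  also have "\<dots> \<le> B * p_energy S X p (n + m) A \<phi>"
    unfolding energy_descendants[OF assms(2), symmetric] using assms by (intro mult_left_mono energy_mono) auto
  finally show ?thesis .
qed

lemma fold_fiber_card:
  assumes "1 \<le> k" "z \<in> T m"
  shows "real (card {u \<in> T (k + m). fold_word k u = z}) \<le> real (card (T k))"
proof -
  have "real (card {u \<in> T (k + m). fold_word k u = z}) =
      (\<Sum>u\<in>{u\<in>T (k + m). take k u \<in> T k}. if fold_word k u = z then 1 else 0)"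
    by (subst sum.If_cases) (auto intro!: arg_cong[where f = card] take_words)
  also have "\<dots> = real (card (T k)) * (\<Sum>y\<in>T m. if y = z then 1 else 0)"
    by (rule sum_fold_word[OF assms(1) order_refl])
  also have "\<dots> = real (card (T k))" using assms(2) by simp
  finally show ?thesis by simp
qed

lemma symmetrized_weight:
  assumes "1 \<le> k" "\<And>u. 0 \<le> \<rho> u"
    and \<rho>'_def: "\<And>z. \<rho>' z = (\<Sum>g\<in>symmetries. \<Sum>u\<in>{u\<in>T (k + m). fold_word k u = act g z}. \<rho> u)"
  shows "(\<Sum>z\<in>T m. \<rho>' z powr p) \<le>
    real (card symmetries) powr p * (real (card (T k)) powr p * (real (card symmetries) * (\<Sum>u\<in>T (k + m). \<rho> u powr p)))"
proof -
  define F where "F g z = {u\<in>T (k + m). fold_word k u = act g z}" for g z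
  have finF: "finite (F g z)" for g z by (simp add: F_def)
  have *: "(\<Sum>z\<in>T m. \<Sum>u\<in>F g z. \<rho> u powr p) \<le> (\<Sum>u\<in>T (k + m). \<rho> u powr p)" if g: "g \<in> symmetries" for g
  proof -
    have sg: "symmetry g" using g by (simp add: symmetries_def)
    have "(\<Sum>z\<in>T m. \<Sum>u\<in>F g z. \<rho> u powr p) =
        (\<Sum>y\<in>act g ` T m. \<Sum>u\<in>{u\<in>T (k + m). fold_word k u = y}. \<rho> u powr p)"
      unfolding F_def by (subst sum.reindex[OF act_inj[OF sg]]) simp
    also have "\<dots> \<le> (\<Sum>y\<in>T m. \<Sum>u\<in>{u\<in>T (k + m). fold_word k u = y}. \<rho> u powr p)"
      by (rule sum_mono2) (use act(1)[OF sg] in \<open>auto intro: sum_nonneg\<close>)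
    also have "\<dots> = (\<Sum>u\<in>T (k + m). \<rho> u powr p)"
      by (rule sum.group) (use fold_word(1)[OF assms(1)] in auto)
    finally show ?thesis .
  qed
  have "\<rho>' z powr p \<le> real (card symmetries) powr p *
      (\<Sum>g\<in>symmetries. real (card (T k)) powr p * (\<Sum>u\<in>F g z. \<rho> u powr p))" if z: "z \<in> T m" for z
  proof -
    have "\<rho>' z powr p \<le> real (card symmetries) powr p * (\<Sum>g\<in>symmetries. (\<Sum>u\<in>F g z. \<rho> u) powr p)"
      unfolding \<rho>'_def F_def[symmetric]
      by (rule sum_powr_le[OF finite_symmetries]) (auto simp: p_pos intro: sum_nonneg assms(2))
    also have "\<dots> \<le> real (card symmetries) powr p *
        (\<Sum>g\<in>symmetries. real (card (T k)) powr p * (\<Sum>u\<in>F g z. \<rho> u powr p))"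
    proof (intro mult_left_mono sum_mono)
      fix g assume "g \<in> symmetries"
      then have "act g z \<in> T m" using act(1) z by (simp add: symmetries_def)
      then show "(\<Sum>u\<in>F g z. \<rho> u) powr p \<le> real (card (T k)) powr p * (\<Sum>u\<in>F g z. \<rho> u powr p)"
        by (intro sum_powr_le_bound) (use finF fold_fiber_card[OF assms(1)] in \<open>auto simp: p_pos assms(2) F_def\<close>)
    qed auto
    finally show ?thesis .
  qed
  then have "(\<Sum>z\<in>T m. \<rho>' z powr p) \<le> (\<Sum>z\<in>T m. real (card symmetries) powr p *
      (\<Sum>g\<in>symmetries. real (card (T k)) powr p * (\<Sum>u\<in>F g z. \<rho> u powr p)))"
    by (rule sum_mono)
  also have "\<dots> = real (card symmetries) powr p * (real (card (T k)) powr p *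
      (\<Sum>g\<in>symmetries. \<Sum>z\<in>T m. \<Sum>u\<in>F g z. \<rho> u powr p))"
    unfolding sum_distrib_left[symmetric] by (subst sum.swap) (rule refl)
  also have "\<dots> \<le> real (card symmetries) powr p * (real (card (T k)) powr p *
      (\<Sum>g\<in>symmetries. \<Sum>u\<in>T (k + m). \<rho> u powr p))"
    by (intro mult_left_mono sum_mono *) auto
  finally show ?thesis by simp
qed

lemma osc_step:
  assumes "SDR K S f"
  obtains k0 where "\<And>k. k0 \<le> k \<Longrightarrow> \<exists>C\<ge>0. \<forall>m B e. 0 \<le> B \<longrightarrow> osc_bound m B \<longrightarrow> 0 < e \<longrightarrow>
    conductance (k + m) = ennreal e \<longrightarrow> osc_bound (k + m) (3 powr p * (2 * B + C / e))"
proof -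
  obtain k0 where k0: "\<And>k. k0 \<le> k \<Longrightarrow> \<exists>C\<ge>0. \<forall>m \<rho> t. (\<forall>z. 0 \<le> \<rho> z) \<longrightarrow> 0 < t \<longrightarrow>
     (\<forall>j U. crossing m j U \<longrightarrow> t \<le> sum \<rho> U) \<longrightarrow>
     conductance (k + m) \<le> ennreal (C * (\<Sum>z\<in>T m. \<rho> z powr p) / t powr p)"
    by (rule crossing_conductance) blast
  show ?thesis
  proof (rule that[of "max 1 k0"])
    fix k assume "max 1 k0 \<le> k"
    then have k: "1 \<le> k" "k0 \<le> k" by auto
    obtain C1 where C1: "0 \<le> C1" "\<And>m \<rho> t. (\<forall>z. 0 \<le> \<rho> z) \<Longrightarrow> 0 < t \<Longrightarrow>
       (\<forall>j U. crossing m j U \<longrightarrow> t \<le> sum \<rho> U) \<Longrightarrow>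
       conductance (k + m) \<le> ennreal (C1 * (\<Sum>z\<in>T m. \<rho> z powr p) / t powr p)"
      using k0[OF k(2)] by blast
    define C2 where "C2 = real (card symmetries) powr p * (real (card (T k)) powr p *
      (real (card symmetries) * (2 * deg powr p)))"
    have C2: "0 \<le> C2" by (simp add: C2_def)
    define C where "C = C1 * C2 + 1"
    have C: "0 < C" "C1 * C2 < C" using C1(1) C2 by (auto simp: C_def add_nonneg_pos)
    show "\<exists>C\<ge>0. \<forall>m B e. 0 \<le> B \<longrightarrow> osc_bound m B \<longrightarrow> 0 < e \<longrightarrow>
      conductance (k + m) = ennreal e \<longrightarrow> osc_bound (k + m) (3 powr p * (2 * B + C / e))"
    proof (intro exI[of _ C] conjI allI impI)
      show "0 \<le> C" using C by simp
      fix m B e assume B: "0 \<le> B" "osc_bound m B" and e: "0 < e" "conductance (k + m) = ennreal e"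
      show "osc_bound (k + m) (3 powr p * (2 * B + C / e))"
        unfolding osc_bound_def
      proof (intro allI ballI)
        fix \<phi> u v assume uv: "u \<in> T (k + m)" "v \<in> T (k + m)"
        let ?E = "energy (k + m) \<phi>"
        show "\<bar>\<phi> u - \<phi> v\<bar> powr p \<le> 3 powr p * (2 * B + C / e) * ?E"
        proof (cases "?E = 0")
          case True
          obtain B' where "osc_bound (k + m) B'" using osc_bound_ex by blast
          then have "\<bar>\<phi> u - \<phi> v\<bar> powr p \<le> B' * ?E" using uv by (simp add: osc_bound_def)
          then show ?thesis using True by simp
        next
          case False
          then have E: "0 < ?E" using energy_nonneg[of "k + m" "T (k + m)" \<phi>] by linarith
          define \<rho> where "\<rho> = grad (k + m) \<phi>"
          define \<rho>' where "\<rho>' z = (\<Sum>g\<in>symmetries. \<Sum>u\<in>{u\<in>T (k + m). fold_word k u = act g z}. \<rho> u)" for z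
          have \<rho>0: "0 \<le> \<rho> u" for u by (simp add: \<rho>_def grad_nonneg)
          have \<rho>'0: "0 \<le> \<rho>' u" for u unfolding \<rho>'_def by (intro sum_nonneg \<rho>0)
          have "(\<Sum>z\<in>T m. \<rho>' z powr p) \<le> real (card symmetries) powr p * (real (card (T k)) powr p *
              (real (card symmetries) * (\<Sum>u\<in>T (k + m). \<rho> u powr p)))"
            by (rule symmetrized_weight[OF k(1) \<rho>0 \<rho>'_def])
          also have "\<dots> \<le> real (card symmetries) powr p * (real (card (T k)) powr p *
              (real (card symmetries) * (2 * deg powr p * ?E)))"
            unfolding \<rho>_def by (intro mult_left_mono grad_energy) auto
          also have "\<dots> = C2 * ?E" by (simp add: C2_def)
          finally have \<rho>': "(\<Sum>z\<in>T m. \<rho>' z powr p) \<le> C2 * ?E" .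
          define t where "t = (C * ?E / e) powr (1 / p)"
          have t: "0 < t" "t powr p = C * ?E / e"
            using C(1) E e(1) p_pos by (auto simp: t_def powr_powr)
          have "\<exists>j U. crossing m j U \<and> sum \<rho>' U < t"
          proof (rule ccontr)
            assume "\<not> ?thesis"
            then have "\<forall>j U. crossing m j U \<longrightarrow> t \<le> sum \<rho>' U" by (meson not_le)
            then have "ennreal e \<le> ennreal (C1 * (\<Sum>z\<in>T m. \<rho>' z powr p) / t powr p)"
              using C1(2)[of \<rho>' t m] \<rho>'0 t(1) e(2) by simp
            moreover have "0 \<le> C1 * (\<Sum>z\<in>T m. \<rho>' z powr p) / t powr p"
              using C1(1) by (intro divide_nonneg_nonneg mult_nonneg_nonneg sum_nonneg) auto
            ultimately have "e \<le> C1 * (\<Sum>z\<in>T m. \<rho>' z powr p) / t powr p" by (simp add: ennreal_le_iff)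
            also have "\<dots> \<le> C1 * (C2 * ?E) / t powr p"
              by (intro divide_right_mono mult_left_mono \<rho>' C1(1)) auto
            also have "\<dots> = (C1 * C2) * (e / C)" unfolding t(2) using E by simp
            also have "\<dots> < C * (e / C)" using C e(1) by (intro mult_strict_right_mono) auto
            also have "\<dots> = e" using C by simp
            finally show False by simp
          qed
          then obtain j U where U: "crossing m j U" "sum \<rho>' U < t" by blast
          obtain W where W: "W \<subseteq> T m" "conn (adj m) W" "W \<subseteq> (\<Union>g\<in>symmetries. act g ` U)"
            "\<And>l e. e \<in> {1, -1} \<Longrightarrow> \<exists>z\<in>W. touches z l e" using spider[OF assms U(1)] by blast
          define V where "V = {u \<in> T (k + m). fold_word k u \<in> W}"
          have V: "conn (adj (k + m)) V" "\<And>x. x \<in> T k \<Longrightarrow> \<exists>u\<in>V. take k u = x" "V \<subseteq> T (k + m)"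
            using unfolded_spider[OF k(1) W(1,2,4)] by (auto simp: V_def)
          have finU: "finite U" using U(1) finite_subset[OF _ finite_T] by (auto simp: crossing_def)
          have "V \<subseteq> (\<Union>z\<in>U. \<Union>g\<in>symmetries. {u\<in>T (k + m). fold_word k u = act g z})"
          proof
            fix u assume "u \<in> V"
            then have "u \<in> T (k + m)" "fold_word k u \<in> W" by (auto simp: V_def)
            then have u: "u \<in> T (k + m)" "fold_word k u \<in> (\<Union>g\<in>symmetries. act g ` U)"
              using subsetD[OF W(3)] by blast+
            then obtain g z where "g \<in> symmetries" "z \<in> U" "fold_word k u = act g z" by blast
            then show "u \<in> (\<Union>z\<in>U. \<Union>g\<in>symmetries. {u\<in>T (k + m). fold_word k u = act g z})"
              using u(1) by blast
          qed
          then have "sum \<rho> V \<le> sum \<rho> (\<Union>z\<in>U. \<Union>g\<in>symmetries. {u\<in>T (k + m). fold_word k u = act g z})"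
            by (intro sum_mono2) (use finU finite_symmetries \<rho>0 in auto)
          also have "\<dots> \<le> (\<Sum>z\<in>U. sum \<rho> (\<Union>g\<in>symmetries. {u\<in>T (k + m). fold_word k u = act g z}))"
            by (rule sum_UN_le) (use finU finite_symmetries \<rho>0 in auto)
          also have "\<dots> \<le> sum \<rho>' U"
            unfolding \<rho>'_def by (intro sum_mono sum_UN_le) (use finite_symmetries \<rho>0 in auto)
          finally have sumV: "sum \<rho> V < t" using U(2) by simp
          obtain a where a: "a \<in> V" "take k a = take k u" using V(2) take_words[OF uv(1)] by blast
          obtain b where b: "b \<in> V" "take k b = take k v" using V(2) take_words[OF uv(2)] by blast
          have D: "u \<in> descendants S m (take k u)" "a \<in> descendants S m (take k u)"
            "v \<in> descendants S m (take k v)" "b \<in> descendants S m (take k v)"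
            using uv a b V(3) descendants_take by (metis subsetD)+
          have sub: "descendants S m (take k u) \<subseteq> T (k + m)" "descendants S m (take k v) \<subseteq> T (k + m)"
            using in_descendants[OF take_words[OF uv(1)]] in_descendants[OF take_words[OF uv(2)]] by blast+
          have ua: "\<bar>\<phi> u - \<phi> a\<bar> powr p \<le> B * ?E"
            by (rule osc_descendants[OF B(2) take_words[OF uv(1)] B(1) D(1,2) sub(1) finite_T])
          have bv: "\<bar>\<phi> b - \<phi> v\<bar> powr p \<le> B * ?E"
            by (rule osc_descendants[OF B(2) take_words[OF uv(2)] B(1) D(4,3) sub(2) finite_T])
          have "\<bar>\<phi> a - \<phi> b\<bar> \<le> sum \<rho> V" unfolding \<rho>_def by (rule grad_variation[OF V(3,1) a(1) b(1)])
          then have "\<bar>\<phi> a - \<phi> b\<bar> powr p \<le> t powr p" using sumV p_pos by (intro powr_mono2) auto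
          then have ab: "\<bar>\<phi> a - \<phi> b\<bar> powr p \<le> C / e * ?E" unfolding t(2) by simp
          have "\<bar>\<phi> u - \<phi> v\<bar> powr p \<le> (\<bar>\<phi> u - \<phi> a\<bar> + \<bar>\<phi> a - \<phi> b\<bar> + \<bar>\<phi> b - \<phi> v\<bar>) powr p"
            using p_pos by (intro powr_mono2) auto
          also have "\<dots> \<le> 3 powr p * (\<bar>\<phi> u - \<phi> a\<bar> powr p + \<bar>\<phi> a - \<phi> b\<bar> powr p + \<bar>\<phi> b - \<phi> v\<bar> powr p)"
            by (rule add3_powr_le) (auto simp: p_pos)
          also have "\<dots> \<le> 3 powr p * (B * ?E + C / e * ?E + B * ?E)"
            by (intro mult_left_mono add_mono ua ab bv) auto
          also have "\<dots> = 3 powr p * (2 * B + C / e) * ?E" by (simp add: algebra_simps)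
          finally show ?thesis .
        qed
      qed
    qed
  qed
qed

lemma disparity_le:
  assumes "osc_bound m B" "0 \<le> B"
  shows "neighbour_disparity S X p m \<le> ennreal (3 powr p * (2 * B + 2))"
  unfolding neighbour_disparity_def
proof (intro SUP_least, goal_cases)
  case (1 n wv)
  obtain w v where wv': "wv = (w, v)" by (cases wv)
  have wv: "(w, v) \<in> cell_edges S X n" using 1 wv' by simp
  show ?case unfolding wv' prod.case
  proof (rule SUP_least)
    fix \<phi> :: "(nat ^ 'n) list \<Rightarrow> real"
    let ?A = "descendants S m w" and ?B = "descendants S m v"
    let ?E = "p_energy S X p (n + m) (?A \<union> ?B) \<phi>"
    have w: "w \<in> T n" "v \<in> T n" "w \<noteq> v" using wv by (auto simp: cell_edges_def)
    have fin: "finite ?A" "finite ?B" unfolding descendants_eq[OF w(1)] descendants_eq[OF w(2)] by auto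
    have ne: "?A \<noteq> {}" "?B \<noteq> {}" unfolding descendants_eq[OF w(1)] descendants_eq[OF w(2)] using T_ne by auto
    obtain x where x: "x \<in> X w" "x \<in> X v" using wv by (auto simp: cell_edges_def)
    obtain y where y: "y \<in> T m" "x \<in> X (w @ y)" using sub_cell_cover[OF w(1) x(1)] by blast
    obtain z where z: "z \<in> T m" "x \<in> X (v @ z)" using sub_cell_cover[OF w(2) x(2)] by blast
    have ab: "w @ y \<in> ?A" "v @ z \<in> ?B"
      unfolding descendants_eq[OF w(1)] descendants_eq[OF w(2)] using y z by auto
    have "w @ y \<noteq> v @ z" using w words_length by (metis append_eq_append_conv)
    then have ed: "(w @ y, v @ z) \<in> cell_edges S X (n + m)"
      using y z append_words w by (auto simp: cell_edges_def)
    have "\<bar>\<phi> (w @ y) - \<phi> (v @ z)\<bar> powr p \<le>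
        (\<Sum>(u, v)\<in>((?A \<union> ?B) \<times> (?A \<union> ?B)) \<inter> cell_edges S X (n + m). \<bar>\<phi> u - \<phi> v\<bar> powr p)"
      using member_le_sum[of "(w @ y, v @ z)" "((?A \<union> ?B) \<times> (?A \<union> ?B)) \<inter> cell_edges S X (n + m)"
          "\<lambda>(u, v). \<bar>\<phi> u - \<phi> v\<bar> powr p"] ed ab fin by auto
    then have mid: "\<bar>\<phi> (w @ y) - \<phi> (v @ z)\<bar> powr p \<le> 2 * ?E" by (simp add: p_energy_def)
    have E0: "0 \<le> ?E" by (rule energy_nonneg)
    define M where "M = (3 powr p * (2 * B + 2) * ?E) powr (1 / p)"
    have M: "M powr p = 3 powr p * (2 * B + 2) * ?E"
      unfolding M_def using assms(2) E0 p_pos by (simp add: powr_powr)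
    have "\<bar>avg \<phi> ?A - avg \<phi> ?B\<bar> \<le> M"
    proof (rule abs_avg_diff_le[OF fin ne])
      fix u u' assume u: "u \<in> ?A" "u' \<in> ?B"
      have 1: "\<bar>\<phi> u - \<phi> (w @ y)\<bar> powr p \<le> B * ?E"
        by (rule osc_descendants[OF assms(1) w(1) assms(2) u(1) ab(1)]) (use fin in auto)
      have 2: "\<bar>\<phi> (v @ z) - \<phi> u'\<bar> powr p \<le> B * ?E"
        by (rule osc_descendants[OF assms(1) w(2) assms(2) ab(2) u(2)]) (use fin in auto)
      have "\<bar>\<phi> u - \<phi> u'\<bar> powr p \<le>
          (\<bar>\<phi> u - \<phi> (w @ y)\<bar> + \<bar>\<phi> (w @ y) - \<phi> (v @ z)\<bar> + \<bar>\<phi> (v @ z) - \<phi> u'\<bar>) powr p"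
        using p_pos by (intro powr_mono2) auto
      also have "\<dots> \<le> 3 powr p * (\<bar>\<phi> u - \<phi> (w @ y)\<bar> powr p + \<bar>\<phi> (w @ y) - \<phi> (v @ z)\<bar> powr p
          + \<bar>\<phi> (v @ z) - \<phi> u'\<bar> powr p)"
        by (rule add3_powr_le) (auto simp: p_pos)
      also have "\<dots> \<le> 3 powr p * (B * ?E + 2 * ?E + B * ?E)"
        by (intro mult_left_mono add_mono 1 2 mid) auto
      also have "\<dots> = M powr p" unfolding M by (simp add: algebra_simps)
      finally have le: "\<bar>\<phi> u - \<phi> u'\<bar> powr p \<le> M powr p" .
      have "0 \<le> M" by (simp add: M_def)
      then show "\<bar>\<phi> u - \<phi> u'\<bar> \<le> M"
        using le powr_less_mono2[OF p_pos, of M "\<bar>\<phi> u - \<phi> u'\<bar>"] by linarith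
    qed
    then have le: "\<bar>avg \<phi> ?A - avg \<phi> ?B\<bar> powr p \<le> 3 powr p * (2 * B + 2) * ?E"
      unfolding M[symmetric] using p_pos by (intro powr_mono2) auto
    show "ennreal (\<bar>avg \<phi> ?A - avg \<phi> ?B\<bar> powr p) / ennreal ?E \<le> ennreal (3 powr p * (2 * B + 2))"
    proof (cases "?E = 0")
      case True
      then show ?thesis using le by simp
    next
      case False
      then have "0 < ?E" using E0 by simp
      then have "ennreal (\<bar>avg \<phi> ?A - avg \<phi> ?B\<bar> powr p) / ennreal ?E =
          ennreal (\<bar>avg \<phi> ?A - avg \<phi> ?B\<bar> powr p / ?E)" by (simp add: divide_ennreal)
      also have "\<dots> \<le> ennreal (3 powr p * (2 * B + 2))"
        using le \<open>0 < ?E\<close> by (intro ennreal_leI) (simp add: pos_divide_le_eq)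
      finally show ?thesis .
    qed
  qed
qed

end

section \<open>Quasisymmetric metrics\<close>

lemma half_line_homeomorphism_0:
  fixes \<theta> :: "real \<Rightarrow> real"
  assumes "homeomorphism {0..} {0..} \<theta> \<theta>'"
  shows "continuous_on {0..} \<theta>" "\<theta> 0 = 0"
proof -
  show cont: "continuous_on {0..} \<theta>" using assms by (simp add: homeomorphism_def)
  have im: "\<theta> ` {0..} = {0..}" using assms by (simp add: homeomorphism_def)
  have inj: "x = y" if "\<theta> x = \<theta> y" "0 \<le> x" "0 \<le> y" for x y
    using assms that unfolding homeomorphism_def by (metis atLeast_iff)
  have nn: "0 \<le> \<theta> x" if "0 \<le> x" for x using im that by (metis atLeast_iff image_eqI)
  have "(0::real) \<in> \<theta> ` {0..}" unfolding im by simp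
  then obtain c where c: "0 \<le> c" "\<theta> c = 0" by force
  show "\<theta> 0 = 0"
  proof (cases "c = 0")
    case False
    then have c0: "0 < c" using c by simp
    define s where "s = min (\<theta> 0) (\<theta> (c + 1))"
    have "\<theta> 0 \<noteq> 0" "\<theta> (c + 1) \<noteq> 0" using inj[of 0 c] inj[of "c + 1" c] c c0 by auto
    then have s: "0 < s" using nn[of 0] nn[of "c + 1"] c by (auto simp: s_def)
    have "continuous_on {0..c} \<theta>" "continuous_on {c..c + 1} \<theta>"
      by (rule continuous_on_subset[OF cont]; use c in auto)+
    then obtain a b where a: "0 \<le> a" "a \<le> c" "\<theta> a = s" and b: "c \<le> b" "b \<le> c + 1" "\<theta> b = s"
      using IVT2'[of \<theta> c s 0] IVT'[of \<theta> c s "c + 1"] s c by (auto simp: s_def)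
    then have "a = c" using inj[of a b] by auto
    then show ?thesis using a c s by simp
  qed (use c in simp)
qed

locale quasisymmetric_tiling = cubic_tiling_energy N K S f p
  for N :: nat and K :: "(real ^ 'n) set" and S :: "(nat ^ 'n) set"
    and f :: "nat ^ 'n \<Rightarrow> real ^ 'n \<Rightarrow> real ^ 'n" and p :: real +
  fixes \<rho> :: "real ^ 'n \<Rightarrow> real ^ 'n \<Rightarrow> real" and \<theta> :: "real \<Rightarrow> real"
  assumes metric: "Metric_space K \<rho>"
    and \<theta>_cont: "continuous_on {0..} \<theta>" and \<theta>_0: "\<theta> 0 = 0"
    and qs: "x \<in> K \<Longrightarrow> y \<in> K \<Longrightarrow> z \<in> K \<Longrightarrow> x \<noteq> z \<Longrightarrow> \<rho> x y / \<rho> x z \<le> \<theta> (dist x y / dist x z)"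
begin

sublocale M: Metric_space K \<rho> by (rule metric)

lemma qs_le:
  assumes "x \<in> K" "y \<in> K" "z \<in> K" "x \<noteq> z" "\<theta> (dist x y / dist x z) \<le> c"
  shows "\<rho> x y \<le> c * \<rho> x z"
proof -
  have "0 < \<rho> x z" using assms by (simp add: M.mdist_pos_eq)
  moreover have "\<rho> x y / \<rho> x z \<le> c" using qs[OF assms(1-4)] assms(5) by linarith
  ultimately show ?thesis by (simp add: pos_divide_le_eq)
qed

lemma qs_bound:
  assumes "0 \<le> a"
  obtains C where "1 \<le> C" "\<And>x y z. x \<in> K \<Longrightarrow> y \<in> K \<Longrightarrow> z \<in> K \<Longrightarrow> x \<noteq> z \<Longrightarrow>
    dist x y \<le> a * dist x z \<Longrightarrow> \<rho> x y \<le> C * \<rho> x z"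
proof -
  have "\<exists>t\<in>{0..a}. \<forall>s\<in>{0..a}. \<theta> s \<le> \<theta> t"
    by (rule continuous_attains_sup) (use assms in \<open>auto intro: continuous_on_subset[OF \<theta>_cont]\<close>)
  then obtain C0 where C0: "\<And>s. s \<in> {0..a} \<Longrightarrow> \<theta> s \<le> C0" by blast
  show ?thesis
  proof (rule that[of "max 1 C0"])
    fix x y z assume xyz: "x \<in> K" "y \<in> K" "z \<in> K" "x \<noteq> z" and d: "dist x y \<le> a * dist x z"
    have "dist x y / dist x z \<in> {0..a}" using d xyz(4) by (simp add: pos_divide_le_eq)
    then have "\<theta> (dist x y / dist x z) \<le> C0" by (rule C0)
    then show "\<rho> x y \<le> max 1 C0 * \<rho> x z" by (intro qs_le[OF xyz]) simp
  qed simp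
qed

lemma qs_small:
  assumes "0 < \<epsilon>"
  obtains \<delta> where "0 < \<delta>" "\<And>x y z. x \<in> K \<Longrightarrow> y \<in> K \<Longrightarrow> z \<in> K \<Longrightarrow> x \<noteq> z \<Longrightarrow>
    dist x y \<le> \<delta> * dist x z \<Longrightarrow> \<rho> x y \<le> \<epsilon> * \<rho> x z"
proof -
  have "(0::real) \<in> {0..}" by simp
  from bspec[OF \<theta>_cont[unfolded continuous_on_iff] this] assms
  obtain d where d0: "0 < d" "\<forall>t\<in>{0..}. dist t 0 < d \<longrightarrow> dist (\<theta> t) (\<theta> 0) < \<epsilon>" by blast
  have d: "0 < d" "\<And>t. 0 \<le> t \<Longrightarrow> t < d \<Longrightarrow> \<theta> t < \<epsilon>"
  proof -
    fix t :: real assume t: "0 \<le> t" "t < d"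
    then have "dist (\<theta> t) (\<theta> 0) < \<epsilon>" using d0(2) by (simp add: dist_real_def)
    then show "\<theta> t < \<epsilon>" by (simp add: \<theta>_0 dist_real_def)
  qed (rule d0(1))
  show ?thesis
  proof (rule that[of "d / 2"])
    show "0 < d / 2" using d by simp
    fix x y z assume xyz: "x \<in> K" "y \<in> K" "z \<in> K" "x \<noteq> z" and le: "dist x y \<le> d / 2 * dist x z"
    have "dist x y / dist x z \<le> d / 2" using le xyz(4) by (simp add: pos_divide_le_eq)
    then have "dist x y / dist x z < d" using d(1) by linarith
    then have "\<theta> (dist x y / dist x z) < \<epsilon>" by (intro d(2)) auto
    then show "\<rho> x y \<le> \<epsilon> * \<rho> x z" by (intro qs_le[OF xyz]) simp
  qed
qed

definition ctr :: "(nat ^ 'n) list \<Rightarrow> real ^ 'n" where "ctr w = wm w ipt"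

definition far :: "(nat ^ 'n) list \<Rightarrow> real ^ 'n" where
  "far w = (SOME y. y \<in> X w \<and> 1 / scl (length w) \<le> dist (ctr w) y)"

definition R :: "(nat ^ 'n) list \<Rightarrow> real" where "R w = \<rho> (ctr w) (far w)"

lemma ctr: "ctr w \<in> X w" by (simp add: ctr_def cell_ipt)

lemma far:
  assumes "w \<in> T n" shows "far w \<in> X w" "1 / scl n \<le> dist (ctr w) (far w)"
proof -
  fix i :: 'n
  obtain x y where xy: "x \<in> X w" "y \<in> X w" "x $ i - y $ i = 2 / scl n"
    using cell_two_points[OF assms] by blast
  have "\<bar>ctr w $ i - x $ i\<bar> \<le> dist (ctr w) x" "\<bar>ctr w $ i - y $ i\<bar> \<le> dist (ctr w) y"
    using component_le_norm_cart[of "ctr w - x" i] component_le_norm_cart[of "ctr w - y" i]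
    by (auto simp: dist_norm)
  moreover have "2 / scl n \<le> \<bar>ctr w $ i - x $ i\<bar> + \<bar>ctr w $ i - y $ i\<bar>" unfolding xy(3)[symmetric] by linarith
  ultimately have "1 / scl n \<le> dist (ctr w) x \<or> 1 / scl n \<le> dist (ctr w) y" by linarith
  then have "\<exists>y. y \<in> X w \<and> 1 / scl (length w) \<le> dist (ctr w) y"
    using xy words_length[OF assms] by auto
  from someI_ex[OF this] show "far w \<in> X w" "1 / scl n \<le> dist (ctr w) (far w)"
    using words_length[OF assms] unfolding far_def by auto
qed

lemma ctr_K: "w \<in> T n \<Longrightarrow> ctr w \<in> K" and far_K: "w \<in> T n \<Longrightarrow> far w \<in> K"
  using ctr far cell_subset by blast+

lemma ctr_ne_far: "w \<in> T n \<Longrightarrow> ctr w \<noteq> far w"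
proof
  assume "w \<in> T n" "ctr w = far w"
  then have "1 / scl n \<le> 0" using far(2)[of w n] by simp
  moreover have "0 < 1 / scl n" by simp
  ultimately show False by linarith
qed

lemma R_pos: "w \<in> T n \<Longrightarrow> 0 < R w"
  unfolding R_def using ctr_ne_far ctr_K far_K M.mdist_pos_eq by blast

lemma R_near:
  assumes "0 \<le> a"
  obtains C where "1 \<le> C" "\<And>n w x. w \<in> T n \<Longrightarrow> x \<in> K \<Longrightarrow> dist (ctr w) x \<le> a / scl n \<Longrightarrow> \<rho> (ctr w) x \<le> C * R w"
proof -
  obtain C where C: "1 \<le> C" "\<And>x y z. x \<in> K \<Longrightarrow> y \<in> K \<Longrightarrow> z \<in> K \<Longrightarrow> x \<noteq> z \<Longrightarrow>
    dist x y \<le> a * dist x z \<Longrightarrow> \<rho> x y \<le> C * \<rho> x z" using qs_bound[OF assms] by blast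
  show ?thesis
  proof (rule that[OF C(1)])
    fix n w x assume w: "w \<in> T n" and x: "x \<in> K" and d: "dist (ctr w) x \<le> a / scl n"
    have "a * (1 / scl n) \<le> a * dist (ctr w) (far w)" by (intro mult_left_mono far w assms)
    then show "\<rho> (ctr w) x \<le> C * R w"
      unfolding R_def using d by (intro C(2) ctr_K[OF w] far_K[OF w] x ctr_ne_far[OF w]) simp
  qed
qed

lemma R_far:
  assumes "0 < b"
  obtains C where "1 \<le> C" "\<And>n w x. w \<in> T n \<Longrightarrow> x \<in> K \<Longrightarrow> b / scl n \<le> dist (ctr w) x \<Longrightarrow> R w \<le> C * \<rho> (ctr w) x"
proof -
  obtain C where C: "1 \<le> C" "\<And>x y z. x \<in> K \<Longrightarrow> y \<in> K \<Longrightarrow> z \<in> K \<Longrightarrow> x \<noteq> z \<Longrightarrow>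
    dist x y \<le> (2 * real CARD('n)) / b * dist x z \<Longrightarrow> \<rho> x y \<le> C * \<rho> x z"
    using qs_bound[of "(2 * real CARD('n)) / b"] assms by auto
  show ?thesis
  proof (rule that[OF C(1)])
    fix n w x assume w: "w \<in> T n" and x: "x \<in> K" and d: "b / scl n \<le> dist (ctr w) x"
    have "dist (ctr w) (far w) \<le> (2 * real CARD('n)) / scl n" by (rule cell_dist[OF w ctr far(1)[OF w]])
    also have "\<dots> = (2 * real CARD('n)) / b * (b / scl n)" using assms by simp
    also have "\<dots> \<le> (2 * real CARD('n)) / b * dist (ctr w) x" by (intro mult_left_mono d) (use assms in simp)
    finally have le: "dist (ctr w) (far w) \<le> (2 * real CARD('n)) / b * dist (ctr w) x" .
    have "0 < b / scl n" using assms by simp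
    then have "ctr w \<noteq> x" using d by auto
    then show "R w \<le> C * \<rho> (ctr w) x" unfolding R_def by (intro C(2) ctr_K[OF w] far_K[OF w] x le)
  qed
qed

lemma R_separated:
  obtains C where "1 \<le> C" "\<And>n w v x y. w \<in> T n \<Longrightarrow> v \<in> T n \<Longrightarrow> X w \<inter> X v = {} \<Longrightarrow>
    x \<in> X w \<Longrightarrow> y \<in> X v \<Longrightarrow> R w \<le> C * \<rho> x y"
proof -
  obtain c where c: "c > 0" "\<forall>n. \<forall>w\<in>T n. \<forall>v\<in>T n. X w \<inter> X v = {} \<longrightarrow>
     (\<forall>x\<in>X w. \<forall>y\<in>X v. \<exists>i. c / scl n \<le> \<bar>x $ i - y $ i\<bar>)" using separation by blast
  obtain C where C: "1 \<le> C" "\<And>x y z. x \<in> K \<Longrightarrow> y \<in> K \<Longrightarrow> z \<in> K \<Longrightarrow> x \<noteq> z \<Longrightarrow>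
    dist x y \<le> (2 * real CARD('n)) / c * dist x z \<Longrightarrow> \<rho> x y \<le> C * \<rho> x z"
    using qs_bound[of "(2 * real CARD('n)) / c"] c(1) by auto
  show ?thesis
  proof (rule that[of "2 * C"])
    show "1 \<le> 2 * C" using C(1) by simp
    fix n w v x y assume w: "w \<in> T n" "v \<in> T n" "X w \<inter> X v = {}" and x: "x \<in> X w" and y: "y \<in> X v"
    have xy: "x \<in> K" "y \<in> K" "x \<noteq> y" using cell_subset w x y by blast+
    obtain i where "c / scl n \<le> \<bar>x $ i - y $ i\<bar>" using c(2) w x y by blast
    then have d: "c / scl n \<le> dist x y" using component_le_norm_cart[of "x - y" i] by (simp add: dist_norm)
    have near: "\<rho> x z \<le> C * \<rho> x y" if z: "z \<in> X w" for z
    proof (rule C(2)[OF xy(1) _ xy(2,3)])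
      show "z \<in> K" using cell_subset w(1) z by blast
      have "dist x z \<le> (2 * real CARD('n)) / scl n" by (rule cell_dist[OF w(1) x z])
      also have "\<dots> = (2 * real CARD('n)) / c * (c / scl n)" using c(1) by simp
      also have "\<dots> \<le> (2 * real CARD('n)) / c * dist x y" by (intro mult_left_mono d) (use c(1) in simp)
      finally show "dist x z \<le> (2 * real CARD('n)) / c * dist x y" .
    qed
    have "R w \<le> \<rho> (ctr w) x + \<rho> x (far w)"
      unfolding R_def by (intro M.triangle ctr_K[OF w(1)] far_K[OF w(1)] xy)
    also have "\<rho> (ctr w) x = \<rho> x (ctr w)" by (rule M.commute)
    finally show "R w \<le> 2 * C * \<rho> x y" using near[OF ctr] near[OF far(1)[OF w(1)]] by linarith
  qed
qed

lemma R_nbr: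
  obtains C where "1 \<le> C" "\<And>n w v. v \<in> nbr n w \<Longrightarrow> R v \<le> C * R w"
proof -
  obtain C where C: "1 \<le> C" "\<And>n w x. w \<in> T n \<Longrightarrow> x \<in> K \<Longrightarrow> dist (ctr w) x \<le> 2 * (2 * real CARD('n)) / scl n \<Longrightarrow> \<rho> (ctr w) x \<le> C * R w"
    using R_near[of "2 * (2 * real CARD('n))"] by auto
  show ?thesis
  proof (rule that[of "2 * C"])
    show "1 \<le> 2 * C" using C(1) by simp
    fix n w v assume v: "v \<in> nbr n w"
    then obtain q where q: "q \<in> X w" "q \<in> X v" and T: "w \<in> T n" "v \<in> T n" by (auto simp: nbr_def adj_def)
    have near: "\<rho> (ctr w) z \<le> C * R w" if z: "z \<in> X v" for z
    proof (rule C(2)[OF T(1)])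
      show "z \<in> K" using cell_subset T(2) z by blast
      have "dist (ctr w) q \<le> (2 * real CARD('n)) / scl n" "dist q z \<le> (2 * real CARD('n)) / scl n"
        using cell_dist[OF T(1) ctr q(1)] cell_dist[OF T(2) q(2) z] by auto
      then show "dist (ctr w) z \<le> 2 * (2 * real CARD('n)) / scl n" using dist_triangle[of "ctr w" z q] by simp
    qed
    have "R v \<le> \<rho> (ctr v) (ctr w) + \<rho> (ctr w) (far v)"
      unfolding R_def by (intro M.triangle ctr_K[OF T(2)] far_K[OF T(2)] ctr_K[OF T(1)])
    also have "\<rho> (ctr v) (ctr w) = \<rho> (ctr w) (ctr v)" by (rule M.commute)
    finally show "R v \<le> 2 * C * R w" using near[OF ctr] near[OF far(1)[OF T(2)]] by linarith
  qed
qed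

lemma R_cell:
  obtains C where "1 \<le> C" "\<And>n w x y. w \<in> T n \<Longrightarrow> x \<in> X w \<Longrightarrow> y \<in> X w \<Longrightarrow> \<rho> x y \<le> C * R w"
proof -
  obtain C where C: "1 \<le> C" "\<And>n w x. w \<in> T n \<Longrightarrow> x \<in> K \<Longrightarrow> dist (ctr w) x \<le> (2 * real CARD('n)) / scl n \<Longrightarrow> \<rho> (ctr w) x \<le> C * R w"
    using R_near[of "(2 * real CARD('n))"] by auto
  show ?thesis
  proof (rule that[of "2 * C"])
    show "1 \<le> 2 * C" using C(1) by simp
    fix n w x y assume w: "w \<in> T n" and x: "x \<in> X w" and y: "y \<in> X w"
    have xy: "x \<in> K" "y \<in> K" using cell_subset w x y by blast+
    have "\<rho> x y \<le> \<rho> x (ctr w) + \<rho> (ctr w) y" by (intro M.triangle xy ctr_K[OF w])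
    moreover have "\<rho> x (ctr w) = \<rho> (ctr w) x" by (rule M.commute)
    moreover have "\<rho> (ctr w) x \<le> C * R w" "\<rho> (ctr w) y \<le> C * R w"
      by (intro C(2)[OF w] xy cell_dist[OF w ctr] x y)+
    ultimately show "\<rho> x y \<le> 2 * C * R w" by linarith
  qed
qed

lemma R_take_le:
  obtains C where "1 \<le> C" "\<And>n m u. u \<in> T (n + m) \<Longrightarrow> R u \<le> C * R (take n u)"
proof -
  obtain C where C: "1 \<le> C" "\<And>n w x y. w \<in> T n \<Longrightarrow> x \<in> X w \<Longrightarrow> y \<in> X w \<Longrightarrow> \<rho> x y \<le> C * R w"
    using R_cell by blast
  have "R u \<le> C * R (take n u)" if u: "u \<in> T (n + m)" for n m u
    using C(2)[OF take_words[OF u], of "ctr u" "far u"] cell_take[OF u] ctr far(1)[OF u]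
    unfolding R_def by blast
  then show ?thesis using that C(1) by blast
qed

lemma R_take_small:
  assumes "0 < \<epsilon>"
  obtains m0 where "\<And>n m u. m0 \<le> m \<Longrightarrow> u \<in> T (n + m) \<Longrightarrow> R u \<le> \<epsilon> * R (take n u)"
proof -
  obtain C where C: "1 \<le> C" "\<And>n w x y. w \<in> T n \<Longrightarrow> x \<in> X w \<Longrightarrow> y \<in> X w \<Longrightarrow> \<rho> x y \<le> C * R w"
    using R_cell by blast
  have "0 < \<epsilon> / C" using assms C by simp
  then obtain \<delta> where \<delta>: "0 < \<delta>" "\<And>x y z. x \<in> K \<Longrightarrow> y \<in> K \<Longrightarrow> z \<in> K \<Longrightarrow> x \<noteq> z \<Longrightarrow>
    dist x y \<le> \<delta> * dist x z \<Longrightarrow> \<rho> x y \<le> \<epsilon> / C * \<rho> x z" using qs_small by blast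
  obtain m0 where m0: "2 * (2 * real CARD('n)) / scl m0 < \<delta>" using scl_tendsto[OF \<delta>(1)] by blast
  show ?thesis
  proof (rule that[of m0])
    fix n m u assume m: "m0 \<le> m" and u: "u \<in> T (n + m)"
    define w where "w = take n u"
    have w: "w \<in> T n" using take_words[OF u] by (simp add: w_def)
    have sub: "X u \<subseteq> X w" using cell_take[OF u] by (simp add: w_def)
    have x: "ctr u \<in> X w" "far u \<in> X w" using sub ctr far(1)[OF u] by blast+
    have "1 / scl n \<le> dist (ctr u) (ctr w) + dist (ctr u) (far w)"
      using far(2)[OF w] dist_triangle3[of "ctr w" "far w" "ctr u"] by linarith
    then have "1 / (2 * scl n) \<le> dist (ctr u) (ctr w) \<or> 1 / (2 * scl n) \<le> dist (ctr u) (far w)"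
      by (simp add: field_simps) linarith
    then obtain z where z: "z \<in> X w" "1 / (2 * scl n) \<le> dist (ctr u) z" using ctr far(1)[OF w] by blast
    have "0 < dist (ctr u) z" by (rule less_le_trans[OF _ z(2)]) simp
    then have ne: "ctr u \<noteq> z" by auto
    have "2 * (2 * real CARD('n)) / scl m \<le> 2 * (2 * real CARD('n)) / scl m0"
      using m N2 by (intro divide_left_mono power_increasing) auto
    then have "2 * (2 * real CARD('n)) / scl m \<le> \<delta>" using m0 by linarith
    have "dist (ctr u) (far u) \<le> (2 * real CARD('n)) / scl (n + m)" by (rule cell_dist[OF u ctr far(1)[OF u]])
    also have "\<dots> = 2 * (2 * real CARD('n)) / scl m * (1 / (2 * scl n))" by (simp add: power_add)
    also have "\<dots> \<le> \<delta> * dist (ctr u) z"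
      by (intro mult_mono z(2) \<open>2 * (2 * real CARD('n)) / scl m \<le> \<delta>\<close>) (use \<delta>(1) in auto)
    finally have "\<rho> (ctr u) (far u) \<le> \<epsilon> / C * \<rho> (ctr u) z"
      using cell_subset[OF w] z(1) by (intro \<delta>(2) ctr_K[OF u] far_K[OF u] ne) auto
    also have "\<dots> \<le> \<epsilon> / C * (C * R w)"
      using C assms by (intro mult_left_mono C(2)[OF w] x(1) z(1)) auto
    also have "\<dots> = \<epsilon> * R w" using C(1) by simp
    finally show "R u \<le> \<epsilon> * R (take n u)" by (simp add: R_def w_def)
  qed
qed

lemma ipt_margin:
  obtains \<beta> where "0 < \<beta>" "\<And>n u v y. u \<in> T n \<Longrightarrow> v \<in> T n \<Longrightarrow> y \<in> X v \<Longrightarrow> dist (ctr u) y < \<beta> / scl n \<Longrightarrow> v = u"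
proof -
  define \<beta> where "\<beta> = Min (range (\<lambda>i. 1 - \<bar>ipt $ i\<bar>))"
  have b0: "0 < \<beta>" unfolding \<beta>_def using ipt(2) by (subst Min_gr_iff) auto
  have b: "\<bar>ipt $ i\<bar> \<le> 1 - \<beta>" for i
  proof -
    have "\<beta> \<le> 1 - \<bar>ipt $ i\<bar>" unfolding \<beta>_def by (rule Min_le) auto
    then show ?thesis by linarith
  qed
  show ?thesis
  proof (rule that[OF b0])
    fix n u v y assume u: "u \<in> T n" and v: "v \<in> T n" and y: "y \<in> X v" and d: "dist (ctr u) y < \<beta> / scl n"
    obtain y' where y': "y' \<in> K" "y = wm v y'" using y by (auto simp: cell_def)
    show "v = u"
    proof (rule idx_inj[OF v u], rule ext)
      fix i
      obtain \<pi> e where pe: "bij \<pi>" "\<And>i. e i = 1 \<or> e i = -1" "\<And>x i. rot u x $ i = e i * x $ \<pi> i"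
        using signed_permE[OF rot_idx(1)[OF u]] by blast
      have 1: "\<bar>rot u ipt $ i\<bar> \<le> 1 - \<beta>" using b[of "\<pi> i"] pe(2)[of i] unfolding pe(3) by auto
      have 2: "\<bar>rot v y' $ i\<bar> \<le> 1" using rot_bound[OF v] y'(1) K_cube by blast
      have "\<bar>ctr u $ i - y $ i\<bar> < \<beta> / scl n"
        using component_le_norm_cart[of "ctr u - y" i] d by (simp add: dist_norm)
      then have "\<bar>(ctr u $ i - y $ i) * scl n\<bar> < \<beta>" by (simp add: abs_mult pos_less_divide_eq)
      moreover have "(ctr u $ i - y $ i) * scl n =
          (rot u ipt $ i + 2 * of_int (idx u i)) - (rot v y' $ i + 2 * of_int (idx v i))"
        using scaled_coord[OF u, of ipt i] scaled_coord[OF v, of y' i]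
        unfolding ctr_def y'(2) by (simp add: algebra_simps)
      moreover have "\<bar>2 * (d - c)\<bar> < 2"
        if "\<bar>x\<bar> < \<beta>" "x = a + 2 * c - (b + 2 * d)" "\<bar>a\<bar> \<le> 1 - \<beta>" "\<bar>b\<bar> \<le> 1" for a b c d x :: real
        using that by (smt (verit))
      ultimately have "\<bar>2 * (of_int (idx v i) - of_int (idx u i))\<bar> < (2::real)" using 1 2 by metis
      then have "\<bar>of_int (idx v i - idx u i)\<bar> < (1::real)" by simp
      then show "idx v i = idx u i" by linarith
    qed
  qed
qed

lemma disjoint_balls:
  obtains \<kappa> where "0 < \<kappa>" "\<kappa> \<le> 1" "\<And>n u v y. u \<in> T n \<Longrightarrow> v \<in> T n \<Longrightarrow> y \<in> X v \<Longrightarrow>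
    y \<in> M.mball (ctr u) (\<kappa> * R u) \<Longrightarrow> v = u"
proof -
  obtain \<beta> where \<beta>: "0 < \<beta>" "\<And>n u v y. u \<in> T n \<Longrightarrow> v \<in> T n \<Longrightarrow> y \<in> X v \<Longrightarrow> dist (ctr u) y < \<beta> / scl n \<Longrightarrow> v = u"
    using ipt_margin by blast
  obtain C where C: "1 \<le> C" "\<And>n w x. w \<in> T n \<Longrightarrow> x \<in> K \<Longrightarrow> \<beta> / scl n \<le> dist (ctr w) x \<Longrightarrow> R w \<le> C * \<rho> (ctr w) x"
    using R_far[OF \<beta>(1)] by blast
  show ?thesis
  proof (rule that[of "1 / C"])
    show "0 < 1 / C" "1 / C \<le> 1" using C(1) by auto
    fix n u v y assume uv: "u \<in> T n" "v \<in> T n" "y \<in> X v" and y: "y \<in> M.mball (ctr u) (1 / C * R u)"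
    have "dist (ctr u) y < \<beta> / scl n"
    proof (rule ccontr)
      assume "\<not> ?thesis"
      then have "R u \<le> C * \<rho> (ctr u) y" using C(2)[OF uv(1)] y by auto
      moreover have "C * \<rho> (ctr u) y < C * (1 / C * R u)" using y C(1) by (intro mult_strict_left_mono) auto
      ultimately show False using C(1) by simp
    qed
    then show "v = u" using \<beta>(2) uv by blast
  qed
qed

section \<open>Decay of the conductance constants\<close>

context
  fixes \<alpha> :: real and \<mu> :: "(real ^ 'n) measure"
  assumes \<alpha>: "0 \<le> \<alpha>" "\<alpha> < p" and breg: "borel_regular K \<rho> \<mu>" and areg: "ahlfors_regular K \<rho> \<alpha> \<mu>"
begin

lemma ball_measurable: "M.mball x r \<in> sets \<mu>"
proof -
  have "M.mball x r \<in> metric_borel_sets K \<rho>"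
    unfolding metric_borel_sets_def by (intro sigma_sets.Basic) (simp add: M.openin_mball)
  then show ?thesis using breg unfolding borel_regular_def by blast
qed

lemma ahlfors_bounds:
  obtains c1 c2 where "0 < c1" "0 < c2"
    "\<And>x a b r. x \<in> K \<Longrightarrow> a \<in> K \<Longrightarrow> b \<in> K \<Longrightarrow> 0 < r \<Longrightarrow> r \<le> \<rho> a b \<Longrightarrow>
      ennreal (c1 * r powr \<alpha>) \<le> emeasure \<mu> (M.mball x r)"
    "\<And>x r. x \<in> K \<Longrightarrow> 0 < r \<Longrightarrow> emeasure \<mu> (M.mball x r) \<le> ennreal (c2 * r powr \<alpha>)"
proof -
  let ?D = "SUP y\<in>K. SUP z\<in>K. ereal (\<rho> y z)"
  obtain c1 c2 where c: "0 < c1" "0 < c2" "\<And>x r. x \<in> K \<Longrightarrow> 0 < r \<Longrightarrow> ereal r \<le> ?D \<Longrightarrow>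
      ennreal (c1 * r powr \<alpha>) \<le> emeasure \<mu> (M.mball x r) \<and>
      emeasure \<mu> (M.mball x r) \<le> ennreal (c2 * r powr \<alpha>)"
    using areg unfolding ahlfors_regular_def by blast
  have D: "ereal r \<le> ?D" if "a \<in> K" "b \<in> K" "r \<le> \<rho> a b" for a b r
  proof -
    have "ereal r \<le> ereal (\<rho> a b)" using that by simp
    also have "\<dots> \<le> (SUP z\<in>K. ereal (\<rho> a z))" by (rule SUP_upper[OF that(2)])
    also have "\<dots> \<le> ?D" by (rule SUP_upper[OF that(1)])
    finally show ?thesis .
  qed
  obtain C where C: "1 \<le> C" "\<And>n w x y. w \<in> T n \<Longrightarrow> x \<in> X w \<Longrightarrow> y \<in> X w \<Longrightarrow> \<rho> x y \<le> C * R w"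
    using R_cell by blast
  have "0 < 1 / (2 * C)" using C(1) by simp
  then obtain k where k: "\<And>n m u. k \<le> m \<Longrightarrow> u \<in> T (n + m) \<Longrightarrow> R u \<le> 1 / (2 * C) * R (take n u)"
    using R_take_small by blast
  have Rk: "2 * C * R v \<le> R []" if "v \<in> T k" for v
    using k[of k v 0] that C(1) by (simp add: field_simps)
  have T0: "[] \<in> T 0" by simp
  have D0: "ereal (R []) \<le> ?D"
    unfolding R_def by (rule D[OF ctr_K[OF T0] far_K[OF T0] order_refl])
  define c2' where "c2' = c2 * (1 + real (card (T k)))"
  show ?thesis
  proof (rule that[of c1 c2'])
    show "0 < c2'" using c(2) by (simp add: c2'_def)
    show "0 < c1" by (rule c(1))
    show "ennreal (c1 * r powr \<alpha>) \<le> emeasure \<mu> (M.mball x r)"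
      if "x \<in> K" "a \<in> K" "b \<in> K" "0 < r" "r \<le> \<rho> a b" for x a b r
      using c(3)[OF that(1,4)] D[OF that(2,3,5)] by blast
    fix x r assume x: "x \<in> K" and r: "(0::real) < r"
    show "emeasure \<mu> (M.mball x r) \<le> ennreal (c2' * r powr \<alpha>)"
    proof (cases "ereal r \<le> ?D")
      case True
      then have "emeasure \<mu> (M.mball x r) \<le> ennreal (c2 * r powr \<alpha>)" using c(3) x r by blast
      also have "\<dots> \<le> ennreal (c2' * r powr \<alpha>)"
        unfolding c2'_def using c(2) by (intro ennreal_leI mult_right_mono) auto
      finally show ?thesis .
    next
      case False
      then have "ereal (R []) < ereal r" using D0 by (meson le_less_trans not_le)
      then have rR: "R [] < r" by simp
      define B where "B v = M.mball (ctr v) (2 * C * R v)" for v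
      have BT: "emeasure \<mu> (B v) \<le> ennreal (c2 * r powr \<alpha>)" if v: "v \<in> T k" for v
      proof -
        have pos: "0 < 2 * C * R v" using R_pos[OF v] C(1) by simp
        have "ereal (2 * C * R v) \<le> ?D" using Rk[OF v] D0 by (meson ereal_less_eq(3) order_trans)
        then have "emeasure \<mu> (B v) \<le> ennreal (c2 * (2 * C * R v) powr \<alpha>)"
          unfolding B_def using c(3)[OF ctr_K[OF v] pos] by blast
        also have "\<dots> \<le> ennreal (c2 * r powr \<alpha>)"
          using c(2) pos Rk[OF v] rR \<alpha> by (intro ennreal_leI mult_left_mono powr_mono2) auto
        finally show ?thesis .
      qed
      have sub: "M.mball x r \<subseteq> (\<Union>v\<in>T k. B v)"
      proof
        fix y assume "y \<in> M.mball x r"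
        then have y: "y \<in> K" by simp
        then obtain v where v: "v \<in> T k" "y \<in> X v" using cell_cover by blast
        have "\<rho> (ctr v) y \<le> C * R v" by (rule C(2)[OF v(1) ctr v(2)])
        also have "\<dots> < 2 * C * R v" using R_pos[OF v(1)] C(1) by simp
        finally have "y \<in> B v" using y ctr_K[OF v(1)] by (simp add: B_def)
        then show "y \<in> (\<Union>v\<in>T k. B v)" using v by blast
      qed
      have meas: "B ` T k \<subseteq> sets \<mu>" using ball_measurable by (auto simp: B_def)
      have "emeasure \<mu> (M.mball x r) \<le> emeasure \<mu> (\<Union>v\<in>T k. B v)"
        by (rule emeasure_mono[OF sub]) (use meas in \<open>auto intro: sets.finite_UN\<close>)
      also have "\<dots> \<le> (\<Sum>v\<in>T k. emeasure \<mu> (B v))"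
        by (rule emeasure_subadditive_finite[OF finite_T meas])
      also have "\<dots> \<le> (\<Sum>v\<in>T k. ennreal (c2 * r powr \<alpha>))" by (intro sum_mono BT)
      also have "\<dots> = ennreal (\<Sum>v\<in>T k. c2 * r powr \<alpha>)" using c(2) by (intro sum_ennreal) auto
      also have "\<dots> \<le> ennreal (c2' * r powr \<alpha>)"
        unfolding c2'_def using c(2) by (intro ennreal_leI) (simp add: algebra_simps)
      finally show ?thesis .
    qed
  qed
qed

lemma nbr2_dist:
  assumes "w \<in> T n" "u \<in> T (n + m)" "take n u \<in> nbr2 n w" "y \<in> X u"
  shows "dist (ctr w) y \<le> 3 * (2 * real CARD('n)) / scl n"
proof -
  obtain v where v: "v \<in> nbr n w" "take n u \<in> nbr n v" using assms(3) by (auto simp: nbr2_def)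
  obtain a where a: "a \<in> X w" "a \<in> X v" "v \<in> T n" using v(1) by (auto simp: nbr_def adj_def)
  obtain b where b: "b \<in> X v" "b \<in> X (take n u)" "take n u \<in> T n" using v(2) by (auto simp: nbr_def adj_def)
  have "y \<in> X (take n u)" using cell_take[OF assms(2)] assms(4) by blast
  then have "dist b y \<le> (2 * real CARD('n)) / scl n" using cell_dist[OF b(3,2)] by blast
  moreover have "dist (ctr w) a \<le> (2 * real CARD('n)) / scl n" using cell_dist[OF assms(1) ctr a(1)] .
  moreover have "dist a b \<le> (2 * real CARD('n)) / scl n" using cell_dist[OF a(3,2) b(1)] .
  moreover have "dist (ctr w) y \<le> dist (ctr w) a + dist a b + dist b y"
    using dist_triangle[of "ctr w" y a] dist_triangle[of a y b] by linarith
  ultimately show ?thesis by simp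
qed

lemma sum_R_powr:
  obtains C where "0 \<le> C" "\<And>n m w. w \<in> T n \<Longrightarrow>
    (\<Sum>u\<in>{u\<in>T (n + m). take n u \<in> nbr2 n w}. R u powr \<alpha>) \<le> C * R w powr \<alpha>"
proof -
  obtain c1 c2 where c: "0 < c1" "0 < c2"
    "\<And>x a b r. x \<in> K \<Longrightarrow> a \<in> K \<Longrightarrow> b \<in> K \<Longrightarrow> 0 < r \<Longrightarrow> r \<le> \<rho> a b \<Longrightarrow>
      ennreal (c1 * r powr \<alpha>) \<le> emeasure \<mu> (M.mball x r)"
    "\<And>x r. x \<in> K \<Longrightarrow> 0 < r \<Longrightarrow> emeasure \<mu> (M.mball x r) \<le> ennreal (c2 * r powr \<alpha>)"
    using ahlfors_bounds by blast
  obtain \<kappa> where \<kappa>: "0 < \<kappa>" "\<kappa> \<le> 1" "\<And>n u v y. u \<in> T n \<Longrightarrow> v \<in> T n \<Longrightarrow> y \<in> X v \<Longrightarrow>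
    y \<in> M.mball (ctr u) (\<kappa> * R u) \<Longrightarrow> v = u" using disjoint_balls by blast
  obtain C where C: "1 \<le> C" "\<And>n w x. w \<in> T n \<Longrightarrow> x \<in> K \<Longrightarrow> dist (ctr w) x \<le> 3 * (2 * real CARD('n)) / scl n \<Longrightarrow> \<rho> (ctr w) x \<le> C * R w"
    using R_near[of "3 * (2 * real CARD('n))"] by auto
  show ?thesis
  proof (rule that[of "c2 * (2 * C) powr \<alpha> / (c1 * \<kappa> powr \<alpha>)"])
    show "0 \<le> c2 * (2 * C) powr \<alpha> / (c1 * \<kappa> powr \<alpha>)" using c by simp
    fix n m w assume w: "w \<in> T n"
    let ?V = "{u\<in>T (n + m). take n u \<in> nbr2 n w}"
    define B where "B u = M.mball (ctr u) (\<kappa> * R u)" for u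
    have sub: "B u \<subseteq> M.mball (ctr w) (2 * C * R w)" if u: "u \<in> ?V" for u
    proof
      fix y assume y: "y \<in> B u"
      then have yK: "y \<in> K" by (simp add: B_def)
      then obtain v where v: "v \<in> T (n + m)" "y \<in> X v" using cell_cover by blast
      then have "v = u" using \<kappa>(3)[of u "n + m" v y] u y by (simp add: B_def)
      then have "dist (ctr w) y \<le> 3 * (2 * real CARD('n)) / scl n" using nbr2_dist[OF w _ _ v(2)] u by blast
      then have "\<rho> (ctr w) y \<le> C * R w" by (rule C(2)[OF w yK])
      also have "\<dots> < 2 * C * R w" using R_pos[OF w] C(1) by simp
      finally show "y \<in> M.mball (ctr w) (2 * C * R w)" using yK ctr_K[OF w] by simp
    qed
    have disj: "disjoint_family_on B ?V"
    proof (unfold disjoint_family_on_def, intro ballI impI)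
      fix u u' assume u: "u \<in> ?V" "u' \<in> ?V" "u \<noteq> u'"
      show "B u \<inter> B u' = {}"
      proof (rule ccontr)
        assume "B u \<inter> B u' \<noteq> {}"
        then obtain y where y: "y \<in> B u" "y \<in> B u'" by blast
        then have "y \<in> K" by (simp add: B_def)
        then obtain v where v: "v \<in> T (n + m)" "y \<in> X v" using cell_cover by blast
        have "v = u" using \<kappa>(3)[of u "n + m" v y] u(1) y(1) v by (simp add: B_def)
        moreover have "v = u'" using \<kappa>(3)[of u' "n + m" v y] u(2) y(2) v by (simp add: B_def)
        ultimately have "u = u'" by simp
        then show False using u(3) by simp
      qed
    qed
    have meas: "B ` ?V \<subseteq> sets \<mu>" using ball_measurable by (auto simp: B_def)
    have lower: "ennreal (c1 * (\<kappa> * R u) powr \<alpha>) \<le> emeasure \<mu> (B u)" if "u \<in> ?V" for u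
    proof -
      have u: "u \<in> T (n + m)" using that by simp
      show ?thesis unfolding B_def
      proof (rule c(3)[OF ctr_K[OF u] ctr_K[OF u] far_K[OF u]])
        show "0 < \<kappa> * R u" using \<kappa> R_pos[OF u] by simp
        show "\<kappa> * R u \<le> \<rho> (ctr u) (far u)"
          using mult_right_mono[OF \<kappa>(2), of "R u"] R_pos[OF u] by (simp add: R_def)
      qed
    qed
    have "ennreal (\<Sum>u\<in>?V. c1 * (\<kappa> * R u) powr \<alpha>) = (\<Sum>u\<in>?V. ennreal (c1 * (\<kappa> * R u) powr \<alpha>))"
      using c by (intro sum_ennreal[symmetric]) auto
    also have "\<dots> \<le> (\<Sum>u\<in>?V. emeasure \<mu> (B u))" by (intro sum_mono lower)
    also have "\<dots> = emeasure \<mu> (\<Union>u\<in>?V. B u)"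
      by (rule sum_emeasure[OF meas disj]) simp
    also have "\<dots> \<le> emeasure \<mu> (M.mball (ctr w) (2 * C * R w))"
      using sub by (intro emeasure_mono ball_measurable) blast
    also have "\<dots> \<le> ennreal (c2 * (2 * C * R w) powr \<alpha>)"
      using R_pos[OF w] C(1) by (intro c(4) ctr_K[OF w]) simp
    finally have "(\<Sum>u\<in>?V. c1 * (\<kappa> * R u) powr \<alpha>) \<le> c2 * (2 * C * R w) powr \<alpha>"
      using c(2) by (subst (asm) ennreal_le_iff) simp_all
    moreover have "(\<Sum>u\<in>?V. c1 * (\<kappa> * R u) powr \<alpha>) = c1 * \<kappa> powr \<alpha> * (\<Sum>u\<in>?V. R u powr \<alpha>)"
      unfolding sum_distrib_left using \<kappa> R_pos
      by (intro sum.cong) (auto simp: powr_mult less_imp_le)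
    moreover have "(2 * C * R w) powr \<alpha> = (2 * C) powr \<alpha> * R w powr \<alpha>"
      by (rule powr_mult)
    moreover have "0 < c1 * \<kappa> powr \<alpha>" using c \<kappa> by simp
    ultimately show "(\<Sum>u\<in>?V. R u powr \<alpha>) \<le> c2 * (2 * C) powr \<alpha> / (c1 * \<kappa> powr \<alpha>) * R w powr \<alpha>"
      by (simp add: pos_le_divide_eq ac_simps)
  qed
qed

lemma conductance_R_bound:
  obtains C where "0 \<le> C" "\<And>m \<epsilon>. 0 \<le> \<epsilon> \<Longrightarrow> (\<And>n u. u \<in> T (n + m) \<Longrightarrow> R u \<le> \<epsilon> * R (take n u)) \<Longrightarrow>
    conductance m \<le> ennreal (C * \<epsilon> powr (p - \<alpha>))"
proof -
  obtain C1 where C1: "1 \<le> C1" "\<And>n w x. w \<in> T n \<Longrightarrow> x \<in> K \<Longrightarrow> dist (ctr w) x \<le> 2 * (2 * real CARD('n)) / scl n \<Longrightarrow> \<rho> (ctr w) x \<le> C1 * R w"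
    using R_near[of "2 * (2 * real CARD('n))"] by auto
  obtain C2 where C2: "1 \<le> C2" "\<And>n w v x y. w \<in> T n \<Longrightarrow> v \<in> T n \<Longrightarrow> X w \<inter> X v = {} \<Longrightarrow>
    x \<in> X w \<Longrightarrow> y \<in> X v \<Longrightarrow> R w \<le> C2 * \<rho> x y" using R_separated by blast
  obtain C3 where C3: "1 \<le> C3" "\<And>n w v. v \<in> nbr n w \<Longrightarrow> R v \<le> C3 * R w" using R_nbr by blast
  obtain C4 where C4: "0 \<le> C4" "\<And>n m w. w \<in> T n \<Longrightarrow>
    (\<Sum>u\<in>{u\<in>T (n + m). take n u \<in> nbr2 n w}. R u powr \<alpha>) \<le> C4 * R w powr \<alpha>" using sum_R_powr by blast
  define C where "C = 2 powr p * deg * (C1 powr p * ((C3 * C3) powr (p - \<alpha>) * C4)) * C2 powr p"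
  show ?thesis
  proof (rule that[of C])
    show "0 \<le> C" using deg_nonneg C4 by (simp add: C_def)
    fix m \<epsilon> assume \<epsilon>: "0 \<le> \<epsilon>" and R\<epsilon>: "\<And>n u. u \<in> T (n + m) \<Longrightarrow> R u \<le> \<epsilon> * R (take n u)"
    show "conductance m \<le> ennreal (C * \<epsilon> powr (p - \<alpha>))"
    proof (rule conductance_le)
      fix n w assume w: "w \<in> T n"
      let ?V = "{u\<in>T (n + m). take n u \<in> nbr2 n w}"
      have Rw: "0 < R w" by (rule R_pos[OF w])
      define t where "t = R w / C2"
      have t: "0 < t" using Rw C2(1) by (simp add: t_def)
      have "\<exists>\<phi>. admissible n m w \<phi> \<and> energy (n + m) \<phi> \<le>
          2 powr p * deg * (\<Sum>u\<in>?V. (C1 * R u) powr p) / t powr p"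
      proof (rule weight_admissible_local[OF w t])
        show "0 \<le> C1 * R u" if "u \<in> T (n + m)" for u using R_pos[OF that] C1(1) by simp
        fix U x y assume U: "U \<subseteq> ?V" "conn (adj (n + m)) U" and x: "x \<in> U" "take n x \<notin> nbr n w"
          and y: "y \<in> U" "take n y = w"
        have UT: "U \<subseteq> T (n + m)" using U(1) by blast
        have xT: "x \<in> T (n + m)" "y \<in> T (n + m)" using UT x y by auto
        have "\<bar>\<rho> (ctr y) (ctr x) - \<rho> (ctr y) (ctr y)\<bar> \<le> (\<Sum>u\<in>U. C1 * R u)"
        proof (rule conn_variation[OF finite_subset[OF UT finite_T] U(2) x(1) y(1)])
          fix u v assume uv: "u \<in> U" "v \<in> U" "(u, v) \<in> adj (n + m)"
          then have uvT: "u \<in> T (n + m)" "v \<in> T (n + m)" using UT by auto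
          obtain q where q: "q \<in> X u" "q \<in> X v" using uv(3) by (auto simp: adj_def)
          have "dist (ctr u) q \<le> (2 * real CARD('n)) / scl (n + m)" "dist q (ctr v) \<le> (2 * real CARD('n)) / scl (n + m)"
            using cell_dist[OF uvT(1) ctr q(1)] cell_dist[OF uvT(2) q(2) ctr] by auto
          then have "dist (ctr u) (ctr v) \<le> 2 * (2 * real CARD('n)) / scl (n + m)"
            using dist_triangle[of "ctr u" "ctr v" q] by simp
          then have "\<rho> (ctr u) (ctr v) \<le> C1 * R u" by (rule C1(2)[OF uvT(1) ctr_K[OF uvT(2)]])
          moreover have "\<rho> (ctr y) (ctr u) \<le> \<rho> (ctr y) (ctr v) + \<rho> (ctr v) (ctr u)"
            "\<rho> (ctr y) (ctr v) \<le> \<rho> (ctr y) (ctr u) + \<rho> (ctr u) (ctr v)"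
            using M.triangle ctr_K uvT xT by blast+
          moreover have "\<rho> (ctr v) (ctr u) = \<rho> (ctr u) (ctr v)" by (rule M.commute)
          ultimately show "\<bar>\<rho> (ctr y) (ctr u) - \<rho> (ctr y) (ctr v)\<bar> \<le> C1 * R u" by linarith
        next
          show "0 \<le> C1 * R u" if "u \<in> U" for u using R_pos[of u "n + m"] UT that C1(1) by auto
        qed
        moreover have "\<rho> (ctr y) (ctr y) = 0" using ctr_K[OF xT(2)] by simp
        moreover have "R w \<le> C2 * \<rho> (ctr y) (ctr x)"
        proof (rule C2(2)[OF w])
          show xn: "take n x \<in> T n" by (rule take_words[OF xT(1)])
          show "X w \<inter> X (take n x) = {}" using x(2) w xn by (auto simp: nbr_def adj_def)
          show "ctr y \<in> X w" using cell_take[OF xT(2)] ctr y(2) by blast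
          show "ctr x \<in> X (take n x)" using cell_take[OF xT(1)] ctr by blast
        qed
        then have "t \<le> \<rho> (ctr y) (ctr x)" using C2(1) by (simp add: t_def pos_divide_le_eq mult.commute)
        ultimately show "t \<le> (\<Sum>u\<in>U. C1 * R u)" by linarith
      qed
      then obtain \<phi> where \<phi>: "admissible n m w \<phi>" "energy (n + m) \<phi> \<le>
          2 powr p * deg * (\<Sum>u\<in>?V. (C1 * R u) powr p) / t powr p" by blast
      have summand: "(C1 * R u) powr p \<le> C1 powr p * ((\<epsilon> * (C3 * C3 * R w)) powr (p - \<alpha>) * R u powr \<alpha>)"
        if u: "u \<in> ?V" for u
      proof -
        have uT: "u \<in> T (n + m)" using u by simp
        obtain v where v: "v \<in> nbr n w" "take n u \<in> nbr n v" using u by (auto simp: nbr2_def)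
        have "R (take n u) \<le> C3 * R v" by (rule C3(2)[OF v(2)])
        also have "\<dots> \<le> C3 * (C3 * R w)" using C3(1) by (intro mult_left_mono C3(2)[OF v(1)]) auto
        finally have "\<epsilon> * R (take n u) \<le> \<epsilon> * (C3 * C3 * R w)" using \<epsilon> by (simp add: mult_left_mono mult.assoc)
        then have "R u \<le> \<epsilon> * (C3 * C3 * R w)" using R\<epsilon>[OF uT] by linarith
        then have le: "R u powr (p - \<alpha>) \<le> (\<epsilon> * (C3 * C3 * R w)) powr (p - \<alpha>)"
          using R_pos[OF uT] \<alpha>(2) by (intro powr_mono2) auto
        have "(C1 * R u) powr p = C1 powr p * (R u powr (p - \<alpha>) * R u powr \<alpha>)"
          using C1(1) R_pos[OF uT] by (simp add: powr_mult powr_add[symmetric])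
        also have "\<dots> \<le> C1 powr p * ((\<epsilon> * (C3 * C3 * R w)) powr (p - \<alpha>) * R u powr \<alpha>)"
          by (intro mult_left_mono mult_right_mono le) auto
        finally show ?thesis .
      qed
      have "(\<Sum>u\<in>?V. (C1 * R u) powr p) \<le>
          (\<Sum>u\<in>?V. C1 powr p * ((\<epsilon> * (C3 * C3 * R w)) powr (p - \<alpha>) * R u powr \<alpha>))"
        by (intro sum_mono summand)
      also have "\<dots> = C1 powr p * ((\<epsilon> * (C3 * C3 * R w)) powr (p - \<alpha>) * (\<Sum>u\<in>?V. R u powr \<alpha>))"
        by (simp only: sum_distrib_left)
      also have "\<dots> \<le> C1 powr p * ((\<epsilon> * (C3 * C3 * R w)) powr (p - \<alpha>) * (C4 * R w powr \<alpha>))"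
        by (intro mult_left_mono C4(2)[OF w]) auto
      also have "(\<epsilon> * (C3 * C3 * R w)) powr (p - \<alpha>) = \<epsilon> powr (p - \<alpha>) * ((C3 * C3) powr (p - \<alpha>) * R w powr (p - \<alpha>))"
        using \<epsilon> C3(1) Rw by (simp add: powr_mult)
      also have "C1 powr p * (\<epsilon> powr (p - \<alpha>) * ((C3 * C3) powr (p - \<alpha>) * R w powr (p - \<alpha>)) * (C4 * R w powr \<alpha>)) =
          C1 powr p * ((C3 * C3) powr (p - \<alpha>) * C4) * \<epsilon> powr (p - \<alpha>) * (R w powr (p - \<alpha>) * R w powr \<alpha>)"
        by (simp only: ac_simps)
      also have "R w powr (p - \<alpha>) * R w powr \<alpha> = R w powr p" using Rw by (simp add: powr_add[symmetric])
      finally have sum: "(\<Sum>u\<in>?V. (C1 * R u) powr p) \<le>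
        C1 powr p * ((C3 * C3) powr (p - \<alpha>) * C4) * \<epsilon> powr (p - \<alpha>) * R w powr p" .
      have tp: "t powr p = R w powr p / C2 powr p" using Rw C2(1) by (simp add: t_def powr_divide)
      note \<phi>(2)
      also have "2 powr p * deg * (\<Sum>u\<in>?V. (C1 * R u) powr p) / t powr p \<le>
          2 powr p * deg * (C1 powr p * ((C3 * C3) powr (p - \<alpha>) * C4) * \<epsilon> powr (p - \<alpha>) * R w powr p) / t powr p"
        using deg_nonneg by (intro divide_right_mono mult_left_mono sum) auto
      also have "\<dots> = C * \<epsilon> powr (p - \<alpha>)"
        unfolding C_def tp using Rw C2(1) by simp
      finally show "\<exists>\<phi>. admissible n m w \<phi> \<and> energy (n + m) \<phi> \<le> C * \<epsilon> powr (p - \<alpha>)"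
        using \<phi>(1) by blast
    qed
  qed
qed

lemma conductance_decay:
  shows "\<exists>C. \<forall>m. conductance m \<le> ennreal C"
    and "0 < \<epsilon> \<Longrightarrow> \<exists>m0. \<forall>m\<ge>m0. conductance m \<le> ennreal \<epsilon>"
proof -
  obtain C where C: "0 \<le> C" "\<And>m \<epsilon>. 0 \<le> \<epsilon> \<Longrightarrow> (\<And>n u. u \<in> T (n + m) \<Longrightarrow> R u \<le> \<epsilon> * R (take n u)) \<Longrightarrow>
    conductance m \<le> ennreal (C * \<epsilon> powr (p - \<alpha>))" using conductance_R_bound by blast
  obtain C' where C': "1 \<le> C'" "\<And>n m u. u \<in> T (n + m) \<Longrightarrow> R u \<le> C' * R (take n u)"
    using R_take_le by blast
  have "conductance m \<le> ennreal (C * C' powr (p - \<alpha>))" for m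
    by (rule C(2)) (use C' in auto)
  then show "\<exists>C. \<forall>m. conductance m \<le> ennreal C" by blast
  assume \<epsilon>: "0 < \<epsilon>"
  define \<delta> where "\<delta> = (\<epsilon> / (C + 1)) powr (1 / (p - \<alpha>))"
  have \<delta>: "0 < \<delta>" "\<delta> powr (p - \<alpha>) = \<epsilon> / (C + 1)" using \<epsilon> C(1) \<alpha> by (auto simp: \<delta>_def powr_powr)
  obtain m0 where m0: "\<And>n m u. m0 \<le> m \<Longrightarrow> u \<in> T (n + m) \<Longrightarrow> R u \<le> \<delta> * R (take n u)"
    using R_take_small[OF \<delta>(1)] by blast
  have "conductance m \<le> ennreal \<epsilon>" if "m0 \<le> m" for m
  proof -
    have "conductance m \<le> ennreal (C * \<delta> powr (p - \<alpha>))" by (rule C(2)) (use \<delta> m0[OF that] in auto)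
    also have "\<dots> \<le> ennreal \<epsilon>" unfolding \<delta>(2) using \<epsilon> C(1) by (intro ennreal_leI) (simp add: field_simps)
    finally show ?thesis .
  qed
  then show "\<exists>m0. \<forall>m\<ge>m0. conductance m \<le> ennreal \<epsilon>" by blast
qed

end

end

section \<open>Conductive homogeneity\<close>

context cubic_tiling_energy
begin

lemma dim_AR_decay:
  assumes "ereal p > dim_AR K dist"
  shows "\<exists>C. \<forall>m. conductance m \<le> ennreal C"
    and "0 < \<epsilon> \<Longrightarrow> \<exists>m0. \<forall>m\<ge>m0. conductance m \<le> ennreal \<epsilon>"
proof -
  obtain \<alpha> \<rho> \<mu> where *: "0 \<le> \<alpha>" "\<alpha> < p" "Metric_space K \<rho>" "quasisymmetric_metrics K dist \<rho>"
    "borel_regular K \<rho> \<mu>" "ahlfors_regular K \<rho> \<alpha> \<mu>"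
    using assms unfolding dim_AR_def Inf_less_iff by auto
  obtain \<theta> \<theta>' where \<theta>: "homeomorphism {0..} {0..} \<theta> \<theta>'"
    "\<forall>x\<in>K. \<forall>y\<in>K. \<forall>z\<in>K. x \<noteq> z \<longrightarrow> \<rho> x y / \<rho> x z \<le> \<theta> (dist x y / dist x z)"
    using *(4) unfolding quasisymmetric_metrics_def by blast
  interpret Q: quasisymmetric_tiling N K S f p \<rho> \<theta>
  proof (rule quasisymmetric_tiling.intro)
    show "cubic_tiling_energy N K S f p" by (rule cubic_tiling_energy_axioms)
    show "quasisymmetric_tiling_axioms K \<rho> \<theta>"
      by (rule quasisymmetric_tiling_axioms.intro)
        (use *(3) \<theta>(2) half_line_homeomorphism_0[OF \<theta>(1)] in auto)
  qed
  show "\<exists>C. \<forall>m. conductance m \<le> ennreal C"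
    by (rule Q.conductance_decay(1)[OF *(1,2,5,6)])
  show "\<exists>m0. \<forall>m\<ge>m0. conductance m \<le> ennreal \<epsilon>" if "0 < \<epsilon>"
    by (rule Q.conductance_decay(2)[OF *(1,2,5,6) that])
qed

lemma osc_bound_mono: "osc_bound m B \<Longrightarrow> B \<le> B' \<Longrightarrow> osc_bound m B'"
  unfolding osc_bound_def using energy_nonneg by (meson mult_right_mono order_trans)

text \<open>Passing from level \<open>m\<close> to level \<open>k + m\<close> multiplies the oscillation bound by a constant that
  does not depend on \<open>k\<close>, while the conductance constant decays; so for large \<open>k\<close> the recursion
  contracts relative to the inverse conductance.\<close>

lemma osc_bound_conductance:
  assumes "SDR K S f" "ereal p > dim_AR K dist"
  obtains H C where "0 \<le> H" "\<And>m. conductance m \<le> ennreal C"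
    "\<And>m e. conductance m = ennreal e \<Longrightarrow> 0 < e \<Longrightarrow> osc_bound m (H / e)"
proof -
  obtain C0 where C0: "\<And>m. conductance m \<le> ennreal C0" using dim_AR_decay(1)[OF assms(2)] by blast
  define e where "e m = enn2real (conductance m)" for m
  have e: "conductance m = ennreal (e m)" "0 < e m" for m
  proof -
    have "conductance m < top" using C0[of m] by (simp add: le_less_trans)
    then show "conductance m = ennreal (e m)" by (simp add: e_def)
    then show "0 < e m" using conductance_pos[of m] by simp
  qed
  obtain k1 where k1: "\<And>k. k1 \<le> k \<Longrightarrow> \<exists>C\<ge>0. \<forall>m B e. 0 \<le> B \<longrightarrow> osc_bound m B \<longrightarrow> 0 < e \<longrightarrow>
    conductance (k + m) = ennreal e \<longrightarrow> osc_bound (k + m) (3 powr p * (2 * B + C / e))"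
    using osc_step[OF assms(1)] by blast
  obtain k2 C2 where C2: "0 \<le> C2" and k2: "\<And>k m a b. k2 \<le> k \<Longrightarrow> conductance k < ennreal a \<Longrightarrow>
    conductance m < ennreal b \<Longrightarrow> conductance (k + m) \<le> ennreal (C2 * a * b)"
    using conductance_submult by blast
  define \<Lambda> where "\<Lambda> = (3::real) powr p"
  have \<Lambda>: "0 < \<Lambda>" by (simp add: \<Lambda>_def)
  define \<epsilon> where "\<epsilon> = 1 / (16 * \<Lambda> * (C2 + 1))"
  have \<epsilon>: "0 < \<epsilon>" using \<Lambda> C2 by (simp add: \<epsilon>_def)
  obtain k3 where k3: "\<And>m. k3 \<le> m \<Longrightarrow> conductance m \<le> ennreal \<epsilon>"
    using dim_AR_decay(2)[OF assms(2) \<epsilon>] by blast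
  define k where "k = max 1 (max k1 (max k2 k3))"
  have k: "1 \<le> k" "k1 \<le> k" "k2 \<le> k" "k3 \<le> k" by (auto simp: k_def)
  have ek: "e k \<le> \<epsilon>" using k3[OF k(4)] e[of k] \<epsilon> by (simp add: ennreal_le_iff)
  have sub: "e (k + m) \<le> e m / (4 * \<Lambda>)" for m
  proof -
    have "conductance k < ennreal (2 * e k)" "conductance m < ennreal (2 * e m)"
      using e by (auto simp: ennreal_less_iff less_imp_le)
    then have "conductance (k + m) \<le> ennreal (C2 * (2 * e k) * (2 * e m))" by (rule k2[OF k(3)])
    then have "e (k + m) \<le> C2 * (2 * e k) * (2 * e m)"
      using e[of "k + m"] e(2)[of k] e(2)[of m] C2 by (simp add: ennreal_le_iff)
    also have "\<dots> \<le> C2 * (2 * \<epsilon>) * (2 * e m)"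
      using ek e(2)[of m] C2 by (intro mult_left_mono mult_right_mono) auto
    also have "\<dots> = (C2 / (C2 + 1)) * (e m / (4 * \<Lambda>))"
    proof -
      have "C2 * (2 * (1 / (16 * \<Lambda> * D))) * (2 * x) = (C2 / D) * (x / (4 * \<Lambda>))" if "0 < D" for D x :: real
        using that \<Lambda> by (simp add: divide_simps)
      then show ?thesis using C2 by (simp add: \<epsilon>_def)
    qed
    also have "\<dots> \<le> 1 * (e m / (4 * \<Lambda>))"
      using C2 \<Lambda> e(2)[of m] by (intro mult_right_mono) auto
    finally show ?thesis by simp
  qed
  obtain Ck where Ck: "0 \<le> Ck" "\<And>m B e. 0 \<le> B \<Longrightarrow> osc_bound m B \<Longrightarrow> 0 < e \<Longrightarrow>
    conductance (k + m) = ennreal e \<Longrightarrow> osc_bound (k + m) (3 powr p * (2 * B + Ck / e))"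
    using k1[OF k(2)] by blast
  have "\<forall>m. \<exists>B. 0 \<le> B \<and> osc_bound m B" using osc_bound_ex by blast
  from choice[OF this] obtain B where B: "\<And>m. 0 \<le> B m" "\<And>m. osc_bound m (B m)" by blast
  define H where "H = 2 * \<Lambda> * Ck + (\<Sum>m<k. B m * e m)"
  have H: "0 \<le> H" "2 * \<Lambda> * Ck \<le> H"
    using \<Lambda> Ck(1) B(1) e(2) by (auto simp: H_def less_imp_le intro!: add_nonneg_nonneg sum_nonneg mult_nonneg_nonneg)
  have bound: "osc_bound m (H / e m)" for m
  proof (induction m rule: less_induct)
    case (less m)
    show ?case
    proof (cases "m < k")
      case True
      have "B m * e m \<le> (\<Sum>m<k. B m * e m)"
        by (rule member_le_sum[of m]) (use True B(1) e(2) in \<open>auto simp: less_imp_le\<close>)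
      also have "\<dots> \<le> H" using \<Lambda> Ck(1) by (simp add: H_def)
      finally have "B m \<le> H / e m" using e(2)[of m] by (simp add: pos_le_divide_eq)
      then show ?thesis using osc_bound_mono B(2) by blast
    next
      case False
      define m' where "m' = m - k"
      have m: "m = k + m'" "m' < m" using False k(1) by (auto simp: m'_def)
      have "osc_bound m (3 powr p * (2 * (H / e m') + Ck / e m))"
        using Ck(2)[of "H / e m'" m' "e m"] less.IH[OF m(2)] H(1) e[of m] e(2)[of m'] m(1) by simp
      moreover have "\<Lambda> * (2 * (H / e m') + Ck / e m) \<le> H / e m"
      proof -
        have "e m \<le> e m' / (4 * \<Lambda>)" using sub[of m'] m(1) by simp
        then have "4 * \<Lambda> * e m \<le> e m'" using \<Lambda> by (simp add: pos_le_divide_eq mult.commute)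
        then have "4 * \<Lambda> / e m' \<le> 1 / e m" using e(2)[of m] e(2)[of m'] by (simp add: divide_simps mult.commute)
        then have "H * (4 * \<Lambda> / e m') \<le> H * (1 / e m)" using H(1) by (rule mult_left_mono)
        moreover have "H * (4 * \<Lambda> / e m') = 2 * (\<Lambda> * (2 * (H / e m')))" "H * (1 / e m) = H / e m" by simp_all
        ultimately have A: "2 * (\<Lambda> * (2 * (H / e m'))) \<le> H / e m" by (simp only:)
        have "2 * \<Lambda> * Ck / e m \<le> H / e m" using H(2) e(2)[of m] by (intro divide_right_mono) auto
        then have B: "2 * (\<Lambda> * (Ck / e m)) \<le> H / e m" by (simp add: mult.assoc)
        have "x + y \<le> z" if "2 * x \<le> z" "2 * y \<le> z" for x y z :: real using that by linarith
        from this[OF A B] show ?thesis by (simp only: distrib_left)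
      qed
      ultimately show ?thesis unfolding \<Lambda>_def by (rule osc_bound_mono)
    qed
  qed
  show ?thesis
  proof (rule that[OF H(1) C0])
    fix m e' assume "conductance m = ennreal e'" "0 < e'"
    then have "e' = e m" using e[of m] by simp
    then show "osc_bound m (H / e')" using bound by simp
  qed
qed

lemma conductive_homogeneity:
  assumes "SDR K S f" "ereal p > dim_AR K dist"
  shows "conductively_homogeneous S X p"
proof -
  obtain H C where H: "0 \<le> H" "\<And>m. conductance m \<le> ennreal C"
    "\<And>m e. conductance m = ennreal e \<Longrightarrow> 0 < e \<Longrightarrow> osc_bound m (H / e)"
    using osc_bound_conductance[OF assms] by blast
  have "neighbour_disparity S X p m * conductance m \<le> ennreal (3 powr p * (2 * H + 2 * C))" for m
  proof -
    define e where "e = enn2real (conductance m)"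
    have "conductance m < top" using H(2)[of m] by (simp add: le_less_trans)
    then have e: "conductance m = ennreal e" by (simp add: e_def)
    then have e0: "0 < e" using conductance_pos[of m] by simp
    have eC: "e \<le> C" using H(2)[of m] e e0 by (cases "0 \<le> C") (auto simp: ennreal_neg)
    have "neighbour_disparity S X p m * conductance m \<le>
        ennreal (3 powr p * (2 * (H / e) + 2)) * ennreal e"
      unfolding e using H(3)[OF e e0] H(1) e0 by (intro mult_right_mono disparity_le) auto
    also have "\<dots> = ennreal (3 powr p * (2 * (H / e) + 2) * e)"
      using H(1) e0 by (simp add: ennreal_mult)
    also have "3 powr p * (2 * (H / e) + 2) * e = 3 powr p * (2 * H + 2 * e)"
      using e0 by (simp add: field_simps)
    also have "ennreal \<dots> \<le> ennreal (3 powr p * (2 * H + 2 * C))"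
      using eC by (intro ennreal_leI mult_left_mono) auto
    finally show ?thesis .
  qed
  then have "(SUP m. neighbour_disparity S X p m * conductance m) \<le> ennreal (3 powr p * (2 * H + 2 * C))"
    by (intro SUP_least)
  then show ?thesis unfolding conductively_homogeneous_def
    by (simp add: le_less_trans infinity_ennreal_def)
qed

end

lemma dim_AR_nonneg: "0 \<le> dim_AR M d"
  unfolding dim_AR_def by (rule Inf_greatest) auto

theorem theorem11p5:
  fixes N :: nat
    and K :: "(real ^ 'n) set"
    and S :: "(nat ^ 'n) set"
    and f :: "nat ^ 'n \<Rightarrow> real ^ 'n \<Rightarrow> real ^ 'n"
    and p :: real
  assumes "N \<ge> 2"
    and "cubic_subsystem N K S f"
    and "nondegenerate K"
    and "locally_symmetric K S f"
    and "strongly_connected S f"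
    and "SDR K S f"
    and "ereal p > dim_AR K dist"
  shows "conductively_homogeneous S (cell f K) p"
proof -
  have "0 < ereal p" using dim_AR_nonneg assms(7) by (rule le_less_trans)
  then interpret cubic_tiling_energy N K S f p
    by unfold_locales (use assms(1-5) in simp_all)
  show ?thesis by (rule conductive_homogeneity[OF assms(6,7)])
qed

end
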